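(* Suppose Assumptions A1, A2, A3 (stated in the context) hold, and let $\{(X^{(t)},\widetilde X^{(t)},\Lambda^{(t)},Y^{(t)},V^{(t)})\}_{t\ge 0}$ be generated by the VRLM algorithm with the SPIDER option, with $q=\mathcal S_2$, $\eta_y=\frac1{4L}$, and $$\eta_x=\min\Big\{\frac{(1-\rho)^2}{180L_P},\ \frac{1}{20(L+1)(12\kappa^2+2\kappa+5)}\Big\},$$ $$\eta_\Lambda=\min\Big\{\frac{5L_P(1-\rho)^2}{24L^2(12\kappa^2+\kappa+1)},\ \frac{1}{2L_P+128L\kappa^2+\frac{(L+1)(20\kappa^2+\kappa+1)}{2}+\frac{4L^2(12\kappa^2+\kappa+1)}{30L_P}}\Big\},$$ where $L_P=L\sqrt{4\kappa^2+1}$. Then for any integer $T\ge1$, $$\frac{1}{4m\eta_x}\sum_{t=0}^{T-1}\mathbb E\|X^{(t+1)}-\bar X^{(t)}\|_F^2+\frac1{2\eta_\Lambda}\sum_{t=0}^{T-1}\mathbb E\|\Lambda^{(t+1)}-\Lambda^{(t)}\|_F^2+\frac1{4m\eta_x}\sum_{t=0}^{T-1}\mathbb E\|X^{(t+1)}-\widetilde X^{(t)}\|_F^2$$ $$+\frac{3}{4m\eta_x}\sum_{t=0}^{T-1}\mathbb E\|X_\perp^{(t)}\|_F^2+\frac1{60mL_P}\sum_{t=0}^{T-1}\mathbb E\|V_{\perp,x}^{(t)}\|_F^2\ \le\ C_0+T\Big(\frac1{30L_P}+\frac1{L_P(1-\rho)^2}+\frac{L+1}{8L^2}\Big)\Upsilon,$$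 where $\Upsilon=\sigma^2/\mathcal S_1$ for general distributions $\{\mathcal D_i\}$, $\Upsilon=0$ for the finite-sum setting (with $\mathcal S_0=\mathcal S_1=n$ and all data samples taken), and $$C_0=\phi(\bar x^{(0)},\Lambda^{(0)})-\phi^*+\Big(\frac1{20mL_P}+\frac{\rho}{15mL_P(1-\rho)}\Big)\mathbb E\|V_{\perp,x}^{(0)}\|_F^2+\Big(\frac{6(L+1)}{64m\kappa}+\frac{L^2}{120mL_P\kappa}+\frac{3L^2}{10mL_P\kappa(1-\rho)^2}\Big)\|\widetilde Y^{(0)}-Y^{(0)}\|_F^2+\Big(\frac{1+1/L}{8}+\frac{L}{30L_P}+\frac{6L}{5L_P(1-\rho)^2}\Big)\hat\delta_0.$$
   Context: **Setting and notation.** $m,d_1,d_2\ge1$ are integers, $[m]=\{1,\dots,m\}$. For $i\in[m]$, $\mathcal D_i$ is a probability distribution and $f_i(x,y)=\mathbb E_{\xi\sim\mathcal D_i}[\tilde f_i(x,y;\xi)]$ on $\mathbb R^{d_1}\times\mathbb R^{d_2}$. The finite-sum setting is the special case $f_i=\frac1n\sum_{j=1}^n\tilde f_i(\cdot,\cdot;\xi_{ij})$, i.e. $\mathcal D_i$ uniform on $\{\xi_{i1},\dots,\xi_{in}\}$. $g:\mathbb R^{d_1}\to\mathbb R\cup\{+\infty\}$ and $h:\mathbb R^{d_2}\to\mathbb R\cup\{+\infty\}$ are closed convex functions. $W=(w_{ij})\in\mathbb R^{m\times m}$ is the mixing matrix, $I$ the identity, $\mathbf 1\in\mathbb R^m$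 the all-ones vector. $X=[x_1,\dots,x_m]^\top\in\mathbb R^{m\times d_1}$, $Y=[y_1,\dots,y_m]^\top\in\mathbb R^{m\times d_2}$, $\Lambda=[\lambda_1,\dots,\lambda_m]^\top\in\mathbb R^{m\times d_2}$. For such a matrix, $\bar x=\frac1m\sum_i x_i$, $\bar X=\mathbf 1\bar x^\top$, $X_\perp=X-\mathbf 1\bar x^\top$ (similarly $V_{\perp,x}=(V_x)_\perp$). $\mathrm{prox}_r(u)=\arg\min_v\{r(v)+\frac12\|v-u\|^2\}$, acting row-wise on matrices. $$\Phi(X,\Lambda,Y)=\frac1m\sum_{i=1}^m\big(f_i(x_i,y_i)-h(y_i)\big)-\frac{L}{2\sqrt m}\langle\Lambda,(W-I)Y\rangle,$$ $P(x,\Lambda)=\max_Y\Phi(\mathbf 1x^\top,\Lambda,Y)$, $\phi(x,\Lambda)=P(x,\Lambda)+g(x)$, $Q(X,\Lambda)=\max_Y\Phi(X,\Lambda,Y)$, $\widetilde Y^{(t)}=\arg\max_Y\Phi(X^{(t)},\Lambda^{(t)},Y)$, and $\hat\delta_t=Q(X^{(t)},\Lambda^{(t)})-\Phi(X^{(t)},\Lambda^{(t)},Y^{(t)})$. **Assumptions.** A1: for each $i$, $f_i(x,\cdot)$ is $\mu$-strongly concave with $\mu>0$; there is $\phi^*\in\mathbb R$ with $\phi(x,\Lambda)\ge\phi^*$ for all $x,\Lambda$; $\mathrm{dom}(h)$ has nonempty relative interior. A2: $\mathrm{Null}(W-I)=\mathrm{Span}\{\mathbf 1\}$, $W^\top\mathbf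 1=\mathbf 1$, $\rho:=\|W-\frac1m\mathbf 1\mathbf 1^\top\|_2<1$, $\|W-I\|_2\le2$. A3: each $f_i$ is $L$-smooth (gradient $L$-Lipschitz), and the stochastic gradient $\tilde\nabla f_i(x,y;\xi)$, $\xi\sim\mathcal D_i$, satisfies (i) $\mathbb E_\xi[\tilde\nabla f_i(x,y;\xi)]=\nabla f_i(x,y)$; (ii) $\mathbb E_\xi\|\tilde\nabla f_i(x,y;\xi)-\nabla f_i(x,y)\|_2^2\le\sigma^2$ for some $\sigma^2\ge0$; (iii) $\mathbb E_\xi\|\tilde\nabla f_i(x,y;\xi)-\tilde\nabla f_i(x',y';\xi)\|_2^2\le L^2(\|x-x'\|_2^2+\|y-y'\|_2^2)$ for all $(x,y),(x',y')$. The condition number is $\kappa=L/\mu$. **VRLM algorithm with SPIDER option.** For a finite sample set $\mathcal B$, $G_i^{(t)}(\mathcal B)=\frac1{|\mathcal B|}\sum_{\xi\in\mathcal B}\tilde\nabla f_i(x_i^{(t)},y_i^{(t)};\xi)$. Random samples on agent $i$ are drawn i.i.d. from $\mathcal D_i$, independently of the past. The batch sizes $\mathcal S_0,\mathcal S_1,\mathcal S_2$ and the period $q$ are positive integers. Start from given $x_i^{(0)}=x^{(0)}\in\mathrm{dom}(g)$, $y_i^{(0)}=y^{(0)}\in\mathrm{dom}(h)$ for all $i$, $\Lambda^{(0)}=0$; $d_i^{(0)}=[d_{x,i}^{(0)};d_{y,i}^{(0)}]=G_i^{(0)}(\mathcal B_i^{(0)})$ with $|\mathcal B_i^{(0)}|=\mathcal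 S_0$; $V_x^{(0)}=D_x^{(0)}$. Here $D_x^{(t)},D_y^{(t)}$ have rows $d_{x,i}^{(t)},d_{y,i}^{(t)}$. For $t\ge1$: - if $t\equiv0\ (\mathrm{mod}\ q)$: $d_i^{(t)}=G_i^{(t)}(\tilde{\mathcal B}_i^{(t)})$ with $|\tilde{\mathcal B}_i^{(t)}|=\mathcal S_1$; otherwise $d_i^{(t)}=G_i^{(t)}(\mathcal B_i^{(t)})-G_i^{(t-1)}(\mathcal B_i^{(t)})+d_i^{(t-1)}$ with $|\mathcal B_i^{(t)}|=\mathcal S_2$; - $V_x^{(t)}=W(V_x^{(t-1)}+D_x^{(t)}-D_x^{(t-1)})$. For $t\ge0$: $V_y^{(t)}=D_y^{(t)}-\frac{L\sqrt m}{2}(W-I)^\top\Lambda^{(t)}$, $\Lambda^{(t+1)}=\Lambda^{(t)}+\frac{L\eta_\Lambda}{2\sqrt m}(W-I)Y^{(t)}$, $\widetilde X^{(t)}=WX^{(t)}$, $X^{(t+1)}=\mathrm{prox}_{\eta_xg}(\widetilde X^{(t)}-\eta_xV_x^{(t)})$, $Y^{(t+1)}=\mathrm{prox}_{\eta_yh}(Y^{(t)}+\eta_yV_y^{(t)})$. In the finite-sum setting one sets $\mathcal S_0=\mathcal S_1=n$ and uses all $n$ local samples in each batch $\mathcal B_i^{(0)},\tilde{\mathcal B}_i^{(t)}$ (so that $G_i^{(t)}=\nabla f_i(x_i^{(t)},y_i^{(t)})$ there). Expectations are over all random samples.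
   Formalization: For general distributions the formal theorem additionally assumes S_1 ≤ S_0; without it the claim fails, since the error σ²/S_0 of the initial batch is not controlled by Υ = σ²/S_1 (e.g. S_0 = 1, T = 1, S_1 large). *)

theory Defs
  imports "HOL-Probability.Probability"
begin

text \<open>
  The agents are indexed by a finite type \<open>'m\<close>, so the number of agents is \<open>CARD('m)\<close>; a matrix with
  one row per agent has type \<open>real ^ 'd ^ 'm\<close>, its row of agent \<open>i\<close> is \<open>X $ i\<close>, and \<open>norm\<close> and
  \<open>inner\<close> on that type are the Frobenius norm and the Frobenius inner product.
\<close>

subsection \<open>Extended-valued convex functions\<close>

definition edom :: "('a \<Rightarrow> ereal) \<Rightarrow> 'a set" where
  "edom r = {v. r v < \<infinity>}"

definition eepigraph :: "('a \<Rightarrow> ereal) \<Rightarrow> ('a \<times> real) set" where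
  "eepigraph r = {(v, c). r v \<le> ereal c}"

definition closed_convex_fun :: "('a::euclidean_space \<Rightarrow> ereal) \<Rightarrow> bool" where
  "closed_convex_fun r \<longleftrightarrow>
     (\<forall>v. r v \<noteq> - \<infinity>) \<and> convex (eepigraph r) \<and> closed (eepigraph r)"

definition prox :: "('a::real_normed_vector \<Rightarrow> ereal) \<Rightarrow> 'a \<Rightarrow> 'a" where
  "prox r u = (ARG_MIN (\<lambda>v. r v + ereal ((norm (v - u))\<^sup>2 / 2)) v. True)"

definition prox_rows :: "(real ^ 'd \<Rightarrow> ereal) \<Rightarrow> real ^ 'd ^ 'm \<Rightarrow> real ^ 'd ^ 'm" where
  "prox_rows r U = (\<chi> i. prox r (U $ i))"

subsection \<open>Smoothness and strong concavity\<close>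

definition grad :: "('a::euclidean_space \<Rightarrow> real) \<Rightarrow> 'a \<Rightarrow> 'a" where
  "grad f z = (THE D. GDERIV f z :> D)"

definition smooth :: "real \<Rightarrow> ('a::euclidean_space \<Rightarrow> real) \<Rightarrow> bool" where
  "smooth L f \<longleftrightarrow> (\<forall>z. \<exists>D. GDERIV f z :> D) \<and> L-lipschitz_on UNIV (grad f)"

definition strongly_concave :: "real \<Rightarrow> ('a::euclidean_space \<Rightarrow> real) \<Rightarrow> bool" where
  "strongly_concave \<mu> f \<longleftrightarrow>
     (\<forall>u v. \<forall>s\<in>{0..1}. f (s *\<^sub>R u + (1 - s) *\<^sub>R v)
        \<ge> s * f u + (1 - s) * f v + \<mu> / 2 * s * (1 - s) * (norm (u - v))\<^sup>2)"

subsection \<open>Consensus matrices\<close>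

definition spectral_norm :: "real ^ 'n ^ 'm \<Rightarrow> real" where
  "spectral_norm A = onorm (\<lambda>v. A *v v)"

definition row_avg :: "real ^ 'd ^ 'm \<Rightarrow> real ^ 'd" where
  "row_avg X = (1 / real CARD('m)) *\<^sub>R (\<Sum>i\<in>UNIV. X $ i)"

text \<open>\<open>rep x\<close> is the matrix \<open>\<one> x\<^sup>T\<close> all of whose rows are \<open>x\<close>.\<close>

definition rep :: "real ^ 'd \<Rightarrow> real ^ 'd ^ 'm" where
  "rep x = (\<chi> i. x)"

definition perp :: "real ^ 'd ^ 'm \<Rightarrow> real ^ 'd ^ 'm" where
  "perp X = X - rep (row_avg X)"

subsection \<open>The reformulated minimax problem\<close>

text \<open>
  Values lie in the extended reals: \<open>Phi = - \<infinity>\<close> as soon as some row of \<open>Y\<close> leaves \<open>edom h\<close>.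
  Maxima over \<open>Y\<close> are suprema here; for strongly concave smooth \<open>f i\<close> and a closed convex \<open>h\<close> with
  nonempty domain they are attained, at a unique point.
\<close>

definition Phi :: "real \<Rightarrow> real ^ 'm ^ 'm \<Rightarrow> ('m \<Rightarrow> (real ^ 'a) \<times> (real ^ 'b) \<Rightarrow> real) \<Rightarrow>
    (real ^ 'b \<Rightarrow> ereal) \<Rightarrow> real ^ 'a ^ 'm \<Rightarrow> real ^ 'b ^ 'm \<Rightarrow> real ^ 'b ^ 'm \<Rightarrow> ereal" where
  "Phi L W f h X \<Lambda> Y =
     ereal (1 / real CARD('m)) * (\<Sum>i\<in>UNIV. ereal (f i (X $ i, Y $ i)) - h (Y $ i))
     - ereal (L / (2 * sqrt (real CARD('m))) * inner \<Lambda> ((W - mat 1) ** Y))"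

definition Qmax :: "real \<Rightarrow> real ^ 'm ^ 'm \<Rightarrow> ('m \<Rightarrow> (real ^ 'a) \<times> (real ^ 'b) \<Rightarrow> real) \<Rightarrow>
    (real ^ 'b \<Rightarrow> ereal) \<Rightarrow> real ^ 'a ^ 'm \<Rightarrow> real ^ 'b ^ 'm \<Rightarrow> ereal" where
  "Qmax L W f h X \<Lambda> = (SUP Y. Phi L W f h X \<Lambda> Y)"

definition Pmax :: "real \<Rightarrow> real ^ 'm ^ 'm \<Rightarrow> ('m \<Rightarrow> (real ^ 'a) \<times> (real ^ 'b) \<Rightarrow> real) \<Rightarrow>
    (real ^ 'b \<Rightarrow> ereal) \<Rightarrow> real ^ 'a \<Rightarrow> real ^ 'b ^ 'm \<Rightarrow> ereal" where
  "Pmax L W f h x \<Lambda> = (SUP Y. Phi L W f h (rep x) \<Lambda> Y)"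

definition phi :: "real \<Rightarrow> real ^ 'm ^ 'm \<Rightarrow> ('m \<Rightarrow> (real ^ 'a) \<times> (real ^ 'b) \<Rightarrow> real) \<Rightarrow>
    (real ^ 'a \<Rightarrow> ereal) \<Rightarrow> (real ^ 'b \<Rightarrow> ereal) \<Rightarrow> real ^ 'a \<Rightarrow> real ^ 'b ^ 'm \<Rightarrow> ereal" where
  "phi L W f g h x \<Lambda> = Pmax L W f h x \<Lambda> + g x"

definition Yopt :: "real \<Rightarrow> real ^ 'm ^ 'm \<Rightarrow> ('m \<Rightarrow> (real ^ 'a) \<times> (real ^ 'b) \<Rightarrow> real) \<Rightarrow>
    (real ^ 'b \<Rightarrow> ereal) \<Rightarrow> real ^ 'a ^ 'm \<Rightarrow> real ^ 'b ^ 'm \<Rightarrow> real ^ 'b ^ 'm" where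
  "Yopt L W f h X \<Lambda> = (ARG_MAX (Phi L W f h X \<Lambda>) Y. True)"

subsection \<open>The VRLM algorithm with SPIDER gradient estimators\<close>

text \<open>A batch is a list of samples, so that repeated draws are counted with multiplicity.\<close>

definition batch_grad :: "('z::real_vector \<Rightarrow> 's \<Rightarrow> 'z) \<Rightarrow> 's list \<Rightarrow> 'z \<Rightarrow> 'z" where
  "batch_grad sg b z = (1 / real (length b)) *\<^sub>R (\<Sum>s\<leftarrow>b. sg z s)"

text \<open>
  One trajectory of the algorithm, for a given choice \<open>B i t\<close> of the batch of agent \<open>i\<close> at
  iteration \<open>t\<close>. The estimator \<open>d t i\<close> is the pair of its \<open>x\<close>-part and its \<open>y\<close>-part.
\<close>

definition vrlm_spider :: "real \<Rightarrow> real ^ 'm ^ 'm \<Rightarrow> (real ^ 'a \<Rightarrow> ereal) \<Rightarrow> (real ^ 'b \<Rightarrow> ereal) \<Rightarrow>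
    ('m \<Rightarrow> (real ^ 'a) \<times> (real ^ 'b) \<Rightarrow> 's \<Rightarrow> (real ^ 'a) \<times> (real ^ 'b)) \<Rightarrow>
    nat \<Rightarrow> real \<Rightarrow> real \<Rightarrow> real \<Rightarrow> real ^ 'a \<Rightarrow> real ^ 'b \<Rightarrow> ('m \<Rightarrow> nat \<Rightarrow> 's list) \<Rightarrow>
    (nat \<Rightarrow> real ^ 'a ^ 'm) \<Rightarrow> (nat \<Rightarrow> real ^ 'a ^ 'm) \<Rightarrow> (nat \<Rightarrow> real ^ 'b ^ 'm) \<Rightarrow>
    (nat \<Rightarrow> real ^ 'b ^ 'm) \<Rightarrow> (nat \<Rightarrow> 'm \<Rightarrow> (real ^ 'a) \<times> (real ^ 'b)) \<Rightarrow>
    (nat \<Rightarrow> real ^ 'a ^ 'm) \<Rightarrow> (nat \<Rightarrow> real ^ 'b ^ 'm) \<Rightarrow> bool" where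
  "vrlm_spider L W g h sg q \<eta>x \<eta>y \<eta>\<Lambda> x0 y0 B X Xt \<Lambda> Y d Vx Vy \<longleftrightarrow>
     X 0 = rep x0 \<and> Y 0 = rep y0 \<and> \<Lambda> 0 = 0 \<and>
     (\<forall>t i. d t i =
        (if t mod q = 0 then batch_grad (sg i) (B i t) (X t $ i, Y t $ i)
         else batch_grad (sg i) (B i t) (X t $ i, Y t $ i)
              - batch_grad (sg i) (B i t) (X (t - 1) $ i, Y (t - 1) $ i)
              + d (t - 1) i)) \<and>
     Vx 0 = (\<chi> i. fst (d 0 i)) \<and>
     (\<forall>t. Vx (Suc t) = W ** (Vx t + (\<chi> i. fst (d (Suc t) i)) - (\<chi> i. fst (d t i)))) \<and>
     (\<forall>t. Vy t = (\<chi> i. snd (d t i))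
        - (L * sqrt (real CARD('m)) / 2) *\<^sub>R (transpose (W - mat 1) ** \<Lambda> t)) \<and>
     (\<forall>t. \<Lambda> (Suc t) = \<Lambda> t
        + (L * \<eta>\<Lambda> / (2 * sqrt (real CARD('m)))) *\<^sub>R ((W - mat 1) ** Y t)) \<and>
     (\<forall>t. Xt t = W ** X t) \<and>
     (\<forall>t. X (Suc t) = prox_rows (\<lambda>v. ereal \<eta>x * g v) (Xt t - \<eta>x *\<^sub>R Vx t)) \<and>
     (\<forall>t. Y (Suc t) = prox_rows (\<lambda>v. ereal \<eta>y * h v) (Y t + \<eta>y *\<^sub>R Vy t))"

subsection \<open>Sampling\<close>

text \<open>
  At iteration \<open>t\<close> agent \<open>i\<close> draws \<open>b t\<close> samples \<open>\<xi> i t k\<close>, \<open>k < b t\<close>. The events of the past are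
  those generated by all samples drawn by all agents before iteration \<open>t\<close>. In \<open>fresh_iid\<close>, the index
  \<open>None\<close> stands for the past and \<open>Some k\<close> for the \<open>k\<close>-th sample of the current batch; samples drawn
  by different agents in the same iteration may be dependent.
\<close>

definition past_events :: "'w measure \<Rightarrow> ('m \<Rightarrow> 's measure) \<Rightarrow> ('m \<Rightarrow> nat \<Rightarrow> nat \<Rightarrow> 'w \<Rightarrow> 's) \<Rightarrow>
    (nat \<Rightarrow> nat) \<Rightarrow> nat \<Rightarrow> 'w set set" where
  "past_events M D \<xi> b t = sigma_sets (space M)
     {\<xi> j s k -` A \<inter> space M | j s k A. s < t \<and> k < b s \<and> A \<in> sets (D j)}"

definition fresh_iid :: "'w measure \<Rightarrow> ('m \<Rightarrow> 's measure) \<Rightarrow> ('m \<Rightarrow> nat \<Rightarrow> nat \<Rightarrow> 'w \<Rightarrow> 's) \<Rightarrow>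
    (nat \<Rightarrow> nat) \<Rightarrow> bool" where
  "fresh_iid M D \<xi> b \<longleftrightarrow>
     (\<forall>i t. (\<forall>k<b t. \<xi> i t k \<in> measurable M (D i) \<and> distr M (D i) (\<xi> i t k) = D i) \<and>
        prob_space.indep_sets M
          (case_option (past_events M D \<xi> b t)
             (\<lambda>k. {\<xi> i t k -` A \<inter> space M | A. A \<in> sets (D i)}))
          (insert None (Some ` {..<b t})))"

definition general_setting :: "'w measure \<Rightarrow> ('m \<Rightarrow> 's measure) \<Rightarrow>
    ('m \<Rightarrow> nat \<Rightarrow> nat \<Rightarrow> 'w \<Rightarrow> 's) \<Rightarrow> nat \<Rightarrow> nat \<Rightarrow> nat \<Rightarrow> nat \<Rightarrow>
    ('m \<Rightarrow> nat \<Rightarrow> 'w \<Rightarrow> 's list) \<Rightarrow> bool" where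
  "general_setting M D \<xi> q S0 S1 S2 B \<longleftrightarrow>
     (let b = (\<lambda>t. if t = 0 then S0 else if t mod q = 0 then S1 else S2) in
        fresh_iid M D \<xi> b \<and>
        (\<forall>i t \<omega>. B i t \<omega> = map (\<lambda>k. \<xi> i t k \<omega>) [0..<b t]))"

text \<open>
  Agent \<open>i\<close> owns the data points \<open>data i j\<close>, \<open>j < n\<close>, with possible repetitions, and \<open>D i\<close> is the
  law of \<open>data i j\<close> for uniform \<open>j\<close>. Its underlying space is the finite set of data points. When
  \<open>t mod q = 0\<close> the batch is the whole data set and nothing is drawn.
\<close>

definition finite_sum_setting :: "'w measure \<Rightarrow> ('m \<Rightarrow> 's measure) \<Rightarrow>
    ('m \<Rightarrow> nat \<Rightarrow> nat \<Rightarrow> 'w \<Rightarrow> 's) \<Rightarrow> nat \<Rightarrow> nat \<Rightarrow> nat \<Rightarrow> nat \<Rightarrow>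
    nat \<Rightarrow> ('m \<Rightarrow> nat \<Rightarrow> 's) \<Rightarrow> ('m \<Rightarrow> nat \<Rightarrow> 'w \<Rightarrow> 's list) \<Rightarrow> bool" where
  "finite_sum_setting M D \<xi> q S0 S1 S2 n data B \<longleftrightarrow>
     S0 = n \<and> S1 = n \<and>
     (\<forall>i. D i = distr (uniform_count_measure {..<n}) (count_space (data i ` {..<n})) (data i)) \<and>
     fresh_iid M D \<xi> (\<lambda>t. if t mod q = 0 then 0 else S2) \<and>
     (\<forall>i t \<omega>. B i t \<omega> =
        (if t mod q = 0 then map (data i) [0..<n] else map (\<lambda>k. \<xi> i t k \<omega>) [0..<S2]))"

text \<open>
  The expectation of a squared norm, as a value in \<open>[0, \<infinity>]\<close>, so that a bound on it includes
  square integrability.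
\<close>

definition Esq :: "'w measure \<Rightarrow> ('w \<Rightarrow> 'v::real_normed_vector) \<Rightarrow> ereal" where
  "Esq M Z = enn2ereal (\<integral>\<^sup>+ \<omega>. ennreal ((norm (Z \<omega>))\<^sup>2) \<partial>M)"

end

theory Submission
  imports Defs
begin

text \<open>
  Along every single run the potential \<open>\<phi>(avg X, \<Lambda>)\<close>, the squared distance from \<open>Y\<close> to the
  maximizer of \<open>Phi X \<Lambda>\<close>, the duality gap \<open>Q - \<Phi>\<close>, and the two consensus errors satisfy one-step
  inequalities whose only random input is the error of the gradient estimator. The three-point
  inequality of the proximal map gives descent of the potential, a contraction of the distance and a
  decrease of the gap; \<open>\<rho> < 1\<close> contracts the consensus errors. Independence of the samples enters only
  in bounding the summed squared estimator error by \<open>\<Upsilon>\<close> per step plus \<open>L\<^sup>2\<close> times the summed squared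
  steps in \<open>X\<close> and \<open>Y\<close>. The step sizes are small enough for the resulting linear system of
  inequalities between expected sums of squares to close.
\<close>

subsection \<open>Closed convex functions and proximal maps\<close>

text \<open>Estimation error, steps in \<open>Y\<close> and distance to the maximizer bound one
  another in a circle: the SPIDER error is fed by the steps, the steps by the gap, the gap by the
  distance, the distance by the error. The circle opens in \<open>combination\<close>: with dual
  step size \<open>1 / (4 * L)\<close> the gap inequality controls \<open>3 * L\<close> times the
  squared steps, while only \<open>3 / 4 * L\<close> of them returns. What survives are multiples of
  the squared primal distances and multiplier steps, which the lower bounds on
  \<open>1 / \<eta>\<close> and \<open>1 / \<eta>'\<close> absorb. Everything is scaled by the
  number \<open>m\<close> of agents, so that sums over rows are Frobenius norms; steps in
  \<open>\<Lambda>\<close> carry the weight \<open>sqrt m\<close>, which gives them the same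
  constant \<open>L\<close> as steps in \<open>X\<close>. The pathwise inequalities are linear in
  sums of squares and hence survive integration once the process is square integrable. Conditioning
  on the past is replaced by Fubini on a product law. The two sampling settings differ only where
  the estimator restarts: there its error is a batch variance or zero.\<close>

lemma ereal_on_edom:
  assumes "closed_convex_fun r" "v \<in> edom r"
  shows "r v = ereal (real_of_ereal (r v))"
  using assms by (cases "r v") (auto simp: closed_convex_fun_def edom_def)

lemma outside_edom: "v \<notin> edom r \<Longrightarrow> r v = \<infinity>"
  by (simp add: edom_def)

lemma closed_convex_funD:
  assumes r: "closed_convex_fun r" and "u \<in> edom r" "v \<in> edom r" "s \<in> {0..1}"
  shows "s *\<^sub>R u + (1 - s) *\<^sub>R v \<in> edom r"
    and "real_of_ereal (r (s *\<^sub>R u + (1 - s) *\<^sub>R v))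
      \<le> s * real_of_ereal (r u) + (1 - s) * real_of_ereal (r v)"
proof -
  let ?w = "s *\<^sub>R u + (1 - s) *\<^sub>R v" and ?c = "s * real_of_ereal (r u) + (1 - s) * real_of_ereal (r v)"
  have "(u, real_of_ereal (r u)) \<in> eepigraph r" "(v, real_of_ereal (r v)) \<in> eepigraph r"
    using ereal_on_edom[OF r] assms by (auto simp: eepigraph_def)
  then have "s *\<^sub>R (u, real_of_ereal (r u)) + (1 - s) *\<^sub>R (v, real_of_ereal (r v)) \<in> eepigraph r"
    using r assms(4) by (intro convexD) (auto simp: closed_convex_fun_def)
  then have le: "r ?w \<le> ereal ?c" by (simp add: eepigraph_def)
  then show 1: "?w \<in> edom r" by (auto simp: edom_def)
  show "real_of_ereal (r ?w) \<le> ?c"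
    using le ereal_on_edom[OF r 1] by (metis ereal_less_eq(3))
qed

text \<open>The proximal step controls \<open>g\<close> row by row, whereas the potential is
  evaluated at the average of the rows; this is the bridge between the two.\<close>

lemma closed_convex_fun_jensen:
  assumes r: "closed_convex_fun r" and fin: "finite I" and ne: "I \<noteq> {}" and dom: "\<And>i. i \<in> I \<Longrightarrow> x i \<in> edom r"
  shows "(1 / real (card I)) *\<^sub>R (\<Sum>i\<in>I. x i) \<in> edom r"
    and "real_of_ereal (r ((1 / real (card I)) *\<^sub>R (\<Sum>i\<in>I. x i)))
      \<le> (1 / real (card I)) * (\<Sum>i\<in>I. real_of_ereal (r (x i)))"
proof -
  have c: "convex (edom r)"
    using closed_convex_funD(1)[OF r] by (auto simp: convex_alt algebra_simps)
  have cf: "convex_on (edom r) (\<lambda>v. real_of_ereal (r v))"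
  proof (intro convex_onI c)
    fix t u v assume "0 < t" "t < (1::real)" "u \<in> edom r" "v \<in> edom r"
    then show "real_of_ereal (r ((1 - t) *\<^sub>R u + t *\<^sub>R v)) \<le> (1 - t) * real_of_ereal (r u) + t * real_of_ereal (r v)"
      using closed_convex_funD(2)[OF r, of u v "1 - t"] by simp
  qed
  have card: "real (card I) > 0" using fin ne by (simp add: card_gt_0_iff)
  have s1: "(\<Sum>i\<in>I. 1 / real (card I)) = 1" using card by simp
  show "(1 / real (card I)) *\<^sub>R (\<Sum>i\<in>I. x i) \<in> edom r"
    unfolding scaleR_sum_right by (rule convex_sum[OF fin c s1]) (use dom in auto)
  show "real_of_ereal (r ((1 / real (card I)) *\<^sub>R (\<Sum>i\<in>I. x i)))
      \<le> (1 / real (card I)) * (\<Sum>i\<in>I. real_of_ereal (r (x i)))"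
    using convex_on_sum[OF fin ne cf s1] dom by (simp add: scaleR_sum_right sum_distrib_left)
qed

text \<open>Reduced to \<open>strongly_concave\<close> by negation, so that assumption A1 on
  \<open>f\<close> passes directly to the minimization problems below.\<close>

definition strongly_convex :: "real \<Rightarrow> ('a::euclidean_space \<Rightarrow> real) \<Rightarrow> bool" where
  "strongly_convex c p \<longleftrightarrow> strongly_concave c (\<lambda>v. - p v)"

lemma strongly_convexD:
  assumes "strongly_convex c p" "s \<in> {0..1}"
  shows "p (s *\<^sub>R u + (1 - s) *\<^sub>R v) \<le> s * p u + (1 - s) * p v - c / 2 * s * (1 - s) * (norm (u - v))\<^sup>2"
  using assms unfolding strongly_convex_def strongly_concave_def by (smt (verit) mult_minus_right)

lemma strongly_convex_linear_minus:
  assumes "strongly_concave c k"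
  shows "strongly_convex c (\<lambda>y. b * inner a y - k y)"
  unfolding strongly_convex_def strongly_concave_def
proof (intro allI ballI)
  fix u v and s :: real assume "s \<in> {0..1}"
  then have "s * k u + (1 - s) * k v + c / 2 * s * (1 - s) * (norm (u - v))\<^sup>2 \<le> k (s *\<^sub>R u + (1 - s) *\<^sub>R v)"
    using assms by (auto simp: strongly_concave_def)
  moreover have "b * inner a (s *\<^sub>R u + (1 - s) *\<^sub>R v) = s * (b * inner a u) + (1 - s) * (b * inner a v)"
    by (simp add: inner_add_right algebra_simps)
  ultimately show "s * - (b * inner a u - k u) + (1 - s) * - (b * inner a v - k v) + c / 2 * s * (1 - s) * (norm (u - v))\<^sup>2
    \<le> - (b * inner a (s *\<^sub>R u + (1 - s) *\<^sub>R v) - k (s *\<^sub>R u + (1 - s) *\<^sub>R v))"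
    by (simp add: right_diff_distrib)
qed

text \<open>Lower semicontinuity of \<open>r\<close> is available only as closedness of its
  epigraph. The sublevel set at the level of \<open>u\<close> is the preimage of the epigraph under
  the continuous map \<open>\<lambda>v. (v, G u - p v)\<close>, hence closed. Finitely many such
  sets share the best of their base points, so by compactness all of them meet in \<open>K\<close>,
  and a common point is a minimizer.\<close>

lemma attains_min_compact:
  assumes r: "closed_convex_fun r" and p: "continuous_on UNIV p" and K: "compact K" "K \<inter> edom r \<noteq> {}"
  shows "\<exists>v\<in>K \<inter> edom r. \<forall>u\<in>K \<inter> edom r. real_of_ereal (r v) + p v \<le> real_of_ereal (r u) + p u"
proof -
  define G where "G v = real_of_ereal (r v) + p v" for v
  define S where "S u = {v. r v \<le> ereal (G u - p v)}" for u
  have S: "v \<in> S u \<longleftrightarrow> v \<in> edom r \<and> G v \<le> G u" for u v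
  proof (cases "v \<in> edom r")
    case True
    show ?thesis unfolding S_def mem_Collect_eq G_def
      by (subst ereal_on_edom[OF r True]) (use True in auto)
  qed (auto simp: S_def outside_edom)
  have clS: "closed (S u)" for u
  proof -
    have "S u = (\<lambda>v. (v, G u - p v)) -` eepigraph r" by (auto simp: S_def eepigraph_def)
    moreover have "closed ((\<lambda>v. (v, G u - p v)) -` eepigraph r)"
      using r p by (intro closed_vimage) (auto intro!: continuous_intros simp: closed_convex_fun_def)
    ultimately show ?thesis by simp
  qed
  have "K \<inter> \<Inter>(S ` (K \<inter> edom r)) \<noteq> {}"
  proof (rule compact_imp_fip)
    show "compact K" by fact
    show "closed T" if "T \<in> S ` (K \<inter> edom r)" for T using that clS by auto
    fix F assume F: "finite F" "F \<subseteq> S ` (K \<inter> edom r)"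
    then obtain U where U: "finite U" "U \<subseteq> K \<inter> edom r" "F = S ` U" by (meson finite_subset_image)
    show "K \<inter> \<Inter>F \<noteq> {}"
    proof (cases "U = {}")
      case True then show ?thesis using K U by auto
    next
      case False
      then obtain w where "w \<in> U" "\<And>u. u \<in> U \<Longrightarrow> G w \<le> G u"
        using U(1) ex_min_if_finite[of "G ` U"] by (metis (no_types, lifting) finite_imageI image_iff image_is_empty not_le)
      then have "w \<in> K \<inter> \<Inter>F" using U S by auto
      then show ?thesis by blast
    qed
  qed
  then obtain v where v: "v \<in> K" "\<And>u. u \<in> K \<inter> edom r \<Longrightarrow> v \<in> S u" by auto
  obtain u0 where "u0 \<in> K \<inter> edom r" using K by auto
  then have "v \<in> K \<inter> edom r" using v S by auto
  moreover have "\<forall>u\<in>K \<inter> edom r. G v \<le> G u" using v S by auto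
  ultimately show ?thesis unfolding G_def by blast
qed

text \<open>
  Coercivity comes for free: strong convexity along the ray from \<open>v0\<close> through a far point, compared
  with the minimum over the unit ball around \<open>v0\<close>, forces quadratic growth.
\<close>

lemma attains_min:
  fixes r :: "'a::euclidean_space \<Rightarrow> ereal"
  assumes r: "closed_convex_fun r" and p: "continuous_on UNIV p" and c: "c > 0" "strongly_convex c p"
    and dom: "edom r \<noteq> {}"
  shows "\<exists>v\<in>edom r. \<forall>u\<in>edom r. real_of_ereal (r v) + p v + c / 2 * (norm (u - v))\<^sup>2 \<le> real_of_ereal (r u) + p u"
proof -
  define G where "G v = real_of_ereal (r v) + p v" for v
  have G: "G (s *\<^sub>R u + (1 - s) *\<^sub>R v) \<le> s * G u + (1 - s) * G v - c / 2 * s * (1 - s) * (norm (u - v))\<^sup>2"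
    if "u \<in> edom r" "v \<in> edom r" "s \<in> {0..1}" for u v s
    using closed_convex_funD(2)[OF r that] strongly_convexD[OF c(2) that(3), of u v]
    unfolding G_def by (simp add: algebra_simps)
  obtain v0 where v0: "v0 \<in> edom r" using dom by auto
  obtain a where a: "\<And>u. u \<in> cball v0 1 \<inter> edom r \<Longrightarrow> a \<le> G u"
    using attains_min_compact[OF r p, of "cball v0 1"] v0 unfolding G_def by (metis IntI centre_in_cball compact_cball empty_iff zero_le_one)
  \<comment> \<open>Beyond this radius the quadratic gain \<open>c / 2 * (t - 1)\<close> outweighs
    the largest possible drop \<open>G v0 - a\<close> inside the unit ball.\<close>
  define R where "R = max 1 (2 * (G v0 - a) / c + 1)"
  have far: "G v0 \<le> G v" if v: "v \<in> edom r" "dist v0 v > R" for v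
  proof -
    define t where "t = norm (v - v0)"
    have t: "t > 1" "t > 2 * (G v0 - a) / c + 1" using v(2) by (auto simp: R_def t_def dist_norm norm_minus_commute)
    define w where "w = (1/t) *\<^sub>R v + (1 - 1/t) *\<^sub>R v0"
    have "w - v0 = (1/t) *\<^sub>R (v - v0)" by (simp add: w_def algebra_simps)
    then have "norm (w - v0) = 1" using t(1) by (simp add: t_def[symmetric])
    then have "w \<in> cball v0 1" by (simp add: dist_norm norm_minus_commute)
    moreover have "w \<in> edom r" unfolding w_def using t v v0 by (intro closed_convex_funD(1)[OF r]) auto
    ultimately have "a \<le> G w" using a by auto
    also have "\<dots> \<le> (1/t) * G v + (1 - 1/t) * G v0 - c / 2 * (1/t) * (1 - 1/t) * t\<^sup>2"
      unfolding w_def t_def[symmetric] using G[of v v0 "1/t"] t(1) v v0 by (simp only: t_def[symmetric]) auto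
    also have "\<dots> = G v0 + (1/t) * (G v - G v0) - c / 2 * (t - 1)"
      using t(1) by (simp add: field_simps power2_eq_square)
    finally have "G v0 - a - c / 2 * (t - 1) + (1/t) * (G v - G v0) \<ge> 0" by simp
    moreover have "G v0 - a - c / 2 * (t - 1) \<le> 0" using t(2) c(1) by (simp add: field_simps)
    ultimately have "(1/t) * (G v - G v0) \<ge> 0" by linarith
    then show ?thesis using t(1) by (simp add: zero_le_divide_iff)
  qed
  have "R \<ge> 1" by (simp add: R_def)
  then have v0K: "v0 \<in> cball v0 R \<inter> edom r" using v0 by simp
  obtain v where v: "v \<in> cball v0 R \<inter> edom r" "\<And>u. u \<in> cball v0 R \<inter> edom r \<Longrightarrow> G v \<le> G u"
    using attains_min_compact[OF r p, of "cball v0 R"] v0K unfolding G_def by (metis compact_cball empty_iff)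
  have min: "G v \<le> G u" if "u \<in> edom r" for u
  proof (cases "dist v0 u > R")
    case True then show ?thesis using far[OF that] v(2)[OF v0K] by auto
  qed (use v that in auto)
  have "G v + c / 2 * (norm (u - v))\<^sup>2 \<le> G u" if u: "u \<in> edom r" for u
  proof -
    \<comment> \<open>Minimality against points on the segment, divided by its parameter
      \<open>s\<close>, gives quadratic growth up to a factor \<open>1 - s\<close>, which tends to
      1.\<close>
    have *: "(1 - s) * (c / 2 * (norm (u - v))\<^sup>2) \<le> G u - G v" if s: "0 < s" "s < 1" for s
    proof -
      have "G v \<le> G (s *\<^sub>R u + (1 - s) *\<^sub>R v)" using v u s by (intro min closed_convex_funD(1)[OF r]) auto
      also have "\<dots> \<le> s * G u + (1 - s) * G v - c / 2 * s * (1 - s) * (norm (u - v))\<^sup>2"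
        using G v u s by auto
      finally have "0 \<le> s * (G u - G v - (1 - s) * (c / 2 * (norm (u - v))\<^sup>2))" by (simp add: algebra_simps)
      then show ?thesis using s by (simp add: zero_le_mult_iff)
    qed
    have "c / 2 * (norm (u - v))\<^sup>2 \<le> G u - G v"
    proof (rule tendsto_upperbound)
      show "((\<lambda>s. (1 - s) * (c / 2 * (norm (u - v))\<^sup>2)) \<longlongrightarrow> c / 2 * (norm (u - v))\<^sup>2) (at_right 0)"
        by (auto intro!: tendsto_eq_intros)
      show "\<forall>\<^sub>F s in at_right 0. (1 - s) * (c / 2 * (norm (u - v))\<^sup>2) \<le> G u - G v"
        using * by (auto simp: eventually_at_right_field intro!: exI[of _ 1])
    qed simp
    then show ?thesis by simp
  qed
  then show ?thesis using v unfolding G_def by auto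
qed

lemma strongly_convex_half_sqdist:
  fixes u :: "'a::euclidean_space"
  shows "strongly_convex a (\<lambda>v. a * ((norm (v - u))\<^sup>2 / 2))"
proof -
  have nsq: "(norm ((s *\<^sub>R x + (1 - s) *\<^sub>R y) - u))\<^sup>2 = s * (norm (x - u))\<^sup>2 + (1 - s) * (norm (y - u))\<^sup>2 - s * (1 - s) * (norm (x - y))\<^sup>2"
    for s and x y :: 'a
    unfolding power2_norm_eq_inner by (simp add: algebra_simps inner_commute)
  then show ?thesis
    unfolding strongly_convex_def strongly_concave_def nsq by (auto simp: field_simps)
qed

text \<open>\<open>prox\<close> is only a chosen minimizer, so existence comes first. Divided by
  \<open>\<eta>\<close>, the objective is \<open>r\<close> plus a function that is strongly convex
  with modulus \<open>1 / \<eta>\<close>, and the quadratic growth from \<open>attains_min\<close>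
  both forces the chosen point to be the minimizer found there and yields the three-point
  inequality.\<close>

lemma prox_props:
  fixes r :: "'a::euclidean_space \<Rightarrow> ereal" and u :: 'a
  assumes r: "closed_convex_fun r" and dom: "edom r \<noteq> {}" and e: "\<eta> > 0"
  defines "w \<equiv> prox (\<lambda>v. ereal \<eta> * r v) u"
  shows prox_in_edom: "w \<in> edom r"
    and prox_ineq: "v \<in> edom r \<Longrightarrow> real_of_ereal (r w) + ((norm (w - u))\<^sup>2 + (norm (v - w))\<^sup>2) / (2 * \<eta>)
            \<le> real_of_ereal (r v) + (norm (v - u))\<^sup>2 / (2 * \<eta>)"
proof -
  define F where "F v = ereal \<eta> * r v + ereal ((norm (v - u))\<^sup>2 / 2)" for v
  define G where "G v = real_of_ereal (r v) + (1/\<eta>) * ((norm (v - u))\<^sup>2 / 2)" for v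
  have FG: "F v = ereal (\<eta> * G v)" if "v \<in> edom r" for v
    unfolding F_def G_def by (subst ereal_on_edom[OF r that]) (use e in \<open>simp add: field_simps\<close>)
  have Finf: "F v = \<infinity>" if "v \<notin> edom r" for v using outside_edom[OF that] e by (simp add: F_def)
  obtain z where z: "z \<in> edom r" "\<And>v. v \<in> edom r \<Longrightarrow> G z + (1/\<eta>) / 2 * (norm (v - z))\<^sup>2 \<le> G v"
    using attains_min[OF r _ _ strongly_convex_half_sqdist dom, of "1/\<eta>" u] e unfolding G_def
    by (force intro!: continuous_intros)
  have zmin: "F z \<le> F v" for v
  proof (cases "v \<in> edom r")
    case True
    have "0 \<le> (1/\<eta>) / 2 * (norm (v - z))\<^sup>2" using e by simp
    then have "G z \<le> G v" using z(2)[OF True] by linarith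
    then show ?thesis using FG z(1) True e by simp
  qed (simp add: Finf)
  have "is_arg_min F (\<lambda>_. True) w"
    unfolding w_def prox_def F_def[symmetric] arg_min_def
    by (rule someI[of _ z]) (use zmin in \<open>auto simp: is_arg_min_def not_less\<close>)
  then have le: "F w \<le> F z" by (auto simp: is_arg_min_def not_less)
  then show wd: "w \<in> edom r" using Finf[of w] FG[OF z(1)] by (metis ereal_infty_less_eq(1) ereal_less_eq(1) PInfty_neq_ereal(1))
  have "G w \<le> G z" using le FG wd z(1) e by simp
  then have "(1/\<eta>) / 2 * (norm (w - z))\<^sup>2 \<le> 0" using z(2)[OF wd] by linarith
  then have "w = z" using e by (simp add: divide_le_0_iff)
  then show "real_of_ereal (r w) + ((norm (w - u))\<^sup>2 + (norm (v - w))\<^sup>2) / (2 * \<eta>)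
            \<le> real_of_ereal (r v) + (norm (v - u))\<^sup>2 / (2 * \<eta>)" if "v \<in> edom r"
    using z(2)[OF that] unfolding G_def by (simp add: add_divide_distrib)
qed

text \<open>Taking each of the two proximal points as competitor of the other and adding the
  inequalities gives firm nonexpansiveness; Cauchy-Schwarz does the rest. It serves the consensus
  contraction and also the measurability of the iterates.\<close>

lemma prox_nonexpansive:
  fixes r :: "'a::euclidean_space \<Rightarrow> ereal"
  assumes r: "closed_convex_fun r" and dom: "edom r \<noteq> {}" and e: "\<eta> > 0"
  shows "norm (prox (\<lambda>v. ereal \<eta> * r v) u - prox (\<lambda>v. ereal \<eta> * r v) u') \<le> norm (u - u')"
proof -
  let ?w = "prox (\<lambda>v. ereal \<eta> * r v) u" and ?w' = "prox (\<lambda>v. ereal \<eta> * r v) u'"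
  note 1 = prox_ineq[OF r dom e prox_in_edom[OF r dom e], of u u']
  note 2 = prox_ineq[OF r dom e prox_in_edom[OF r dom e], of u' u]
  have "((norm (?w - u))\<^sup>2 + (norm (?w' - ?w))\<^sup>2 + (norm (?w' - u'))\<^sup>2 + (norm (?w - ?w'))\<^sup>2) / (2 * \<eta>)
    \<le> ((norm (?w' - u))\<^sup>2 + (norm (?w - u'))\<^sup>2) / (2 * \<eta>)"
    using 1 2 by (simp add: add_divide_distrib)
  then have "(norm (?w - u))\<^sup>2 + (norm (?w' - ?w))\<^sup>2 + (norm (?w' - u'))\<^sup>2 + (norm (?w - ?w'))\<^sup>2
    \<le> (norm (?w' - u))\<^sup>2 + (norm (?w - u'))\<^sup>2"
    using e by (simp add: divide_le_cancel)
  then have "norm (?w - ?w') * norm (?w - ?w') \<le> inner (?w - ?w') (u - u')"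
    by (simp add: power2_norm_eq_inner algebra_simps inner_commute power2_eq_square[symmetric])
  also have "\<dots> \<le> norm (?w - ?w') * norm (u - u')" by (rule norm_cauchy_schwarz)
  finally show ?thesis by (smt (verit) mult_le_cancel_left norm_ge_zero)
qed

subsection \<open>Smooth and strongly concave functions\<close>

lemma GDERIV_grad:
  assumes "smooth L f"
  shows "GDERIV f z :> grad f z"
proof -
  obtain D where D: "GDERIV f z :> D" using assms by (auto simp: smooth_def)
  have "D' = D" if "GDERIV f z :> D'" for D'
  proof -
    have "(\<lambda>h. inner h D') = (\<lambda>h. inner h D)"
      using that D unfolding gderiv_def by (rule has_derivative_unique)
    then have "inner (D' - D) D' = inner (D' - D) D" by meson
    then have "inner (D' - D) (D' - D) = 0" by (simp add: inner_diff_right)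
    then show ?thesis by simp
  qed
  then show ?thesis unfolding grad_def using D by (metis theI)
qed

lemma smooth_lipschitz:
  assumes "smooth L f"
  shows "norm (grad f z - grad f z') \<le> L * norm (z - z')"
  using lipschitz_onD[of L UNIV "grad f" z z'] assms by (simp add: smooth_def dist_norm)

lemma DERIV_along_line:
  assumes "smooth L f"
  shows "((\<lambda>s. f (z + s *\<^sub>R v)) has_real_derivative inner v (grad f (z + s *\<^sub>R v))) (at s)"
proof -
  have "((\<lambda>s. z + s *\<^sub>R v) has_derivative (\<lambda>t. t *\<^sub>R v)) (at s)"
    by (auto intro!: derivative_eq_intros)
  then have "((\<lambda>s. f (z + s *\<^sub>R v)) has_derivative (\<lambda>t. inner (t *\<^sub>R v) (grad f (z + s *\<^sub>R v)))) (at s)"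
    using GDERIV_grad[OF assms, of "z + s *\<^sub>R v"] unfolding gderiv_def by (rule has_derivative_compose)
  then show ?thesis by (simp add: has_field_derivative_def mult_commute_abs)
qed

text \<open>For both signs the Taylor remainder along the segment, less its quadratic bound, has a
  nonpositive derivative, so monotonicity replaces integration of the gradient.\<close>

lemma smooth_bounds:
  assumes f: "smooth L f"
  shows "\<bar>f z' - f z - inner (z' - z) (grad f z)\<bar> \<le> L / 2 * (norm (z' - z))\<^sup>2"
proof -
  define v where "v = z' - z"
  have b: "\<bar>inner v (grad f (z + s *\<^sub>R v) - grad f z)\<bar> \<le> L * s * (norm v)\<^sup>2" if "s \<ge> 0" for s
  proof -
    have "\<bar>inner v (grad f (z + s *\<^sub>R v) - grad f z)\<bar> \<le> norm v * norm (grad f (z + s *\<^sub>R v) - grad f z)"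
      by (rule Cauchy_Schwarz_ineq2)
    also have "\<dots> \<le> norm v * (L * norm (s *\<^sub>R v))"
      using smooth_lipschitz[OF f, of "z + s *\<^sub>R v" z] by (intro mult_left_mono) auto
    finally show ?thesis using that by (simp add: power2_eq_square mult_ac)
  qed
  note dl = DERIV_along_line[OF f, of z v, THEN DERIV_chain2]
  have *: "\<sigma> * (f (z + 1 *\<^sub>R v) - 1 * inner v (grad f z)) - L / 2 * 1\<^sup>2 * (norm v)\<^sup>2
     \<le> \<sigma> * (f (z + 0 *\<^sub>R v) - 0 * inner v (grad f z)) - L / 2 * 0\<^sup>2 * (norm v)\<^sup>2"
    if \<sigma>: "\<sigma> = 1 \<or> \<sigma> = -1" for \<sigma> :: real
  proof (rule DERIV_nonpos_imp_nonincreasing[of 0 1 "\<lambda>s. \<sigma> * (f (z + s *\<^sub>R v) - s * inner v (grad f z)) - L / 2 * s\<^sup>2 * (norm v)\<^sup>2"])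
    fix s :: real assume s: "0 \<le> s" "s \<le> 1"
    have "((\<lambda>s. \<sigma> * (f (z + s *\<^sub>R v) - s * inner v (grad f z)) - L / 2 * s\<^sup>2 * (norm v)\<^sup>2) has_real_derivative
      \<sigma> * (inner v (grad f (z + s *\<^sub>R v)) - inner v (grad f z)) - L * s * (norm v)\<^sup>2) (at s)"
      by (rule derivative_eq_intros DERIV_along_line[OF f] refl | simp)+
    moreover have "\<sigma> * (inner v (grad f (z + s *\<^sub>R v)) - inner v (grad f z)) - L * s * (norm v)\<^sup>2 \<le> 0"
      using b[OF s(1)] \<sigma> by (auto simp: inner_diff_right)
    ultimately show "\<exists>y. ((\<lambda>s. \<sigma> * (f (z + s *\<^sub>R v) - s * inner v (grad f z)) - L / 2 * s\<^sup>2 * (norm v)\<^sup>2) has_real_derivative y) (at s) \<and> y \<le> 0"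
      by blast
  qed simp
  have "f z' - f z - inner (z' - z) (grad f z) \<le> L / 2 * (norm (z' - z))\<^sup>2"
    "- (f z' - f z - inner (z' - z) (grad f z)) \<le> L / 2 * (norm (z' - z))\<^sup>2"
    using *[of 1] *[of "-1"] unfolding v_def by simp_all
  then show ?thesis by linarith
qed

lemma smooth_continuous: "smooth L f \<Longrightarrow> continuous_on UNIV f"
  using GDERIV_grad by (metis continuous_at_imp_continuous_on gderiv_def has_derivative_continuous)

lemma norm_Pair_sq: "(norm (x, y))\<^sup>2 = (norm x)\<^sup>2 + (norm y)\<^sup>2"
  by (simp add: norm_Pair)

lemma norm_fst_snd_le: "norm (fst z) \<le> norm z" "norm (snd z) \<le> norm z"
  by (metis norm_fst_le prod.collapse) (metis norm_snd_le prod.collapse)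

text \<open>The mean value theorem is applied to the difference of \<open>f\<close> along two
  parallel segments. The two gradients are then compared at the same parameter \<open>s\<close>,
  where their arguments differ exactly by \<open>u - v\<close>; no second derivative is
  involved.\<close>

lemma smooth_cross_difference:
  fixes f :: "'a::euclidean_space \<times> 'b::euclidean_space \<Rightarrow> real"
  assumes f: "smooth L f"
  shows "(f (x', u) - f (x, u)) - (f (x', v) - f (x, v)) \<le> L * norm (x' - x) * norm (u - v)"
proof -
  define e where "e = (x' - x, 0 :: 'b)"
  have D: "((\<lambda>s. f ((x, u) + s *\<^sub>R e) - f ((x, v) + s *\<^sub>R e)) has_real_derivative
     inner e (grad f ((x, u) + s *\<^sub>R e)) - inner e (grad f ((x, v) + s *\<^sub>R e))) (at s)" for s
    by (intro DERIV_diff DERIV_along_line[OF f])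
  obtain s where s: "(f ((x, u) + 1 *\<^sub>R e) - f ((x, v) + 1 *\<^sub>R e)) - (f ((x, u) + 0 *\<^sub>R e) - f ((x, v) + 0 *\<^sub>R e))
    = (1 - 0) * (inner e (grad f ((x, u) + s *\<^sub>R e)) - inner e (grad f ((x, v) + s *\<^sub>R e)))"
    using MVT2[of 0 1 "\<lambda>s. f ((x, u) + s *\<^sub>R e) - f ((x, v) + s *\<^sub>R e)", OF _ D] by auto
  have "inner e (grad f ((x, u) + s *\<^sub>R e) - grad f ((x, v) + s *\<^sub>R e))
    \<le> norm e * norm (grad f ((x, u) + s *\<^sub>R e) - grad f ((x, v) + s *\<^sub>R e))" by (rule norm_cauchy_schwarz)
  also have "\<dots> \<le> norm e * (L * norm (((x, u) + s *\<^sub>R e) - ((x, v) + s *\<^sub>R e)))"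
    by (intro mult_left_mono smooth_lipschitz[OF f]) auto
  also have "\<dots> = L * norm (x' - x) * norm (u - v)" by (simp add: e_def norm_Pair)
  finally show ?thesis using s by (simp add: e_def inner_diff_right algebra_simps)
qed

text \<open>The chord inequality divided by the parameter \<open>s\<close>, with \<open>s\<close>
  tending to 0 from the right.\<close>

lemma strongly_concave_first_order:
  fixes f :: "'a::euclidean_space \<times> 'b::euclidean_space \<Rightarrow> real"
  assumes f: "smooth L f" and c: "strongly_concave \<mu> (\<lambda>y. f (x, y))"
  shows "f (x, y') \<le> f (x, y) + inner (y' - y) (snd (grad f (x, y))) - \<mu> / 2 * (norm (y' - y))\<^sup>2"
proof -
  define e where "e = (0 :: 'a, y' - y)"
  have D: "((\<lambda>s. f ((x, y) + s *\<^sub>R e)) has_real_derivative inner e (grad f (x, y))) (at 0)"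
    using DERIV_along_line[OF f, of "(x,y)" e 0] by simp
  have lim: "((\<lambda>s. (f ((x, y) + s *\<^sub>R e) - f (x, y)) / s) \<longlongrightarrow> inner e (grad f (x, y))) (at_right 0)"
    using D[THEN DERIV_D] by (simp add: filterlim_at_split)
  have "f (x, y') - f (x, y) + \<mu> / 2 * (norm (y' - y))\<^sup>2 \<le> inner e (grad f (x, y))"
  proof (rule tendsto_le[OF _ lim])
    show "((\<lambda>s. f (x, y') - f (x, y) + \<mu> / 2 * (1 - s) * (norm (y' - y))\<^sup>2) \<longlongrightarrow> f (x, y') - f (x, y) + \<mu> / 2 * (norm (y' - y))\<^sup>2) (at_right 0)"
      by (auto intro!: tendsto_eq_intros)
    have "f (x, y') - f (x, y) + \<mu> / 2 * (1 - s) * (norm (y' - y))\<^sup>2 \<le> (f ((x, y) + s *\<^sub>R e) - f (x, y)) / s" if s: "0 < s" "s < 1" for s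
    proof -
      have "(x, s *\<^sub>R y' + (1 - s) *\<^sub>R y) = (x, y) + s *\<^sub>R e" by (simp add: e_def algebra_simps)
      then have "s * f (x, y') + (1 - s) * f (x, y) + \<mu> / 2 * s * (1 - s) * (norm (y' - y))\<^sup>2 \<le> f ((x, y) + s *\<^sub>R e)"
        using c s unfolding strongly_concave_def by (metis atLeastAtMost_iff less_eq_real_def)
      then have "(f (x, y') - f (x, y) + \<mu> / 2 * (1 - s) * (norm (y' - y))\<^sup>2) * s \<le> f ((x, y) + s *\<^sub>R e) - f (x, y)"
        by (simp add: algebra_simps)
      then show ?thesis using s(1) by (simp only: pos_le_divide_eq)
    qed
    then show "\<forall>\<^sub>F s in at_right 0. f (x, y') - f (x, y) + \<mu> / 2 * (1 - s) * (norm (y' - y))\<^sup>2 \<le> (f ((x, y) + s *\<^sub>R e) - f (x, y)) / s"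
      by (auto simp: eventually_at_right_field intro!: exI[of _ 1])
  qed simp
  then show ?thesis by (simp add: e_def inner_prod_def)
qed

text \<open>Upper and lower quadratic bounds around 0 are compared at a unit vector in the
  \<open>y\<close>-space. This is where \<kappa> \<ge> 1 comes from, which is used throughout the
  arithmetic.\<close>

lemma strong_concavity_le_smoothness:
  fixes f :: "'a::euclidean_space \<times> 'b::euclidean_space \<Rightarrow> real"
  assumes f: "smooth L f" and c: "strongly_concave \<mu> (\<lambda>y. f (x, y))"
  shows "\<mu> \<le> L"
proof -
  obtain b :: 'b where b: "b \<in> Basis" by (meson nonempty_Basis ex_in_conv)
  have 1: "f (x, b) \<le> f (x, 0) + inner b (snd (grad f (x, 0))) - \<mu> / 2"
    using strongly_concave_first_order[OF f c, of b 0] b by simp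
  have 2: "- (f (x, b) - f (x, 0) - inner b (snd (grad f (x, 0)))) \<le> L / 2"
    using smooth_bounds[OF f, of "(x, b)" "(x, 0)"] b unfolding abs_le_iff by (simp add: inner_prod_def norm_Pair)
  show ?thesis using 1 2 by linarith
qed

subsection \<open>Mixing matrices\<close>

lemma norm_sq_vec: "(norm (X :: 'v::real_normed_vector ^ 'm))\<^sup>2 = (\<Sum>i\<in>UNIV. (norm (X $ i))\<^sup>2)"
  by (simp add: norm_vec_def L2_set_def sum_nonneg)

lemma norm_sq_rows: "(norm (X :: real ^ 'd ^ 'm))\<^sup>2 = (\<Sum>i\<in>UNIV. (norm (X $ i))\<^sup>2)"
  by (rule norm_sq_vec)

lemma matrix_mult_row: "((A :: real ^ 'k ^ 'm) ** (X :: real ^ 'd ^ 'k)) $ i = (\<Sum>k\<in>UNIV. A $ i $ k *\<^sub>R X $ k)"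
  by (simp add: vec_eq_iff matrix_matrix_mult_def)

lemma linear_matrix_mult: "linear (\<lambda>X :: real ^ 'd ^ 'k. (A :: real ^ 'k ^ 'm) ** X)"
  by (intro linearI) (auto simp: vec_eq_iff matrix_mult_row algebra_simps sum.distrib scaleR_sum_right)

lemma matrix_mult_diff_right: "(A :: real ^ 'k ^ 'm) ** (X - Y :: real ^ 'd ^ 'k) = A ** X - A ** Y"
  by (rule linear_diff[OF linear_matrix_mult])

text \<open>The Frobenius norm is a sum over columns as well as over rows, and on each column the
  product is a matrix-vector product governed by the operator norm.\<close>

lemma norm_matrix_mult_le:
  fixes A :: "real ^ 'k ^ 'm" and X :: "real ^ 'd ^ 'k"
  shows "norm (A ** X) \<le> spectral_norm A * norm X"
proof -
  let ?c = "\<lambda>j. \<chi> i. X $ i $ j"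
  have sn: "norm (A *v v) \<le> spectral_norm A * norm v" for v
    unfolding spectral_norm_def by (intro onorm) (simp add: linear_linear)
  have s0: "spectral_norm A \<ge> 0"
    unfolding spectral_norm_def by (rule onorm_pos_le) (simp add: linear_linear)
  have "(norm (A ** X))\<^sup>2 = (\<Sum>i\<in>UNIV. \<Sum>j\<in>UNIV. ((A *v ?c j) $ i)\<^sup>2)"
    by (simp add: norm_sq_rows norm_vec_def L2_set_def sum_nonneg matrix_matrix_mult_def matrix_vector_mult_def)
  also have "\<dots> = (\<Sum>j\<in>UNIV. (norm (A *v ?c j))\<^sup>2)"
    by (subst sum.swap) (simp add: norm_vec_def L2_set_def sum_nonneg)
  also have "\<dots> \<le> (\<Sum>j\<in>UNIV. (spectral_norm A * norm (?c j))\<^sup>2)"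
    by (intro sum_mono power_mono sn) auto
  also have "\<dots> = (spectral_norm A)\<^sup>2 * (\<Sum>j\<in>UNIV. \<Sum>i\<in>UNIV. (X $ i $ j)\<^sup>2)"
    by (simp add: norm_vec_def L2_set_def sum_nonneg power_mult_distrib sum_distrib_left)
  also have "\<dots> = (spectral_norm A * norm X)\<^sup>2"
    by (subst sum.swap) (simp add: norm_sq_rows norm_vec_def L2_set_def sum_nonneg power_mult_distrib)
  finally show ?thesis by (rule power2_le_imp_le) (simp add: s0)
qed

lemma spectral_norm_nonneg: "spectral_norm A \<ge> 0"
  unfolding spectral_norm_def by (rule onorm_pos_le) (simp add: linear_linear)

lemma inner_matrix_transpose:
  fixes A :: "real ^ 'k ^ 'm" and X :: "real ^ 'd ^ 'k" and Z :: "real ^ 'd ^ 'm"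
  shows "inner (transpose A ** Z) X = inner Z (A ** X)"
proof -
  have "inner (transpose A ** Z) X = (\<Sum>k\<in>UNIV. \<Sum>i\<in>UNIV. A $ i $ k * inner (Z $ i) (X $ k))"
    by (subst inner_vec_def) (simp add: matrix_mult_row transpose_def inner_sum_left)
  also have "\<dots> = inner Z (A ** X)"
    by (subst sum.swap, subst (2) inner_vec_def) (simp add: matrix_mult_row inner_sum_right)
  finally show ?thesis .
qed

lemma rep_nth [simp]: "rep x $ i = x" by (simp add: rep_def)

lemma linear_rep: "linear (rep :: _ \<Rightarrow> real ^ 'd ^ 'm)"
  by (intro linearI) (simp_all add: vec_eq_iff)

lemma linear_row_avg: "linear (row_avg :: real ^ 'd ^ 'm \<Rightarrow> _)"
  by (intro linearI) (simp_all add: row_avg_def sum.distrib algebra_simps scaleR_sum_right)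

lemma linear_perp: "linear (perp :: real ^ 'd ^ 'm \<Rightarrow> _)"
  unfolding perp_def
  using linear_compose_sub[OF linear_ident linear_compose[OF linear_row_avg linear_rep]] by (simp add: o_def)

lemma row_avg_rep [simp]: "row_avg (rep x :: real ^ 'd ^ 'm) = x"
  by (simp add: row_avg_def sum_constant_scaleR del: sum_constant)

lemma perp_rep [simp]: "perp (rep x) = 0"
  by (simp add: perp_def)

lemma sum_rows: "(\<Sum>i\<in>UNIV. (X :: real ^ 'd ^ 'm) $ i) = real CARD('m) *\<^sub>R row_avg X"
  by (simp add: row_avg_def)

lemma inner_rep: "inner (X :: real ^ 'd ^ 'm) (rep x) = real CARD('m) * inner (row_avg X) x"
  by (subst inner_vec_def) (simp add: inner_sum_left[symmetric] sum_rows)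

lemma inner_perp_rep: "inner (perp X :: real ^ 'd ^ 'm) (rep x) = 0"
  by (simp add: inner_rep perp_def linear_diff[OF linear_row_avg])

text \<open>\<open>rep (row_avg X)\<close> is the orthogonal projection of \<open>X\<close> onto the
  matrices with equal rows. Both components are therefore dominated by the distance of
  \<open>X\<close> to any such matrix.\<close>

lemma pythagoras_rep: "(norm (X - rep x :: real ^ 'd ^ 'm))\<^sup>2 = (norm (perp X))\<^sup>2 + (norm (rep (row_avg X - x) :: real ^ 'd ^ 'm))\<^sup>2"
proof -
  have "X - rep x = perp X + rep (row_avg X - x)" by (simp add: perp_def linear_diff[OF linear_rep])
  moreover have "orthogonal (perp X) (rep (row_avg X - x))" by (simp add: orthogonal_def inner_perp_rep)
  ultimately show ?thesis by (metis norm_add_Pythagorean)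
qed

lemma norm_perp_le: "norm (perp X) \<le> norm (X - rep x :: real ^ 'd ^ 'm)"
  by (rule power2_le_imp_le) (simp_all add: pythagoras_rep)

lemma norm_rep_avg_le: "norm (rep (row_avg X - x) :: real ^ 'd ^ 'm) \<le> norm (X - rep x :: real ^ 'd ^ 'm)"
  by (rule power2_le_imp_le) (simp_all add: pythagoras_rep)

lemma norm_perp_le_self: "norm (perp X) \<le> norm (X :: real ^ 'd ^ 'm)"
  using norm_perp_le[of X 0] by (simp add: linear_0[OF linear_rep])

locale mixing =
  fixes W :: "real ^ 'm ^ 'm" and \<rho> :: real
  assumes null: "{v. (W - mat 1) *v v = 0} = span {vec 1}"
    and stoch: "transpose W *v vec 1 = vec 1"
    and rho: "\<rho> = spectral_norm (W - (1 / real CARD('m)) *\<^sub>R (\<chi> i j. 1))"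
    and rho1: "\<rho> < 1"
    and norm2: "spectral_norm (W - mat 1) \<le> 2"
begin

lemma rho0: "\<rho> \<ge> 0" by (simp add: rho spectral_norm_nonneg)

lemma row_sum: "(\<Sum>k\<in>UNIV. W $ i $ k) = 1"
proof -
  have "(W - mat 1) *v vec 1 = 0" using null span_base[of "vec 1" "{vec 1}"] by auto
  then have "W *v vec 1 = vec 1" by (simp add: matrix_vector_mult_diff_rdistrib)
  then show ?thesis by (simp add: vec_eq_iff matrix_vector_mult_def)
qed

lemma col_sum: "(\<Sum>k\<in>UNIV. W $ k $ i) = 1"
  using stoch by (simp add: vec_eq_iff matrix_vector_mult_def transpose_def)

lemma W_rep [simp]: "W ** rep x = (rep x :: real ^ 'd ^ 'm)"
  unfolding vec_eq_iff[of "W ** rep x"] by (simp only: matrix_mult_row rep_nth scaleR_sum_left[symmetric] row_sum scaleR_one simp_thms)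

lemma row_avg_W [simp]: "row_avg (W ** (X :: real ^ 'd ^ 'm)) = row_avg X"
proof -
  have "(\<Sum>i\<in>UNIV. (W ** X) $ i) = (\<Sum>k\<in>UNIV. (\<Sum>i\<in>UNIV. W $ i $ k) *\<^sub>R X $ k)"
    unfolding matrix_mult_row by (subst sum.swap) (simp add: scaleR_sum_left)
  then show ?thesis by (simp add: row_avg_def col_sum)
qed

text \<open>\<open>W\<close> fixes matrices with equal rows and preserves averages, and the
  averaging matrix annihilates \<open>perp X\<close>; hence \<open>W\<close> may be replaced by
  \<open>W\<close> minus the averaging matrix, whose norm is \<rho>.\<close>

lemma perp_W: "norm (perp (W ** (X :: real ^ 'd ^ 'm))) \<le> \<rho> * norm (perp X)"
proof -
  let ?J = "(1 / real CARD('m)) *\<^sub>R (\<chi> i j. 1) :: real ^ 'm ^ 'm"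
  have J: "?J ** Z = rep (row_avg Z)" for Z :: "real ^ 'd ^ 'm"
    by (simp add: vec_eq_iff matrix_mult_row row_avg_def scaleR_sum_right sum_divide_distrib)
  have "(W - ?J) ** perp X = W ** perp X - ?J ** perp X"
    by (simp add: vec_eq_iff matrix_mult_row sum_subtractf algebra_simps)
  also have "?J ** perp X = 0"
    unfolding J by (simp add: perp_def linear_diff[OF linear_row_avg] linear_0[OF linear_rep])
  also have "W ** perp X - 0 = perp (W ** X)"
    by (simp add: perp_def matrix_mult_diff_right)
  finally show ?thesis using norm_matrix_mult_le[of "W - ?J" "perp X"] by (simp add: rho)
qed

lemma norm_W_minus_1: "norm ((W - mat 1) ** (X :: real ^ 'd ^ 'm)) \<le> 2 * norm X"
  using norm_matrix_mult_le[of "W - mat 1" X] norm2 mult_right_mono[OF norm2, of "norm X"] by auto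

end

subsection \<open>Inequalities between real numbers\<close>

abbreviation sumsq :: "(nat \<Rightarrow> real) \<Rightarrow> nat \<Rightarrow> real" where
  "sumsq u T \<equiv> \<Sum>t<T. (u t)\<^sup>2"

text \<open>Convexity of the square with weights \<rho> and \<open>1 - \<rho>\<close> keeps the
  contraction factor of the squared sequence at \<rho>. The sum is then compared with its own
  shift.\<close>

lemma contraction_sum_sq:
  fixes u c :: "nat \<Rightarrow> real"
  assumes u: "\<And>t. 0 \<le> u t" and c: "\<And>t. 0 \<le> c t" and \<rho>: "0 \<le> \<rho>" "\<rho> < 1"
    and step: "\<And>t. u (Suc t) \<le> \<rho> * u t + c t"
  shows "(\<Sum>t<Suc n. (u t)\<^sup>2) \<le> (u 0)\<^sup>2 / (1 - \<rho>) + (\<Sum>t<n. (c t)\<^sup>2) / (1 - \<rho>)\<^sup>2"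
proof -
  let ?S = "\<Sum>t<Suc n. (u t)\<^sup>2" and ?C = "\<Sum>t<n. (c t)\<^sup>2"
  have sq: "(u (Suc t))\<^sup>2 \<le> \<rho> * (u t)\<^sup>2 + (c t)\<^sup>2 / (1 - \<rho>)" for t
  proof -
    have "(u (Suc t))\<^sup>2 \<le> (\<rho> * u t + c t)\<^sup>2" using step u by (intro power_mono) auto
    \<comment> \<open>The deficit in that convexity inequality, written as an explicit
      square.\<close>
    moreover have "\<rho> * (u t)\<^sup>2 + (c t)\<^sup>2 / (1 - \<rho>) - (\<rho> * u t + c t)\<^sup>2 = \<rho> / (1 - \<rho>) * ((1 - \<rho>) * u t - c t)\<^sup>2"
      using \<rho> by (simp add: field_simps power2_eq_square)
    moreover have "0 \<le> \<rho> / (1 - \<rho>) * ((1 - \<rho>) * u t - c t)\<^sup>2" using \<rho> by simp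
    ultimately show ?thesis by linarith
  qed
  have "?S = (u 0)\<^sup>2 + (\<Sum>t<n. (u (Suc t))\<^sup>2)" by (rule sum.lessThan_Suc_shift)
  also have "\<dots> \<le> (u 0)\<^sup>2 + (\<Sum>t<n. \<rho> * (u t)\<^sup>2 + (c t)\<^sup>2 / (1 - \<rho>))" by (intro add_left_mono sum_mono sq)
  also have "\<dots> = (u 0)\<^sup>2 + \<rho> * (\<Sum>t<n. (u t)\<^sup>2) + ?C / (1 - \<rho>)"
    by (simp add: sum.distrib sum_distrib_left sum_divide_distrib)
  also have "\<dots> \<le> (u 0)\<^sup>2 + \<rho> * ?S + ?C / (1 - \<rho>)"
    using \<rho> by (intro add_right_mono add_left_mono mult_left_mono) auto
  finally have "(1 - \<rho>) * ?S \<le> (u 0)\<^sup>2 + ?C / (1 - \<rho>)" by (simp add: algebra_simps)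
  then have "?S \<le> ((u 0)\<^sup>2 + ?C / (1 - \<rho>)) / (1 - \<rho>)" using \<rho> by (simp add: pos_le_divide_eq mult.commute)
  then show ?thesis by (simp add: add_divide_distrib power2_eq_square)
qed

lemma young_le: "c > 0 \<Longrightarrow> a * b \<le> c * a\<^sup>2 + b\<^sup>2 / (4 * (c::real))"
proof -
  assume c: "c > 0"
  have "0 \<le> (2 * c * a - b)\<^sup>2 / (4 * c)" using c by simp
  also have "\<dots> = c * a\<^sup>2 + b\<^sup>2 / (4 * c) - a * b" using c by (simp add: field_simps power2_eq_square)
  finally show ?thesis by simp
qed

lemma sq_sum3: "(a + b + c)\<^sup>2 \<le> 3 * (a\<^sup>2 + b\<^sup>2 + (c::real)\<^sup>2)"
proof -
  have "0 \<le> (a - b)\<^sup>2 + (b - c)\<^sup>2 + (a - c)\<^sup>2" by simp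
  then show ?thesis by (simp add: power2_eq_square algebra_simps)
qed

text \<open>The Young weights are dictated from outside. \<open>v\<close> may cost
  \<open>1 / (60 * LP)\<close>, its coefficient on the left of the theorem, and each of the two
  products with \<open>D\<close> gets \<open>L / (104 * \<kappa>\<^sup>2)\<close>, so that only a
  small multiple remains after the factor \<open>\<kappa>\<^sup>2\<close> of the summed distance.
  This forces \<open>15 = 60 / 4\<close> and \<open>26 = 104 / 4\<close>.\<close>

lemma primal_young:
  fixes n1 E p v l D L LP \<kappa> :: real
  assumes "L > 0" "LP > 0" "\<kappa> \<ge> 1"
  defines "r \<equiv> D + \<kappa> * (n1 + p + l)"
  shows "n1 * (E + L * p + L * r + v) + L / 2 * n1\<^sup>2 + L * l * r
    \<le> (L * (16 + 3 * \<kappa> + 26 * \<kappa>\<^sup>2) + 15 * LP) * n1\<^sup>2 + L * (26 * \<kappa>\<^sup>2 + 3 * \<kappa>) * l\<^sup>2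
      + E\<^sup>2 / (60 * L) + v\<^sup>2 / (60 * LP) + L / (52 * \<kappa>\<^sup>2) * D\<^sup>2 + L / 2 * (1 + \<kappa>) * p\<^sup>2"
proof -
  have 1: "n1 * E \<le> 15 * L * n1\<^sup>2 + E\<^sup>2 / (60 * L)" using young_le[of "15 * L" n1 E] assms by simp
  have 2: "n1 * v \<le> 15 * LP * n1\<^sup>2 + v\<^sup>2 / (60 * LP)" using young_le[of "15 * LP" n1 v] assms by simp
  have Y: "a * b \<le> a\<^sup>2 / 2 + b\<^sup>2 / 2" for a b :: real using sum_squares_bound[of a b] by simp
  have 3: "L * (n1 * p) \<le> L * (n1\<^sup>2 / 2 + p\<^sup>2 / 2)" using Y assms by (intro mult_left_mono) auto
  have D: "L * (a * D) \<le> L * (26 * \<kappa>\<^sup>2 * a\<^sup>2 + D\<^sup>2 / (104 * \<kappa>\<^sup>2))" for a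
    using young_le[of "26 * \<kappa>\<^sup>2" a D] assms by (intro mult_left_mono) auto
  have "(n1 + l) * (n1 + p + l) \<le> 3 * n1\<^sup>2 + 3 * l\<^sup>2 + p\<^sup>2 / 2"
  proof -
    have "(n1 + l) * (n1 + p + l) = (n1 + l)\<^sup>2 + (n1 + l) * p" by (simp add: algebra_simps power2_eq_square)
    moreover have "(n1 + l)\<^sup>2 = n1\<^sup>2 + l\<^sup>2 + 2 * (n1 * l)" by (simp add: power2_sum)
    ultimately show ?thesis using Y[of "n1 + l" p] Y[of n1 l] by linarith
  qed
  then have 4: "L * \<kappa> * ((n1 + l) * (n1 + p + l)) \<le> L * \<kappa> * (3 * n1\<^sup>2 + 3 * l\<^sup>2 + p\<^sup>2 / 2)"
    using assms by (intro mult_left_mono) auto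
  have "n1 * (E + L * p + L * r + v) + L / 2 * n1\<^sup>2 + L * l * r
    = n1 * E + n1 * v + L * (n1 * p) + L * (n1 * D) + L * (l * D) + L * \<kappa> * ((n1 + l) * (n1 + p + l)) + L / 2 * n1\<^sup>2"
    unfolding r_def by (simp add: algebra_simps)
  also have "\<dots> \<le> (15 * L * n1\<^sup>2 + E\<^sup>2 / (60 * L)) + (15 * LP * n1\<^sup>2 + v\<^sup>2 / (60 * LP)) + L * (n1\<^sup>2 / 2 + p\<^sup>2 / 2)
     + L * (26 * \<kappa>\<^sup>2 * n1\<^sup>2 + D\<^sup>2 / (104 * \<kappa>\<^sup>2)) + L * (26 * \<kappa>\<^sup>2 * l\<^sup>2 + D\<^sup>2 / (104 * \<kappa>\<^sup>2))
     + L * \<kappa> * (3 * n1\<^sup>2 + 3 * l\<^sup>2 + p\<^sup>2 / 2) + L / 2 * n1\<^sup>2"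
    by (intro add_mono 1 2 3 4 D order_refl)
  also have "\<dots> = (L * (16 + 3 * \<kappa> + 26 * \<kappa>\<^sup>2) + 15 * LP) * n1\<^sup>2 + L * (26 * \<kappa>\<^sup>2 + 3 * \<kappa>) * l\<^sup>2
      + E\<^sup>2 / (60 * L) + v\<^sup>2 / (60 * LP) + L / (52 * \<kappa>\<^sup>2) * D\<^sup>2 + L / 2 * (1 + \<kappa>) * p\<^sup>2"
    by (simp add: algebra_simps)
  finally show ?thesis .
qed

text \<open>The right-hand side of the theorem without the drop of the potential, multiplied by the
  number of agents: that factor sits inside \<open>\<delta>0\<close> and \<open>U\<close>, whereas
  it has been removed from the coefficients of \<open>v0\<close> and \<open>D0\<close>.\<close>

definition error_terms :: "real \<Rightarrow> real \<Rightarrow> real \<Rightarrow> real \<Rightarrow> real \<Rightarrow> real \<Rightarrow> real \<Rightarrow> real \<Rightarrow> real" where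
  "error_terms L LP \<kappa> \<rho> v0 D0 \<delta>0 U = (1 / (20 * LP) + \<rho> / (15 * LP * (1 - \<rho>))) * v0
      + (6 * (L + 1) / (64 * \<kappa>) + L\<^sup>2 / (120 * LP * \<kappa>) + 3 * L\<^sup>2 / (10 * LP * \<kappa> * (1 - \<rho>)\<^sup>2)) * D0
      + ((1 + 1 / L) / 8 + L / (30 * LP) + 6 * L / (5 * LP * (1 - \<rho>)\<^sup>2)) * \<delta>0
      + (1 / (30 * LP) + 1 / (LP * (1 - \<rho>)\<^sup>2) + (L + 1) / (8 * L\<^sup>2)) * U"

text \<open>
  The letters stand for (expected) sums of squares along a run: \<open>N1\<close>, \<open>N2\<close>, \<open>Sp\<close>, \<open>Sv\<close>, \<open>Sl\<close>, \<open>SD\<close>, \<open>SE\<close>,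
  \<open>Sb\<close>, \<open>Sx\<close>, \<open>Sxl\<close> collect the distance to the old average, the distance to the mixed iterate, the
  two consensus errors, the steps in \<open>\<Lambda>\<close>, the distance to the maximizer, the estimation error, the
  steps in \<open>Y\<close> and \<open>X\<close>, and the joint steps in \<open>X\<close> and \<open>\<Lambda>\<close>.
\<close>

lemma combination:
  fixes N1 N2 Sp Sv Sl SD SE Sb Sx Sxl v0 D0 \<delta>0 \<Phi>0 U L LP \<kappa> \<rho> \<eta> \<eta>' :: real
  assumes L: "L > 0" and \<kappa>: "\<kappa> \<ge> 1" and LP: "LP = L * sqrt (4 * \<kappa>\<^sup>2 + 1)" and \<rho>: "0 \<le> \<rho>" "\<rho> < 1"
    and \<eta>: "\<eta> > 0" "1 / \<eta> \<ge> 180 * LP / (1 - \<rho>)\<^sup>2" "1 / \<eta> \<ge> 20 * L * (12 * \<kappa>\<^sup>2 + 2 * \<kappa> + 5)"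
    and \<eta>': "\<eta>' > 0" "1 / \<eta>' \<ge> 24 * L\<^sup>2 * (12 * \<kappa>\<^sup>2) / (5 * LP * (1 - \<rho>)\<^sup>2)" "1 / \<eta>' \<ge> 128 * L * \<kappa>\<^sup>2"
    and nn: "0 \<le> N1" "0 \<le> N2" "0 \<le> Sp" "0 \<le> Sv" "0 \<le> Sl" "0 \<le> SD" "0 \<le> SE" "0 \<le> Sb" "0 \<le> Sx" "0 \<le> v0" "0 \<le> D0" "0 \<le> \<delta>0" "0 \<le> U"
    and A: "(1 / (2 * \<eta>) - (L * (16 + 3 * \<kappa> + 26 * \<kappa>\<^sup>2) + 15 * LP)) * N1 + N2 / (2 * \<eta>)
        + (1 / \<eta>' - L * (26 * \<kappa>\<^sup>2 + 3 * \<kappa>)) * Sl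
        \<le> \<Phi>0 + SE / (60 * L) + Sv / (60 * LP) + L / (52 * \<kappa>\<^sup>2) * SD + (1 / (2 * \<eta>) + L / 2 * (1 + \<kappa>)) * Sp"
    and D: "SD \<le> 4 * \<kappa> * D0 + 2 * \<kappa>\<^sup>2 / L\<^sup>2 * SE + 4 * \<kappa> * (1 + 8 * \<kappa>) * \<kappa>\<^sup>2 * Sxl"
    and \<delta>: "3 * L * Sb \<le> \<delta>0 + SE / (2 * L) + L / (8 * \<kappa>\<^sup>2) * SD + 2 * L * \<kappa>\<^sup>2 * Sxl"
    and V: "Sv \<le> v0 / (1 - \<rho>) + (6 * SE + 3 * L\<^sup>2 * (Sx + Sb)) / (1 - \<rho>)\<^sup>2"
    and P: "Sp \<le> \<eta>\<^sup>2 * Sv / (1 - \<rho>)\<^sup>2" "Sp \<le> N1"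
    and X: "Sx \<le> 2 * N1 + 2 * Sp" "Sxl \<le> 2 * Sx + 2 * Sl"
    and E: "SE \<le> U + L\<^sup>2 * (Sx + Sb)"
  shows "N1 / (4 * \<eta>) + Sl / (2 * \<eta>') + N2 / (4 * \<eta>) + 3 / (4 * \<eta>) * Sp + Sv / (60 * LP)
    \<le> \<Phi>0 + error_terms L LP \<kappa> \<rho> v0 D0 \<delta>0 U"
proof -
  have LP0: "LP > 0" unfolding LP using L by (auto intro!: mult_pos_pos add_nonneg_pos)
  have "(2 * L * \<kappa>)\<^sup>2 \<le> LP\<^sup>2" unfolding LP by (simp add: power_mult_distrib algebra_simps)
  define s where "s = (1 - \<rho>)\<^sup>2"
  have s: "0 < s" "s \<le> 1" using \<rho> by (auto simp: s_def power_le_one)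
  \<comment> \<open>Everything is measured in units of the objective. The factor
    \<open>\<kappa>\<^sup>2\<close> in \<open>a\<close> and \<open>b\<close> is the one with which
    joint steps enter the gap inequality, and also the distance inequality once it is normalized to
    \<open>D1\<close>.\<close>
  define a b where "a = L * \<kappa>\<^sup>2 * N1" and "b = L * \<kappa>\<^sup>2 * Sl"
  define u d where "u = U / L" and "d = L * D0 / \<kappa>"
  have ab: "0 \<le> a" "0 \<le> b" "0 \<le> u" "0 \<le> d" using nn L \<kappa> by (auto simp: a_def b_def u_def d_def)
  have k2: "\<kappa>\<^sup>2 \<ge> 1" using \<kappa> by simp
  have Sx4: "Sx \<le> 4 * N1" using P(2) X(1) by simp
  have xl: "L * \<kappa>\<^sup>2 * Sxl \<le> 8 * a + 2 * b"
  proof -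
    have "L * \<kappa>\<^sup>2 * Sxl \<le> L * \<kappa>\<^sup>2 * (8 * N1 + 2 * Sl)" using Sx4 X(2) L by (intro mult_left_mono) auto
    then show ?thesis by (simp add: a_def b_def algebra_simps)
  qed
  have LSx: "L * Sx \<le> 4 * a"
  proof -
    have "L * Sx \<le> L * (4 * N1)" using Sx4 L by simp
    also have "\<dots> \<le> L * (4 * (\<kappa>\<^sup>2 * N1))" using k2 nn(1) L by (intro mult_left_mono mult_right_mono[of 1 "\<kappa>\<^sup>2" N1, simplified]) auto
    finally show ?thesis by (simp add: a_def algebra_simps)
  qed
  define e D1 where "e = SE / L" and "D1 = L / \<kappa>\<^sup>2 * SD"
  define Z where "Z = L * (Sx + Sb)"
  have Z0: "0 \<le> Z" using nn L by (simp add: Z_def)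
  have E': "e \<le> u + Z"
  proof -
    have "SE / L \<le> (U + L\<^sup>2 * (Sx + Sb)) / L" using E L by (intro divide_right_mono) auto
    then show ?thesis using L by (simp add: e_def u_def Z_def field_simps power2_eq_square)
  qed
  \<comment> \<open>The number 36 bounds \<open>4 / \<kappa> + 32\<close>, by \<kappa> \<ge>
    1.\<close>
  have D': "D1 \<le> 4 * d + 2 * e + 36 * (8 * a + 2 * b)"
  proof -
    have "D1 \<le> L / \<kappa>\<^sup>2 * (4 * \<kappa> * D0 + 2 * \<kappa>\<^sup>2 / L\<^sup>2 * SE + 4 * \<kappa> * (1 + 8 * \<kappa>) * \<kappa>\<^sup>2 * Sxl)"
      unfolding D1_def using D L by (intro mult_left_mono) auto
    also have "\<dots> = 4 * d + 2 * e + 4 * \<kappa> * (1 + 8 * \<kappa>) / \<kappa>\<^sup>2 * (L * \<kappa>\<^sup>2 * Sxl)"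
      using L \<kappa> by (simp add: d_def e_def field_simps power2_eq_square)
    also have "4 * \<kappa> * (1 + 8 * \<kappa>) / \<kappa>\<^sup>2 * (L * \<kappa>\<^sup>2 * Sxl) \<le> 4 * \<kappa> * (1 + 8 * \<kappa>) / \<kappa>\<^sup>2 * (8 * a + 2 * b)"
      using xl \<kappa> by (intro mult_left_mono) auto
    also have "4 * \<kappa> * (1 + 8 * \<kappa>) / \<kappa>\<^sup>2 * (8 * a + 2 * b) \<le> 36 * (8 * a + 2 * b)"
      using \<kappa> ab by (intro mult_right_mono) (auto simp: field_simps power2_eq_square)
    finally show ?thesis by simp
  qed
  \<comment> \<open>The circular dependence is resolved here. After inserting the distance bound,
    the gap inequality returns \<open>3 / 4\<close> of \<open>e\<close>, hence \<open>3 / 4\<close>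
    of \<open>L * Sb\<close>, against \<open>3 * (L * Sb)\<close> on the left. Division by the
    remaining \<open>9 / 4\<close> produces the ninths.\<close>
  have Zle: "Z \<le> 4/9 * \<delta>0 + 2/9 * d + u / 3 + 29 * a + 6 * b"
  proof -
    have "3 * (L * Sb) \<le> \<delta>0 + e / 2 + D1 / 8 + 2 * (L * \<kappa>\<^sup>2 * Sxl)"
      using \<delta> by (simp add: e_def D1_def algebra_simps)
    also have "\<dots> \<le> \<delta>0 + e / 2 + (4 * d + 2 * e + 36 * (8 * a + 2 * b)) / 8 + 2 * (8 * a + 2 * b)"
      using D' xl by (intro add_mono divide_right_mono mult_left_mono order_refl) auto
    also have "\<dots> = \<delta>0 + 3 / 4 * e + d / 2 + 52 * a + 13 * b" by (simp add: field_simps)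
    also have "\<dots> \<le> \<delta>0 + 3 / 4 * (u + L * Sx + L * Sb) + d / 2 + 52 * a + 13 * b"
      using E' by (intro add_mono mult_left_mono order_refl) (simp_all add: Z_def algebra_simps)
    finally have "3 * (L * Sb) \<le> \<delta>0 + 3 / 4 * (u + L * Sx + L * Sb) + d / 2 + 52 * a + 13 * b" .
    then have "L * Sb \<le> 4/9 * \<delta>0 + 2/9 * d + u / 3 + 220/9 * a + 52/9 * b" using LSx by argo
    moreover have "Z = L * Sx + L * Sb" by (simp add: Z_def algebra_simps)
    ultimately show ?thesis using LSx ab by argo
  qed
  define w where "w = Sv / LP"
  define k where "k = L / (LP * s)"
  have k0: "k \<ge> 0" using L LP0 s by (simp add: k_def)
  \<comment> \<open>The goal asks for \<open>3 / 4\<close> of \<open>Sp / \<eta>\<close> and the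
    descent inequality \<open>A\<close> produces another \<open>1 / 2\<close>. Since
    \<open>Sp / \<eta>\<close> is at most \<open>Sv / (180 * LP)\<close>, these \<open>5 / 4\<close>
    cost \<open>1 / 144\<close>.\<close>
  have Sp: "5 / 4 * (Sp / \<eta>) \<le> Sv / (144 * LP)"
  proof -
    have "\<eta> / s \<le> 1 / (180 * LP)" using \<eta> LP0 s by (simp add: s_def field_simps)
    then have "(\<eta> / s) * Sv \<le> 1 / (180 * LP) * Sv" using nn by (intro mult_right_mono) auto
    moreover have "Sp / \<eta> \<le> (\<eta>\<^sup>2 * Sv / s) / \<eta>" using P(1) \<eta> by (intro divide_right_mono) (auto simp: s_def)
    moreover have "(\<eta>\<^sup>2 * Sv / s) / \<eta> = (\<eta> / s) * Sv" using \<eta> by (simp add: power2_eq_square)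
    ultimately show ?thesis by simp
  qed
  \<comment> \<open>\<open>29 / 720 = 1 / 60 + 1 / 60 + 1 / 144\<close>: tracking error from the
    goal, from \<open>A\<close>, and from the consensus error just converted. For the initial term,
    the average of \<open>1 / 20\<close> and \<open>1 / 15\<close> with weights
    \<open>1 - \<rho>\<close> and \<rho> exceeds this number.\<close>
  have Sv: "29 / 720 * w \<le> (1 / (20 * LP) + \<rho> / (15 * LP * (1 - \<rho>))) * v0 + 29 / 720 * (k * (6 * u + 9 * Z))"
  proof -
    have "6 * SE + 3 * L\<^sup>2 * (Sx + Sb) = L * (6 * e + 3 * Z)" using L by (simp add: e_def Z_def algebra_simps power2_eq_square)
    also have "\<dots> \<le> L * (6 * u + 9 * Z)" using E' L by (intro mult_left_mono) auto
    finally have "(6 * SE + 3 * L\<^sup>2 * (Sx + Sb)) / s \<le> L * (6 * u + 9 * Z) / s" using s by (intro divide_right_mono) auto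
    then have "Sv \<le> v0 / (1 - \<rho>) + L * (6 * u + 9 * Z) / s" using V by (simp add: s_def)
    then have "w \<le> (v0 / (1 - \<rho>) + L * (6 * u + 9 * Z) / s) / LP" unfolding w_def using LP0 by (intro divide_right_mono) auto
    also have "\<dots> = v0 / (LP * (1 - \<rho>)) + k * (6 * u + 9 * Z)" by (simp add: k_def add_divide_distrib mult_ac)
    finally have "29 / 720 * w \<le> 29 / 720 * (v0 / (LP * (1 - \<rho>))) + 29 / 720 * (k * (6 * u + 9 * Z))" by argo
    moreover have "29 / 720 * (v0 / (LP * (1 - \<rho>))) \<le> (1 / (20 * LP) + \<rho> / (15 * LP * (1 - \<rho>))) * v0"
    proof -
      have "(1 / (20 * LP) + \<rho> / (15 * LP * (1 - \<rho>))) * v0 = (1 / 20 * (1 - \<rho>) + \<rho> / 15) * (v0 / (LP * (1 - \<rho>)))"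
        unfolding distrib_right
        by (rule arg_cong2[where f = "(+)"]) (use \<rho> in simp_all)
      moreover have "29 / 720 * (v0 / (LP * (1 - \<rho>))) \<le> (1 / 20 * (1 - \<rho>) + \<rho> / 15) * (v0 / (LP * (1 - \<rho>)))"
      proof (rule mult_right_mono)
        show "29 / 720 \<le> 1 / 20 * (1 - \<rho>) + \<rho> / 15" using \<rho> by argo
      qed (use LP0 \<rho> nn in simp)
      ultimately show ?thesis by simp
    qed
    ultimately show ?thesis by linarith
  qed
  have kZ: "k * (6 * u + 9 * Z) \<le> k * (9 * u + 4 * \<delta>0 + 2 * d + 261 * a + 54 * b)"
    using Zle k0 by (intro mult_left_mono) auto
  \<comment> \<open>\<open>LP\<close> is at least \<open>2 * L * \<kappa>\<close>, so the
    \<open>\<kappa>\<^sup>2\<close> inside \<open>a\<close> can be traded for \<open>LP\<close>, the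
    scale of the first bound on the primal step size.\<close>
  have ka: "k * a \<le> LP / s * N1 / 4"
  proof -
    have "k * a = (2 * L * \<kappa>)\<^sup>2 / (4 * LP * s) * N1" by (simp add: k_def a_def power2_eq_square)
    also have "\<dots> \<le> LP\<^sup>2 / (4 * LP * s) * N1"
      using \<open>(2 * L * \<kappa>)\<^sup>2 \<le> LP\<^sup>2\<close> LP0 s nn by (intro mult_right_mono divide_right_mono) auto
    also have "\<dots> = LP / s * N1 / 4" using LP0 by (simp add: power2_eq_square)
    finally show ?thesis .
  qed
  have kb: "144 / 5 * (k * b) \<le> Sl / (2 * \<eta>')"
  proof -
    have "Sl / (2 * \<eta>') = 1 / 2 * (1 / \<eta>' * Sl)" by simp
    also have "\<dots> \<ge> 1 / 2 * (24 * L\<^sup>2 * (12 * \<kappa>\<^sup>2) / (5 * LP * (1 - \<rho>)\<^sup>2) * Sl)"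
      using \<eta>'(2) nn by (intro mult_left_mono mult_right_mono) auto
    also have "1 / 2 * (24 * L\<^sup>2 * (12 * \<kappa>\<^sup>2) / (5 * LP * (1 - \<rho>)\<^sup>2) * Sl) = 144 / 5 * (k * b)"
      by (simp add: k_def b_def s_def power2_eq_square mult_ac)
    finally show ?thesis .
  qed
  have b64: "64 * b \<le> Sl / (2 * \<eta>')"
    using mult_right_mono[OF \<eta>'(3) nn(5)] by (simp add: b_def algebra_simps)
  \<comment> \<open>The two bounds on \<open>1 / \<eta>\<close> draw on the same reserve
    \<open>N1 / (4 * \<eta>)\<close>, just as \<open>kb\<close> and \<open>b64\<close> draw on
    \<open>Sl / (2 * \<eta>')\<close>. A convex combination within each pair has to cover all terms:
    multiples of \<open>LP\<close> go to \<open>N1a\<close>, those of \<open>a\<close> and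
    \<open>L * N1\<close> to \<open>N1b\<close>.\<close>
  have N1a: "45 * (LP / s * N1) \<le> N1 / (4 * \<eta>)"
    using mult_right_mono[OF \<eta>(2) nn(1)] by (simp add: s_def)
  have N1b: "60 * a + 10 * (L * \<kappa> * N1) + 25 * (L * N1) \<le> N1 / (4 * \<eta>)"
    using mult_right_mono[OF \<eta>(3) nn(1)] by (simp add: a_def algebra_simps)
  have LPs: "LP * N1 \<le> LP / s * N1" using s LP0 nn by (intro mult_right_mono) (auto simp: field_simps)
  have La: "L * N1 \<le> L * \<kappa> * N1" "L * \<kappa> * N1 \<le> a"
    using mult_right_mono[OF \<kappa>, of "L * N1"] mult_right_mono[OF \<kappa>, of "L * \<kappa> * N1"] L nn \<kappa>
    by (simp_all add: a_def power2_eq_square mult_ac)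
  have Lb: "L * \<kappa> * Sl \<le> b"
    using mult_right_mono[OF \<kappa>, of "L * \<kappa> * Sl"] L nn \<kappa> by (simp add: b_def power2_eq_square mult_ac)
  \<comment> \<open>Half of \<open>N1 / (2 * \<eta>)\<close> and half of \<open>Sl / \<eta>'\<close>
    are claimed by the goal; the other halves stand here with a minus sign as the reserve.\<close>
  have A': "N1 / (4 * \<eta>) + Sl / (2 * \<eta>') + N2 / (4 * \<eta>) + 3 / (4 * \<eta>) * Sp + Sv / (60 * LP)
    \<le> \<Phi>0 + (16 * (L * N1) + 3 * (L * \<kappa> * N1) + 26 * a + 15 * (LP * N1) - N1 / (4 * \<eta>))
       + (26 * b + 3 * (L * \<kappa> * Sl) - Sl / (2 * \<eta>')) + (L * N1 + L * \<kappa> * N1) / 2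
       + 29 / 720 * w + e / 60 + D1 / 52"
  proof -
    have "L / 2 * (1 + \<kappa>) * Sp \<le> L / 2 * (1 + \<kappa>) * N1" using P(2) L \<kappa> by (intro mult_left_mono) auto
    moreover have "0 \<le> N2 / (4 * \<eta>)" using nn \<eta> by simp
    moreover have "N1 / \<eta> / 2 - (16 * (L * N1) + 3 * (L * \<kappa> * N1) + 26 * a + 15 * (LP * N1)) + N2 / \<eta> / 2
        + Sl / \<eta>' - (26 * b + 3 * (L * \<kappa> * Sl))
        \<le> \<Phi>0 + e / 60 + w / 60 + D1 / 52 + Sp / \<eta> / 2 + L / 2 * (1 + \<kappa>) * Sp"
      using A by (simp add: w_def a_def b_def e_def D1_def algebra_simps)
    moreover have "5 / 4 * (Sp / \<eta>) \<le> w / 144" using Sp by (simp add: w_def)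
    moreover have "N1 / (4 * \<eta>) = N1 / \<eta> / 4" "N2 / (4 * \<eta>) = N2 / \<eta> / 4" "Sl / (2 * \<eta>') = Sl / \<eta>' / 2"
      "3 / (4 * \<eta>) * Sp = 3 / 4 * (Sp / \<eta>)" "Sv / (60 * LP) = w / 60" "L / 2 * (1 + \<kappa>) * N1 = (L * N1 + L * \<kappa> * N1) / 2"
      by (simp_all add: w_def algebra_simps)
    ultimately show ?thesis by argo
  qed
  have "N1 / (4 * \<eta>) + Sl / (2 * \<eta>') + N2 / (4 * \<eta>) + 3 / (4 * \<eta>) * Sp + Sv / (60 * LP)
    \<le> \<Phi>0 + (1 / (20 * LP) + \<rho> / (15 * LP * (1 - \<rho>))) * v0 + (1/8 * \<delta>0 + 6/64 * d + 1/8 * u)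
     + (6/5 * (k * \<delta>0) + 3/10 * (k * d) + k * u)"
  proof -
    have kk: "0 \<le> k * u" "0 \<le> k * \<delta>0" "0 \<le> k * d" "0 \<le> k * b" "0 \<le> LP / s * N1"
      using k0 ab nn LP0 s by auto
    have "k * (9 * u + 4 * \<delta>0 + 2 * d + 261 * a + 54 * b) = 9 * (k * u) + 4 * (k * \<delta>0) + 2 * (k * d) + 261 * (k * a) + 54 * (k * b)"
      by (simp add: algebra_simps)
    then have "29 / 720 * w \<le> (1 / (20 * LP) + \<rho> / (15 * LP * (1 - \<rho>))) * v0
      + (6/5 * (k * \<delta>0) + 3/10 * (k * d) + k * u) + 66/25 * (LP / s * N1) + 11/5 * (k * b)"
      using Sv kZ ka kk kb by argo
    \<comment> \<open>The share \<open>1 / 52\<close> of the distance matters: \<open>4 / 52\<close>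
      of \<open>d\<close>, together with what returns through \<open>e\<close>, stays just below
      \<open>6 / 64\<close>.\<close>
    moreover have "e / 60 + D1 / 52 \<le> 1/8 * \<delta>0 + 6/64 * d + 1/8 * u + 36/5 * a + 9/5 * b"
      using E' D' Zle ab nn(12) by argo
    ultimately show ?thesis using A' N1a N1b LPs La Lb kb b64 ab kk by argo
  qed
  also have "6/5 * (k * \<delta>0) + 3/10 * (k * d) + k * u = 6 * L / (5 * LP * (1 - \<rho>)\<^sup>2) * \<delta>0
    + 3 * L\<^sup>2 / (10 * LP * \<kappa> * (1 - \<rho>)\<^sup>2) * D0 + 1 / (LP * (1 - \<rho>)\<^sup>2) * U"
    using L by (simp add: k_def d_def u_def s_def power2_eq_square mult_ac)
  \<comment> \<open>The coefficients in the statement exceed those obtained here by nonnegative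
    amounts.\<close>
  also have "1/8 * \<delta>0 + 6/64 * d + 1/8 * u \<le> ((1 + 1 / L) / 8 + L / (30 * LP)) * \<delta>0
    + (6 * (L + 1) / (64 * \<kappa>) + L\<^sup>2 / (120 * LP * \<kappa>)) * D0 + (1 / (30 * LP) + (L + 1) / (8 * L\<^sup>2)) * U"
  proof (intro add_mono)
    show "1/8 * \<delta>0 \<le> ((1 + 1 / L) / 8 + L / (30 * LP)) * \<delta>0"
      using L LP0 nn by (intro mult_right_mono) (auto simp: add_divide_distrib)
    have "6/64 * d = 6 * L / (64 * \<kappa>) * D0" by (simp add: d_def)
    also have "\<dots> \<le> (6 * (L + 1) / (64 * \<kappa>) + L\<^sup>2 / (120 * LP * \<kappa>)) * D0"
      using L LP0 nn \<kappa> by (intro mult_right_mono) (auto simp: add_divide_distrib)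
    finally show "6/64 * d \<le> (6 * (L + 1) / (64 * \<kappa>) + L\<^sup>2 / (120 * LP * \<kappa>)) * D0" .
    have "1/8 * u = L / (8 * L\<^sup>2) * U" using L by (simp add: u_def power2_eq_square)
    also have "\<dots> \<le> (1 / (30 * LP) + (L + 1) / (8 * L\<^sup>2)) * U"
      using L LP0 nn by (intro mult_right_mono) (auto simp: add_divide_distrib)
    finally show "1/8 * u \<le> (1 / (30 * LP) + (L + 1) / (8 * L\<^sup>2)) * U" .
  qed
  finally show ?thesis by (simp add: error_terms_def algebra_simps)
qed

subsection \<open>One step of the algorithm\<close>

text \<open>Expanding the squares around the gradient step cancels the squared norm of
  \<open>v\<close> and leaves a linear term; the competitor \<open>u\<close> stays free.\<close>

lemma prox_step:
  fixes r :: "'a::euclidean_space \<Rightarrow> ereal" and y v :: 'a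
  assumes r: "closed_convex_fun r" and e: "\<eta> > 0" and u: "u \<in> edom r"
  defines "w \<equiv> prox (\<lambda>v. ereal \<eta> * r v) (y + \<eta> *\<^sub>R v)"
  shows "real_of_ereal (r w) - inner (w - u) v + ((norm (w - y))\<^sup>2 + (norm (u - w))\<^sup>2 - (norm (u - y))\<^sup>2) / (2 * \<eta>)
    \<le> real_of_ereal (r u)"
proof -
  have sq: "(norm (z - (y + \<eta> *\<^sub>R v)))\<^sup>2 = (norm (z - y))\<^sup>2 - 2 * \<eta> * inner (z - y) v + \<eta>\<^sup>2 * (norm v)\<^sup>2" for z
    unfolding power2_norm_eq_inner by (simp add: algebra_simps inner_commute power2_eq_square)
  have "real_of_ereal (r w) + ((norm (w - (y + \<eta> *\<^sub>R v)))\<^sup>2 + (norm (u - w))\<^sup>2) / (2 * \<eta>)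
     \<le> real_of_ereal (r u) + (norm (u - (y + \<eta> *\<^sub>R v)))\<^sup>2 / (2 * \<eta>)"
    unfolding w_def using u by (intro prox_ineq[OF r _ e]) auto
  moreover have "(a - 2 * \<eta> * j + c + b) / (2 * \<eta>) = (a + b) / (2 * \<eta>) - j + c / (2 * \<eta>)" for a b c j :: real
    using e by (simp add: field_simps)
  moreover have "(a - 2 * \<eta> * j + c) / (2 * \<eta>) = a / (2 * \<eta>) - j + c / (2 * \<eta>)" for a c j :: real
    using e by (simp add: field_simps)
  ultimately show ?thesis
    unfolding sq by (simp add: inner_diff_left add_divide_distrib diff_divide_distrib)
qed

lemma norm_sum_rows_le: "(\<Sum>i\<in>UNIV. norm ((X :: real ^ 'd ^ 'm) $ i) * norm ((Z :: real ^ 'e ^ 'm) $ i)) \<le> norm X * norm Z"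
  using L2_set_mult_ineq[of "\<lambda>i. norm (X $ i)" "\<lambda>i. norm (Z $ i)" UNIV] by (simp add: norm_vec_def[of X] norm_vec_def[of Z])

section \<open>The scaled objective and its maximizer in \<open>Y\<close>\<close>

locale minimax = mixing W \<rho> for W :: "real ^ 'm ^ 'm" and \<rho> :: real +
  fixes m L \<mu> \<kappa> :: real and f :: "'m \<Rightarrow> (real ^ 'a) \<times> (real ^ 'b) \<Rightarrow> real" and g :: "real ^ 'a \<Rightarrow> ereal" and h :: "real ^ 'b \<Rightarrow> ereal"
  assumes m_card: "m = real CARD('m)"
    and mu: "\<mu> > 0"
    and f_smooth: "\<And>i. smooth L (f i)"
    and f_concave: "\<And>i x. strongly_concave \<mu> (\<lambda>y. f i (x, y))"
    and g_cc: "closed_convex_fun g"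
    and h_cc: "closed_convex_fun h" and h_dom: "edom h \<noteq> {}"
    and kappa: "\<kappa> = L / \<mu>"
begin

lemma mu_le_L: "\<mu> \<le> L" using strong_concavity_le_smoothness[OF f_smooth f_concave] .
lemma L_pos: "L > 0" using mu_le_L mu by simp
lemma kappa_ge1: "\<kappa> \<ge> 1" using mu_le_L mu by (simp add: kappa)
lemma m_pos: "m > 0" by (simp add: m_card)

text \<open>On the domain this is \<open>m * Phi\<close>, whence \<open>L * sqrt m / 2\<close> in
  place of \<open>L / (2 * sqrt m)\<close>. Outside the domain \<open>real_of_ereal\<close> turns
  \<infinity> into 0 and the value means nothing, so maximality statements carry
  \<open>ydom\<close>.\<close>

definition F :: "real ^ 'a ^ 'm \<Rightarrow> real ^ 'b ^ 'm \<Rightarrow> real ^ 'b ^ 'm \<Rightarrow> real" where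
  "F X \<Lambda> Y = (\<Sum>i\<in>UNIV. f i (X $ i, Y $ i) - real_of_ereal (h (Y $ i)))
     - (L * sqrt m / 2) * inner \<Lambda> ((W - mat 1) ** Y)"

definition ydom :: "real ^ 'b ^ 'm \<Rightarrow> bool" where "ydom Y \<longleftrightarrow> (\<forall>i. Y $ i \<in> edom h)"

lemma Phi_eq_F:
  assumes "ydom Y"
  shows "Phi L W f h X \<Lambda> Y = ereal (F X \<Lambda> Y / m)"
proof -
  have "ereal (f i (X $ i, Y $ i)) - h (Y $ i) = ereal (f i (X $ i, Y $ i) - real_of_ereal (h (Y $ i)))" for i
    by (subst ereal_on_edom[OF h_cc]) (use assms in \<open>auto simp: ydom_def\<close>)
  moreover have "L / (2 * sqrt m) = (L * sqrt m / 2) / m"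
    using m_pos by (simp add: field_simps flip: power2_eq_square)
  ultimately show ?thesis
    unfolding Phi_def F_def m_card[symmetric] by (simp add: diff_divide_distrib)
qed

text \<open>One summand is -\<infinity>, and none is +\<infinity> because \<open>h\<close> never
  takes the value -\<infinity>; so the extended sum does not fall into the undetermined
  case.\<close>

lemma Phi_outside:
  assumes "\<not> ydom Y"
  shows "Phi L W f h X \<Lambda> Y = - \<infinity>"
proof -
  obtain i where "Y $ i \<notin> edom h" using assms by (auto simp: ydom_def)
  then have i: "h (Y $ i) = \<infinity>" by (rule outside_edom)
  have ne: "ereal (f j (X $ j, Y $ j)) - h (Y $ j) \<noteq> \<infinity>" for j
    using h_cc by (cases "h (Y $ j)") (auto simp: closed_convex_fun_def)
  have "(\<Sum>j\<in>UNIV. ereal (f j (X $ j, Y $ j)) - h (Y $ j)) =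
    (ereal (f i (X $ i, Y $ i)) - h (Y $ i)) + (\<Sum>j\<in>UNIV - {i}. ereal (f j (X $ j, Y $ j)) - h (Y $ j))"
    by (rule sum.remove) auto
  also have "\<dots> = - \<infinity>"
    using i ne by (auto simp: sum_Pinfty)
  finally show ?thesis unfolding Phi_def by (simp add: ereal_mult_minus_right)
qed

text \<open>Moving \<open>W - mat 1\<close> to the multiplier by transposition decouples the agents:
  each row of \<open>Y\<close> solves its own strongly convex problem, and the row-wise quadratic
  growth adds up to the Frobenius norm.\<close>

lemma Yopt_exists: "\<exists>Z. ydom Z \<and> (\<forall>Y. ydom Y \<longrightarrow> F X \<Lambda> Y + \<mu> / 2 * (norm (Y - Z))\<^sup>2 \<le> F X \<Lambda> Z)"
proof -
  define A where "A = transpose (W - mat 1) ** \<Lambda>"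
  define p where "p i y = (L * sqrt m / 2) * inner (A $ i) y - f i (X $ i, y)" for i y
  have "\<exists>z\<in>edom h. \<forall>y\<in>edom h. real_of_ereal (h z) + p i z + \<mu> / 2 * (norm (y - z))\<^sup>2 \<le> real_of_ereal (h y) + p i y" for i
  proof (rule attains_min[OF h_cc _ mu _ h_dom])
    show "continuous_on UNIV (p i)"
      unfolding p_def by (intro continuous_intros continuous_on_compose2[OF smooth_continuous[OF f_smooth]]) auto
    show "strongly_convex \<mu> (p i)"
      unfolding p_def by (rule strongly_convex_linear_minus[OF f_concave])
  qed
  then obtain z where z: "\<And>i. z i \<in> edom h"
    "\<And>i y. y \<in> edom h \<Longrightarrow> real_of_ereal (h (z i)) + p i (z i) + \<mu> / 2 * (norm (y - z i))\<^sup>2 \<le> real_of_ereal (h y) + p i y"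
    by metis
  have F: "F X \<Lambda> Y = - (\<Sum>i\<in>UNIV. real_of_ereal (h (Y $ i)) + p i (Y $ i))" for Y
  proof -
    have "inner \<Lambda> ((W - mat 1) ** Y) = (\<Sum>i\<in>UNIV. inner (A $ i) (Y $ i))"
      unfolding A_def inner_matrix_transpose[symmetric] by (subst inner_vec_def) simp
    then show ?thesis
      by (simp add: F_def p_def sum.distrib sum_subtractf sum_distrib_left)
  qed
  let ?Z = "\<chi> i. z i"
  have "F X \<Lambda> Y + \<mu> / 2 * (norm (Y - ?Z))\<^sup>2 \<le> F X \<Lambda> ?Z" if "ydom Y" for Y
  proof -
    have "(\<Sum>i\<in>UNIV. real_of_ereal (h (z i)) + p i (z i) + \<mu> / 2 * (norm (Y $ i - z i))\<^sup>2)
      \<le> (\<Sum>i\<in>UNIV. real_of_ereal (h (Y $ i)) + p i (Y $ i))"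
      using that by (intro sum_mono z) (auto simp: ydom_def)
    then show ?thesis by (simp add: F norm_sq_rows sum_distrib_left sum.distrib)
  qed
  then show ?thesis using z(1) by (intro exI[of _ ?Z]) (auto simp: ydom_def)
qed

abbreviation Yo where "Yo \<equiv> Yopt L W f h"

text \<open>\<open>Yopt\<close> is a chosen maximizer in the extended reals. Quadratic growth at the
  point constructed before forces the two to coincide.\<close>

lemma
  shows Yopt_ydom: "ydom (Yo X \<Lambda>)"
    and Yopt_max: "ydom Y \<Longrightarrow> F X \<Lambda> Y + \<mu> / 2 * (norm (Y - Yo X \<Lambda>))\<^sup>2 \<le> F X \<Lambda> (Yo X \<Lambda>)"
proof -
  obtain Z where Z: "ydom Z" "\<And>Y. ydom Y \<Longrightarrow> F X \<Lambda> Y + \<mu> / 2 * (norm (Y - Z))\<^sup>2 \<le> F X \<Lambda> Z"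
    using Yopt_exists by blast
  have le: "F X \<Lambda> Y \<le> F X \<Lambda> Z" if "ydom Y" for Y
    using Z(2)[OF that] mu by (smt (verit) mult_nonneg_nonneg divide_nonneg_nonneg zero_le_power2)
  have Zmax: "Phi L W f h X \<Lambda> Y \<le> Phi L W f h X \<Lambda> Z" for Y
    by (cases "ydom Y") (use le Z(1) m_pos in \<open>auto simp: Phi_eq_F Phi_outside divide_right_mono\<close>)
  let ?Y = "Yo X \<Lambda>"
  have "is_arg_max (Phi L W f h X \<Lambda>) (\<lambda>_. True) ?Y"
    unfolding Yopt_def arg_max_def
    by (rule someI[of _ Z]) (use Zmax in \<open>auto simp: is_arg_max_def not_less\<close>)
  then have ge: "Phi L W f h X \<Lambda> Z \<le> Phi L W f h X \<Lambda> ?Y" by (auto simp: is_arg_max_def not_less)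
  show d: "ydom ?Y"
    using ge by (rule contrapos_pp) (simp add: Phi_outside Phi_eq_F[OF Z(1)])
  have "F X \<Lambda> Z \<le> F X \<Lambda> ?Y" using ge m_pos by (simp add: Phi_eq_F Z(1) d divide_le_cancel)
  then have "\<mu> / 2 * (norm (?Y - Z))\<^sup>2 \<le> 0" using Z(2)[OF d] by linarith
  then have "?Y = Z" using mu by (simp add: mult_le_0_iff)
  then show "ydom Y \<Longrightarrow> F X \<Lambda> Y + \<mu> / 2 * (norm (Y - ?Y))\<^sup>2 \<le> F X \<Lambda> ?Y" using Z(2) by simp
qed

lemma Yopt_le: "ydom Y \<Longrightarrow> F X \<Lambda> Y \<le> F X \<Lambda> (Yo X \<Lambda>)"
  using Yopt_max[of Y X \<Lambda>] mu by (smt (verit) mult_nonneg_nonneg divide_nonneg_nonneg zero_le_power2)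

lemma Qmax_eq_F: "Qmax L W f h X \<Lambda> = ereal (F X \<Lambda> (Yo X \<Lambda>) / m)"
  unfolding Qmax_def
proof (rule antisym)
  show "(SUP Y. Phi L W f h X \<Lambda> Y) \<le> ereal (F X \<Lambda> (Yo X \<Lambda>) / m)"
  proof (rule SUP_least)
    fix Y show "Phi L W f h X \<Lambda> Y \<le> ereal (F X \<Lambda> (Yo X \<Lambda>) / m)"
      by (cases "ydom Y") (use m_pos in \<open>auto simp: Phi_eq_F Phi_outside Yopt_le divide_right_mono\<close>)
  qed
  show "ereal (F X \<Lambda> (Yo X \<Lambda>) / m) \<le> (SUP Y. Phi L W f h X \<Lambda> Y)"
    unfolding Phi_eq_F[OF Yopt_ydom, symmetric] by (rule SUP_upper) simp
qed

lemma phi_eq_F: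
  assumes "x \<in> edom g"
  shows "phi L W f g h x \<Lambda> = ereal ((F (rep x) \<Lambda> (Yo (rep x) \<Lambda>) + m * real_of_ereal (g x)) / m)"
proof -
  have "phi L W f g h x \<Lambda> = Qmax L W f h (rep x) \<Lambda> + ereal (real_of_ereal (g x))"
    unfolding phi_def Pmax_def Qmax_def ereal_on_edom[OF g_cc assms, symmetric] ..
  then show ?thesis using m_pos by (simp add: Qmax_eq_F add_divide_distrib)
qed

text \<open>In this mixed difference all terms depending on \<open>Y\<close> alone or on the other
  arguments alone cancel. The bound 2 on the norm of \<open>W - mat 1\<close> cancels the
  \<open>1 / 2\<close> of the bilinear term, and the weight \<open>sqrt m\<close> of multiplier
  steps arises here.\<close>

lemma F_cross_difference:
  "(F X' \<Lambda>' Y - F X \<Lambda> Y) - (F X' \<Lambda>' Z - F X \<Lambda> Z)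
    \<le> L * (norm (X' - X) + sqrt m * norm (\<Lambda>' - \<Lambda>)) * norm (Y - Z)"
proof -
  have "(\<Sum>i\<in>UNIV. (f i (X' $ i, Y $ i) - f i (X $ i, Y $ i)) - (f i (X' $ i, Z $ i) - f i (X $ i, Z $ i)))
    \<le> (\<Sum>i\<in>UNIV. L * norm ((X' - X) $ i) * norm ((Y - Z) $ i))"
    by (intro sum_mono) (simp add: smooth_cross_difference[OF f_smooth])
  also have "\<dots> = L * (\<Sum>i\<in>UNIV. norm ((X' - X) $ i) * norm ((Y - Z) $ i))"
    by (simp add: sum_distrib_left mult.assoc)
  also have "\<dots> \<le> L * (norm (X' - X) * norm (Y - Z))"
    using L_pos norm_sum_rows_le[of "X' - X" "Y - Z"] by (intro mult_left_mono) auto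
  finally have 1: "(\<Sum>i\<in>UNIV. (f i (X' $ i, Y $ i) - f i (X $ i, Y $ i)) - (f i (X' $ i, Z $ i) - f i (X $ i, Z $ i)))
    \<le> L * (norm (X' - X) * norm (Y - Z))" .
  have "- inner (\<Lambda>' - \<Lambda>) ((W - mat 1) ** (Y - Z)) \<le> norm (\<Lambda>' - \<Lambda>) * norm ((W - mat 1) ** (Y - Z))"
    using Cauchy_Schwarz_ineq2 by (metis abs_le_D2)
  also have "\<dots> \<le> norm (\<Lambda>' - \<Lambda>) * (2 * norm (Y - Z))" by (intro mult_left_mono norm_W_minus_1) auto
  finally have "(L * sqrt m / 2) * (- inner (\<Lambda>' - \<Lambda>) ((W - mat 1) ** (Y - Z)))
    \<le> (L * sqrt m / 2) * (norm (\<Lambda>' - \<Lambda>) * (2 * norm (Y - Z)))"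
    using L_pos m_pos by (intro mult_left_mono) auto
  with 1 show ?thesis
    unfolding F_def matrix_mult_diff_right inner_diff_left inner_diff_right
    by (simp add: sum_subtractf sum.distrib algebra_simps)
qed

text \<open>Each maximizer is inserted as competitor into the quadratic growth at the other. The sum
  of both inequalities is a mixed difference, which is linear in the distance, while the growth is
  quadratic.\<close>

lemma Yopt_lipschitz:
  "norm (Yo X' \<Lambda>' - Yo X \<Lambda>) \<le> \<kappa> * (norm (X' - X) + sqrt m * norm (\<Lambda>' - \<Lambda>))"
proof -
  let ?d = "norm (Yo X' \<Lambda>' - Yo X \<Lambda>)"
  have "\<mu> * ?d\<^sup>2 \<le> L * (norm (X' - X) + sqrt m * norm (\<Lambda>' - \<Lambda>)) * ?d"
    using F_cross_difference[of X' \<Lambda>' "Yo X' \<Lambda>'" X \<Lambda> "Yo X \<Lambda>"]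
      Yopt_max[OF Yopt_ydom, of X \<Lambda> X' \<Lambda>'] Yopt_max[OF Yopt_ydom, of X' \<Lambda>' X \<Lambda>]
    by (simp add: norm_minus_commute)
  then have "?d * (\<mu> * ?d) \<le> ?d * (L * (norm (X' - X) + sqrt m * norm (\<Lambda>' - \<Lambda>)))"
    by (simp add: power2_eq_square mult_ac)
  moreover have "0 \<le> L * (norm (X' - X) + sqrt m * norm (\<Lambda>' - \<Lambda>))" using L_pos m_pos by simp
  ultimately have "\<mu> * ?d \<le> L * (norm (X' - X) + sqrt m * norm (\<Lambda>' - \<Lambda>))"
    by (cases "?d = 0") (simp_all add: mult_le_cancel_left)
  then show ?thesis using mu by (simp add: kappa field_simps)
qed

section \<open>One-step inequalities for the dual, primal and consensus updates\<close>

definition gradx where "gradx X Y = (\<chi> i. fst (grad (f i) (X $ i, Y $ i)))"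
definition grady where "grady X Y = (\<chi> i. snd (grad (f i) (X $ i, Y $ i)))"

lemma ydom_prox:
  assumes "\<eta> > 0"
  shows "ydom (prox_rows (\<lambda>v. ereal \<eta> * h v) Z)"
  by (simp add: ydom_def prox_rows_def prox_in_edom[OF h_cc h_dom assms])

text \<open>Three-point inequality of the proximal map, strong concavity from \<open>Y\<close> to
  \<open>U\<close> and smoothness from \<open>Y\<close> to the new point are added row by row; the
  linear multiplier term cancels exactly. \<open>2 * L\<close> is half the inverse of the step size.
  The competitor \<open>U\<close> is free: the maximizer gives the contraction, \<open>Y\<close>
  itself the ascent.\<close>

lemma dual_step:
  fixes X \<Lambda> Y Dy
  defines "Y' \<equiv> prox_rows (\<lambda>v. ereal (1 / (4 * L)) * h v)
      (Y + (1 / (4 * L)) *\<^sub>R (Dy - (L * sqrt m / 2) *\<^sub>R (transpose (W - mat 1) ** \<Lambda>)))"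
  assumes U: "ydom U"
  shows "F X \<Lambda> U - F X \<Lambda> Y' \<le> norm (Dy - grady X Y) * norm (Y' - U) - \<mu> / 2 * (norm (U - Y))\<^sup>2
      + L / 2 * (norm (Y' - Y))\<^sup>2 - 2 * L * ((norm (Y' - Y))\<^sup>2 + (norm (Y' - U))\<^sup>2 - (norm (U - Y))\<^sup>2)"
proof -
  define A where "A = (L * sqrt m / 2) *\<^sub>R (transpose (W - mat 1) ** \<Lambda>)"
  have A: "inner A Z = (L * sqrt m / 2) * inner \<Lambda> ((W - mat 1) ** Z)" for Z
    by (simp add: A_def inner_matrix_transpose)
  have row: "(f i (X $ i, U $ i) - real_of_ereal (h (U $ i))) - (f i (X $ i, Y' $ i) - real_of_ereal (h (Y' $ i)))
     \<le> inner ((Y' - U) $ i) ((Dy - A - grady X Y) $ i) - \<mu> / 2 * (norm ((U - Y) $ i))\<^sup>2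
      + L / 2 * (norm ((Y' - Y) $ i))\<^sup>2 - 2 * L * ((norm ((Y' - Y) $ i))\<^sup>2 + (norm ((Y' - U) $ i))\<^sup>2 - (norm ((U - Y) $ i))\<^sup>2)" (is "?l i \<le> ?r i") for i
  proof -
    let ?G = "grad (f i) (X $ i, Y $ i)"
    have Y': "Y' $ i = prox (\<lambda>v. ereal (1 / (4 * L)) * h v) (Y $ i + (1 / (4 * L)) *\<^sub>R ((Dy - A) $ i))"
      by (simp add: Y'_def prox_rows_def A_def)
    have 1: "real_of_ereal (h (Y' $ i)) - inner (Y' $ i - U $ i) ((Dy - A) $ i)
       + 2 * L * ((norm (Y' $ i - Y $ i))\<^sup>2 + (norm (U $ i - Y' $ i))\<^sup>2 - (norm (U $ i - Y $ i))\<^sup>2) \<le> real_of_ereal (h (U $ i))"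
      using prox_step[OF h_cc, of "1 / (4 * L)" "U $ i" "Y $ i" "(Dy - A) $ i"] L_pos U
      unfolding Y'[symmetric] by (simp add: ydom_def field_simps)
    have 2: "f i (X $ i, U $ i) \<le> f i (X $ i, Y $ i) + inner (U $ i - Y $ i) (snd ?G) - \<mu> / 2 * (norm (U $ i - Y $ i))\<^sup>2"
      by (rule strongly_concave_first_order[OF f_smooth f_concave])
    have 3: "- (f i (X $ i, Y' $ i) - f i (X $ i, Y $ i) - inner (Y' $ i - Y $ i) (snd ?G)) \<le> L / 2 * (norm (Y' $ i - Y $ i))\<^sup>2"
      using smooth_bounds[OF f_smooth[of i], of "(X $ i, Y' $ i)" "(X $ i, Y $ i)"] unfolding abs_le_iff
      by (simp add: norm_Pair inner_prod_def)
    show ?thesis using 1 2 3 by (simp add: grady_def inner_diff_left inner_diff_right norm_minus_commute[of "U $ i" "Y' $ i"])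
  qed
  have "F X \<Lambda> U - F X \<Lambda> Y' = (\<Sum>i\<in>UNIV. (f i (X $ i, U $ i) - real_of_ereal (h (U $ i))) - (f i (X $ i, Y' $ i) - real_of_ereal (h (Y' $ i))))
     + inner A (Y' - U)"
    unfolding F_def A by (simp add: sum_subtractf sum.distrib matrix_mult_diff_right inner_diff_right algebra_simps)
  also have "\<dots> \<le> inner (Y' - U) (Dy - A - grady X Y) - \<mu> / 2 * (norm (U - Y))\<^sup>2
      + L / 2 * (norm (Y' - Y))\<^sup>2 - 2 * L * ((norm (Y' - Y))\<^sup>2 + (norm (Y' - U))\<^sup>2 - (norm (U - Y))\<^sup>2) + inner A (Y' - U)"
  proof -
    have "(\<Sum>i\<in>UNIV. ?l i) \<le> (\<Sum>i\<in>UNIV. ?r i)" by (intro sum_mono row)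
    then show ?thesis
      by (simp add: norm_sq_rows sum.distrib sum_subtractf sum_distrib_left[symmetric] sum_divide_distrib[symmetric]
          inner_vec_def[where 'b='m])
  qed
  also have "inner (Y' - U) (Dy - A - grady X Y) = inner (Dy - grady X Y) (Y' - U) - inner A (Y' - U)"
    by (simp add: inner_diff_left inner_diff_right inner_commute)
  finally show ?thesis using norm_cauchy_schwarz[of "Dy - grady X Y" "Y' - U"] by linarith
qed

definition dualstep where
  "dualstep \<Lambda> Y Dy = prox_rows (\<lambda>v. ereal (1 / (4 * L)) * h v)
      (Y + (1 / (4 * L)) *\<^sub>R (Dy - (L * sqrt m / 2) *\<^sub>R (transpose (W - mat 1) ** \<Lambda>)))"

text \<open>Strong concavity helps twice, at the old point and through quadratic growth at the new
  one, with \<open>\<mu> / 2\<close> each. The estimation error uses \<open>\<mu> / 4\<close> of the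
  second; the rest stays on the left as \<open>1 / (8 * \<kappa>)\<close> and later pays for the
  drift of the maximizer.\<close>

lemma dual_contraction:
  fixes \<Lambda> Y Dy
  assumes E: "norm (Dy - grady X Y) \<le> E"
  defines "b \<equiv> norm (dualstep \<Lambda> Y Dy - Y)"
  shows "(1 + 1 / (8 * \<kappa>)) * (norm (dualstep \<Lambda> Y Dy - Yo X \<Lambda>))\<^sup>2
    \<le> (1 - 1 / (4 * \<kappa>)) * (norm (Y - Yo X \<Lambda>))\<^sup>2 + \<kappa> / (2 * L\<^sup>2) * E\<^sup>2 - 3 / 4 * b\<^sup>2"
proof -
  let ?Y' = "dualstep \<Lambda> Y Dy" and ?U = "Yo X \<Lambda>"
  define d' where "d' = norm (?Y' - ?U)"
  define d where "d = norm (?U - Y)"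
  have "ydom ?Y'" unfolding dualstep_def by (rule ydom_prox) (use L_pos in simp)
  from Yopt_max[OF this, of X \<Lambda>] have 1: "\<mu> / 2 * d'\<^sup>2 \<le> F X \<Lambda> ?U - F X \<Lambda> ?Y'" by (simp add: d'_def)
  have 2: "F X \<Lambda> ?U - F X \<Lambda> ?Y' \<le> norm (Dy - grady X Y) * d' - \<mu> / 2 * d\<^sup>2 + L / 2 * b\<^sup>2 - 2 * L * (b\<^sup>2 + d'\<^sup>2 - d\<^sup>2)"
    unfolding d'_def d_def b_def dualstep_def by (rule dual_step[OF Yopt_ydom])
  have "norm (Dy - grady X Y) * d' \<le> E * d'" using E by (intro mult_right_mono) (auto simp: d'_def)
  also have "E * d' \<le> E\<^sup>2 / \<mu> + \<mu> / 4 * d'\<^sup>2"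
  proof -
    have "0 \<le> (E - \<mu> / 2 * d')\<^sup>2 / \<mu>" using mu by simp
    also have "\<dots> = E\<^sup>2 / \<mu> + \<mu> / 4 * d'\<^sup>2 - E * d'" using mu by (simp add: field_simps power2_eq_square)
    finally show ?thesis by simp
  qed
  finally have "(2 * L + \<mu> / 4) * d'\<^sup>2 \<le> (2 * L - \<mu> / 2) * d\<^sup>2 + E\<^sup>2 / \<mu> - 3 / 2 * L * b\<^sup>2"
    using 1 2 by (simp add: algebra_simps)
  then have "((2 * L + \<mu> / 4) * d'\<^sup>2) / (2 * L) \<le> ((2 * L - \<mu> / 2) * d\<^sup>2 + E\<^sup>2 / \<mu> - 3 / 2 * L * b\<^sup>2) / (2 * L)"
    using L_pos by (intro divide_right_mono) auto
  then show ?thesis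
    using L_pos mu unfolding d'_def[symmetric] norm_minus_commute[of Y] d_def[symmetric]
    by (simp add: kappa field_simps power2_eq_square)
qed

text \<open>With competitor \<open>Y\<close> the three-point inequality contributes
  \<open>4 * L\<close>, of which smoothness takes back \<open>L / 2\<close>.\<close>

lemma dual_ascent:
  fixes \<Lambda> Y Dy
  assumes E: "norm (Dy - grady X Y) \<le> E" and Y: "ydom Y"
  defines "b \<equiv> norm (dualstep \<Lambda> Y Dy - Y)"
  shows "F X \<Lambda> Y + 7 / 2 * L * b\<^sup>2 - E * b \<le> F X \<Lambda> (dualstep \<Lambda> Y Dy)"
proof -
  have "F X \<Lambda> Y - F X \<Lambda> (dualstep \<Lambda> Y Dy) \<le> norm (Dy - grady X Y) * b + L / 2 * b\<^sup>2 - 2 * L * (b\<^sup>2 + b\<^sup>2)"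
    using dual_step[OF Y, of X \<Lambda> Y Dy] unfolding b_def dualstep_def by simp
  moreover have "norm (Dy - grady X Y) * b \<le> E * b" using E by (intro mult_right_mono) (auto simp: b_def)
  ultimately show ?thesis by simp
qed

text \<open>The new maximizer is merely a competitor at the old point, so the old gap bounds it
  there; the mixed difference charges the move to the distance of \<open>Y\<close> from the new
  maximizer.\<close>

lemma gap_drift:
  "F X' \<Lambda>' (Yo X' \<Lambda>') - F X' \<Lambda>' Y \<le> F X \<Lambda> (Yo X \<Lambda>) - F X \<Lambda> Y
    + L * norm (Y - Yo X' \<Lambda>') * (norm (X' - X) + sqrt m * norm (\<Lambda>' - \<Lambda>))"
  using F_cross_difference[of X' \<Lambda>' "Yo X' \<Lambda>'" X \<Lambda> Y] Yopt_le[OF Yopt_ydom, of X \<Lambda> X' \<Lambda>']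
  by (simp add: norm_minus_commute mult_ac)

text \<open>For \<open>x\<close> in \<open>edom g\<close> this is \<open>m * phi\<close>, see
  \<open>phi_eq_F\<close>.\<close>

definition potential where
  "potential x \<Lambda> = F (rep x) \<Lambda> (Yo (rep x) \<Lambda>) + m * real_of_ereal (g x)"

lemma norm_gradx_diff_sq_le:
  "(norm (gradx X' Y' - gradx X Y))\<^sup>2 \<le> L\<^sup>2 * ((norm (X' - X))\<^sup>2 + (norm (Y' - Y))\<^sup>2)"
proof -
  have "(norm (gradx X' Y' - gradx X Y))\<^sup>2 \<le> (\<Sum>i\<in>UNIV. L\<^sup>2 * ((norm ((X' - X) $ i))\<^sup>2 + (norm ((Y' - Y) $ i))\<^sup>2))"
    unfolding norm_sq_rows
  proof (rule sum_mono)
    fix i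
    have "norm ((gradx X' Y' - gradx X Y) $ i) \<le> norm (grad (f i) (X' $ i, Y' $ i) - grad (f i) (X $ i, Y $ i))"
      by (simp add: gradx_def norm_fst_snd_le flip: fst_diff)
    also have "\<dots> \<le> L * norm ((X' - X) $ i, (Y' - Y) $ i)"
      using smooth_lipschitz[OF f_smooth[of i], of "(X' $ i, Y' $ i)" "(X $ i, Y $ i)"] by simp
    finally show "(norm ((gradx X' Y' - gradx X Y) $ i))\<^sup>2 \<le> L\<^sup>2 * ((norm ((X' - X) $ i))\<^sup>2 + (norm ((Y' - Y) $ i))\<^sup>2)"
      using power_mono[of _ _ 2] by (metis norm_Pair_sq norm_ge_zero power_mult_distrib)
  qed
  also have "\<dots> = L\<^sup>2 * ((norm (X' - X))\<^sup>2 + (norm (Y' - Y))\<^sup>2)"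
    by (simp add: norm_sq_rows sum.distrib flip: sum_distrib_left)
  finally show ?thesis .
qed

lemma norm_gradx_diff_le:
  "norm (gradx X' Y' - gradx X Y) \<le> L * (norm (X' - X) + norm (Y' - Y))"
proof (rule power2_le_imp_le)
  have "(norm (X' - X))\<^sup>2 + (norm (Y' - Y))\<^sup>2 \<le> (norm (X' - X) + norm (Y' - Y))\<^sup>2" by (simp add: power2_sum)
  then show "(norm (gradx X' Y' - gradx X Y))\<^sup>2 \<le> (L * (norm (X' - X) + norm (Y' - Y)))\<^sup>2"
    using norm_gradx_diff_sq_le[of X' Y' X Y] L_pos unfolding power_mult_distrib
    by (meson mult_left_mono order_trans zero_le_power2)
qed (use L_pos in auto)

text \<open>
  The maximizer at the new point is used as a competitor at the old one, so that no differentiability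
  of the maximum is needed; the price is only the drift of the maximizer.
\<close>

lemma primal_step:
  fixes X V Dx :: "real ^ 'a ^ 'm" and \<Lambda> Y :: "real ^ 'b ^ 'm"
  assumes \<eta>: "\<eta> > 0" and \<eta>': "\<eta>' > 0" and E: "norm (Dx - gradx X Y) \<le> E"
    and V: "row_avg V = row_avg Dx" and xdom: "row_avg X \<in> edom g"
  defines "X' \<equiv> prox_rows (\<lambda>v. ereal \<eta> * g v) (W ** X - \<eta> *\<^sub>R V)"
    and "\<Lambda>' \<equiv> \<Lambda> + (L * \<eta>' / (2 * sqrt m)) *\<^sub>R ((W - mat 1) ** Y)"
  defines "n1 \<equiv> norm (X' - rep (row_avg X))" and "n2 \<equiv> norm (X' - W ** X)" and "p \<equiv> norm (perp X)"
    and "v \<equiv> norm (perp V)" and "l \<equiv> sqrt m * norm (\<Lambda>' - \<Lambda>)"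
    and "r \<equiv> norm (Y - Yo X \<Lambda>) + \<kappa> * (norm (X' - rep (row_avg X)) + norm (perp X) + sqrt m * norm (\<Lambda>' - \<Lambda>))"
  shows "row_avg X' \<in> edom g"
    and "potential (row_avg X') \<Lambda>' \<le> potential (row_avg X) \<Lambda> + n1 * (E + L * p + L * r + v) + L / 2 * n1\<^sup>2
      + L * l * r - l\<^sup>2 / \<eta>' - (n1\<^sup>2 + n2\<^sup>2) / (2 * \<eta>) + p\<^sup>2 / (2 * \<eta>)"
proof -
  let ?x = "row_avg X" and ?x' = "row_avg X'"
  define dx :: "real ^ 'a ^ 'm" where "dx = rep (?x' - ?x)"
  have dx: "norm dx \<le> n1" unfolding dx_def n1_def by (rule norm_rep_avg_le)
  have dx': "rep ?x' - rep ?x = dx" by (simp add: dx_def linear_diff[OF linear_rep])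
  have gdom: "edom g \<noteq> {}" using xdom by auto
  have X'dom: "X' $ i \<in> edom g" for i
    by (simp add: X'_def prox_rows_def prox_in_edom[OF g_cc gdom \<eta>])
  note jensen = closed_convex_fun_jensen[OF g_cc, of UNIV "\<lambda>i. X' $ i", OF _ _ X'dom]
  show xd': "?x' \<in> edom g" unfolding row_avg_def using jensen(1) by simp
  define Z where "Z = Yo (rep ?x') \<Lambda>'"
  \<comment> \<open>The distance from the competitor to \<open>Y\<close> splits at the maximizer for
    the unaveraged \<open>X\<close>: its present distance from \<open>Y\<close>, plus its drift to
    the new average.\<close>
  have r: "norm (Z - Y) \<le> r"
  proof -
    have "norm (rep ?x' - X) = norm (dx - perp X)" by (simp add: dx'[symmetric] perp_def)
    also have "\<dots> \<le> n1 + p" using norm_triangle_ineq4[of dx "perp X"] dx by (simp add: p_def)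
    finally have a: "norm (rep ?x' - X) \<le> n1 + p" .
    have "norm (Z - Yo X \<Lambda>) \<le> \<kappa> * (norm (rep ?x' - X) + sqrt m * norm (\<Lambda>' - \<Lambda>))"
      unfolding Z_def by (rule Yopt_lipschitz)
    also have "\<dots> \<le> \<kappa> * (n1 + p + l)" using a kappa_ge1 by (intro mult_left_mono) (auto simp: l_def)
    finally have b: "norm (Z - Yo X \<Lambda>) \<le> \<kappa> * (n1 + p + l)" .
    have "norm (Z - Y) \<le> norm (Z - Yo X \<Lambda>) + norm (Y - Yo X \<Lambda>)" using norm_triangle_ineq4[of "Z - Yo X \<Lambda>" "Y - Yo X \<Lambda>"] by simp
    with b show ?thesis by (simp add: r_def n1_def p_def l_def)
  qed
  have "F (rep ?x') \<Lambda>' Z - F (rep ?x) \<Lambda> Z = (\<Sum>i\<in>UNIV. f i (?x', Z $ i) - f i (?x, Z $ i))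
      - (L * sqrt m / 2) * inner (\<Lambda>' - \<Lambda>) ((W - mat 1) ** Z)"
    by (simp add: F_def sum_subtractf inner_diff_left algebra_simps)
  moreover have "(\<Sum>i\<in>UNIV. f i (?x', Z $ i) - f i (?x, Z $ i)) \<le> inner dx (gradx (rep ?x) Z) + L / 2 * n1\<^sup>2"
  proof -
    have "(\<Sum>i\<in>UNIV. f i (?x', Z $ i) - f i (?x, Z $ i))
      \<le> (\<Sum>i\<in>UNIV. inner (dx $ i) (gradx (rep ?x) Z $ i) + L / 2 * (norm (dx $ i))\<^sup>2)"
    proof (rule sum_mono)
      fix i
      show "f i (?x', Z $ i) - f i (?x, Z $ i) \<le> inner (dx $ i) (gradx (rep ?x) Z $ i) + L / 2 * (norm (dx $ i))\<^sup>2"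
        using smooth_bounds[OF f_smooth[of i], of "(?x', Z $ i)" "(?x, Z $ i)"] unfolding abs_le_iff
        by (simp add: norm_Pair inner_prod_def dx_def gradx_def)
    qed
    also have "\<dots> = inner dx (gradx (rep ?x) Z) + L / 2 * (norm dx)\<^sup>2"
      by (simp add: norm_sq_rows sum.distrib sum_distrib_left inner_vec_def[where 'b='m])
    also have "\<dots> \<le> inner dx (gradx (rep ?x) Z) + L / 2 * n1\<^sup>2"
      using dx L_pos by (intro add_left_mono mult_left_mono power_mono) auto
    finally show ?thesis .
  qed
  \<comment> \<open>The multiplier step is a positive multiple of \<open>(W - mat 1) ** Y\<close>,
    so against \<open>Y\<close> the bilinear term is an exact square with the right sign. Replacing
    \<open>Z\<close> by \<open>Y\<close> costs \<open>L * l * r\<close>.\<close>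
  moreover have "- (L * sqrt m / 2) * inner (\<Lambda>' - \<Lambda>) ((W - mat 1) ** Z) \<le> - (l\<^sup>2 / \<eta>') + L * l * r"
  proof -
    have "(W - mat 1) ** Y = (2 * sqrt m / (L * \<eta>')) *\<^sub>R (\<Lambda>' - \<Lambda>)"
      using L_pos \<eta>' m_pos by (simp add: \<Lambda>'_def)
    then have 1: "(L * sqrt m / 2) * inner (\<Lambda>' - \<Lambda>) ((W - mat 1) ** Y) = l\<^sup>2 / \<eta>'"
      using L_pos m_pos \<eta>' by (simp add: l_def power_mult_distrib power2_norm_eq_inner)
    have "- inner (\<Lambda>' - \<Lambda>) ((W - mat 1) ** (Z - Y)) \<le> norm (\<Lambda>' - \<Lambda>) * norm ((W - mat 1) ** (Z - Y))"
      using Cauchy_Schwarz_ineq2 by (metis abs_le_D2)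
    also have "\<dots> \<le> norm (\<Lambda>' - \<Lambda>) * (2 * norm (Z - Y))" by (intro mult_left_mono norm_W_minus_1) auto
    also have "\<dots> \<le> norm (\<Lambda>' - \<Lambda>) * (2 * r)" using r by (intro mult_left_mono) auto
    finally have "(L * sqrt m / 2) * (- inner (\<Lambda>' - \<Lambda>) ((W - mat 1) ** (Z - Y)))
       \<le> (L * sqrt m / 2) * (norm (\<Lambda>' - \<Lambda>) * (2 * r))"
      using L_pos m_pos by (intro mult_left_mono) auto
    moreover have "inner (\<Lambda>' - \<Lambda>) ((W - mat 1) ** (Z - Y)) = inner (\<Lambda>' - \<Lambda>) ((W - mat 1) ** Z) - inner (\<Lambda>' - \<Lambda>) ((W - mat 1) ** Y)"
      by (simp add: matrix_mult_diff_right inner_diff_right)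
    moreover have "(L * sqrt m / 2) * (norm (\<Lambda>' - \<Lambda>) * (2 * r)) = L * l * r" by (simp add: l_def)
    ultimately show ?thesis using 1 by (simp only: right_diff_distrib minus_diff_eq mult_minus_left)
  qed
  \<comment> \<open>The old average is the competitor in every row. Mixing leaves the rows within
    \<open>p\<close> of it in total, and convexity turns the row values of \<open>g\<close> into the
    value at the new average.\<close>
  moreover have "m * real_of_ereal (g ?x') + inner (X' - rep ?x) V + (n2\<^sup>2 + n1\<^sup>2 - p\<^sup>2) / (2 * \<eta>) \<le> m * real_of_ereal (g ?x)"
  proof -
    have "real_of_ereal (g (X' $ i)) + inner (X' $ i - ?x) (V $ i)
        + ((norm (X' $ i - (W ** X) $ i))\<^sup>2 + (norm (?x - X' $ i))\<^sup>2 - (norm (?x - (W ** X) $ i))\<^sup>2) / (2 * \<eta>)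
       \<le> real_of_ereal (g ?x)" for i
      using prox_step[OF g_cc \<eta> xdom, of "(W ** X) $ i" "- V $ i"] by (simp add: X'_def prox_rows_def)
    then have "(\<Sum>i\<in>UNIV. real_of_ereal (g (X' $ i)) + inner ((X' - rep ?x) $ i) (V $ i)
        + ((norm ((X' - W ** X) $ i))\<^sup>2 + (norm ((X' - rep ?x) $ i))\<^sup>2 - (norm ((W ** X - rep ?x) $ i))\<^sup>2) / (2 * \<eta>))
       \<le> (\<Sum>i\<in>(UNIV::'m set). real_of_ereal (g ?x))"
      by (intro sum_mono) (simp add: norm_minus_commute)
    then have s: "(\<Sum>i\<in>UNIV. real_of_ereal (g (X' $ i))) + inner (X' - rep ?x) V
        + (n2\<^sup>2 + n1\<^sup>2 - (norm (W ** X - rep ?x))\<^sup>2) / (2 * \<eta>) \<le> m * real_of_ereal (g ?x)"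
      by (simp add: n1_def n2_def norm_sq_rows sum.distrib sum_subtractf sum_divide_distrib[symmetric] inner_vec_def[where 'b='m] m_card)
    have "norm (W ** X - rep ?x) = norm (perp (W ** X))" by (simp add: perp_def)
    also have "\<dots> \<le> \<rho> * p" unfolding p_def by (rule perp_W)
    also have "\<dots> \<le> p" using rho1 rho0 by (simp add: p_def mult_left_le_one_le)
    finally have "(n2\<^sup>2 + n1\<^sup>2 - p\<^sup>2) / (2 * \<eta>) \<le> (n2\<^sup>2 + n1\<^sup>2 - (norm (W ** X - rep ?x))\<^sup>2) / (2 * \<eta>)"
      using \<eta> by (intro divide_right_mono diff_left_mono power_mono) auto
    moreover have "m * real_of_ereal (g ?x') \<le> (\<Sum>i\<in>UNIV. real_of_ereal (g (X' $ i)))"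
      using jensen(2) m_pos unfolding row_avg_def by (simp add: m_card field_simps)
    ultimately show ?thesis using s by linarith
  qed
  \<comment> \<open>As the average of \<open>V\<close> is that of the estimator, the direction
    \<open>V\<close> differs from it only by \<open>perp V\<close> and by the error of
    \<open>Dx\<close> as a gradient at the competitor \<open>Z\<close>.\<close>
  moreover have "inner dx (gradx (rep ?x) Z) - inner (X' - rep ?x) V \<le> n1 * (E + L * p + L * r + v)"
  proof -
    have "inner (X' - rep ?x) V = inner (X' - rep ?x) (perp V) + inner (X' - rep ?x) (rep (row_avg V))"
      by (simp add: perp_def inner_add_right[symmetric])
    also have "inner (X' - rep ?x) (rep (row_avg V)) = inner dx Dx"
      by (simp add: inner_rep V dx_def linear_diff[OF linear_row_avg] inner_commute[of "rep _" Dx])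
        (simp add: inner_commute)
    finally have "inner dx (gradx (rep ?x) Z) - inner (X' - rep ?x) V
       = inner dx (gradx (rep ?x) Z - Dx) - inner (X' - rep ?x) (perp V)" by (simp add: inner_diff_right)
    also have "\<dots> \<le> norm dx * norm (gradx (rep ?x) Z - Dx) + norm (X' - rep ?x) * norm (perp V)"
      using norm_cauchy_schwarz[of dx "gradx (rep ?x) Z - Dx"] Cauchy_Schwarz_ineq2[of "X' - rep ?x" "perp V"] by linarith
    also have "\<dots> \<le> n1 * (E + L * (p + r)) + n1 * v"
    proof (intro add_mono mult_mono dx)
      have "norm (gradx (rep ?x) Z - Dx) \<le> norm (gradx (rep ?x) Z - gradx X Y) + norm (Dx - gradx X Y)"
        using norm_triangle_ineq4[of "gradx (rep ?x) Z - gradx X Y" "Dx - gradx X Y"] by simp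
      also have "\<dots> \<le> L * (norm (rep ?x - X) + norm (Z - Y)) + E" by (intro add_mono norm_gradx_diff_le E)
      also have "\<dots> \<le> L * (p + r) + E"
        using r L_pos by (intro add_mono mult_left_mono) (auto simp: p_def perp_def norm_minus_commute)
      finally show "norm (gradx (rep ?x) Z - Dx) \<le> E + L * (p + r)" by simp
    qed (auto simp: n1_def v_def)
    finally show ?thesis by (simp add: algebra_simps)
  qed
  moreover have "F (rep ?x) \<Lambda> Z \<le> F (rep ?x) \<Lambda> (Yo (rep ?x) \<Lambda>)"
    unfolding Z_def by (rule Yopt_le[OF Yopt_ydom])
  moreover have "(n2\<^sup>2 + n1\<^sup>2 - p\<^sup>2) / (2 * \<eta>) = (n1\<^sup>2 + n2\<^sup>2) / (2 * \<eta>) - p\<^sup>2 / (2 * \<eta>)"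
    by (simp add: add_divide_distrib diff_divide_distrib)
  ultimately show "potential ?x' \<Lambda>' \<le> potential ?x \<Lambda> + n1 * (E + L * p + L * r + v) + L / 2 * n1\<^sup>2
      + L * l * r - l\<^sup>2 / \<eta>' - (n1\<^sup>2 + n2\<^sup>2) / (2 * \<eta>) + p\<^sup>2 / (2 * \<eta>)"
    unfolding potential_def Z_def[symmetric] by linarith
qed

text \<open>The comparison point is the proximal point of the average. It is a matrix with equal
  rows, so \<open>perp\<close> is no larger than the distance to it, and nonexpansiveness applies in
  every row.\<close>

lemma consensus_step:
  fixes X V :: "real ^ 'a ^ 'm"
  assumes \<eta>: "\<eta> > 0" and gdom: "edom g \<noteq> {}"
  defines "X' \<equiv> prox_rows (\<lambda>v. ereal \<eta> * g v) (W ** X - \<eta> *\<^sub>R V)"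
  shows "norm (perp X') \<le> \<rho> * norm (perp X) + \<eta> * norm (perp V)"
proof -
  let ?Z = "W ** X - \<eta> *\<^sub>R V"
  have "norm (perp X') \<le> norm (X' - rep (prox (\<lambda>v. ereal \<eta> * g v) (row_avg ?Z)))"
    by (rule norm_perp_le)
  also have "\<dots> \<le> norm (perp ?Z)"
  proof (rule power2_le_imp_le)
    show "(norm (X' - rep (prox (\<lambda>v. ereal \<eta> * g v) (row_avg ?Z))))\<^sup>2 \<le> (norm (perp ?Z))\<^sup>2"
      unfolding norm_sq_rows
    proof (intro sum_mono power_mono)
      fix i
      have "(X' - rep (prox (\<lambda>v. ereal \<eta> * g v) (row_avg ?Z))) $ i
          = prox (\<lambda>v. ereal \<eta> * g v) (?Z $ i) - prox (\<lambda>v. ereal \<eta> * g v) (row_avg ?Z)"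
        by (simp only: X'_def prox_rows_def vec_lambda_beta vector_minus_component rep_nth)
      moreover have "perp ?Z $ i = ?Z $ i - row_avg ?Z" by (simp only: perp_def vector_minus_component rep_nth)
      ultimately show "norm ((X' - rep (prox (\<lambda>v. ereal \<eta> * g v) (row_avg ?Z))) $ i) \<le> norm (perp ?Z $ i)"
        by (simp only: prox_nonexpansive[OF g_cc gdom \<eta>])
    qed simp
  qed simp
  also have "perp ?Z = perp (W ** X) - \<eta> *\<^sub>R perp V"
    by (simp add: linear_diff[OF linear_perp] linear_scale[OF linear_perp])
  also have "norm \<dots> \<le> \<rho> * norm (perp X) + \<eta> * norm (perp V)"
    using norm_triangle_ineq4[of "perp (W ** X)" "\<eta> *\<^sub>R perp V"] perp_W[of X] \<eta> by simp
  finally show ?thesis .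
qed

end

subsection \<open>Sums along a run\<close>

text \<open>A single sample path. The estimator \<open>d\<close> is arbitrary, so everything derived
  here is deterministic and the sampling law can enter later through \<open>E\<close> alone.\<close>

locale vrlm_run = minimax W \<rho> m L \<mu> \<kappa> f g h
  for W :: "real ^ 'm ^ 'm" and \<rho> m L \<mu> \<kappa> :: real
    and f :: "'m \<Rightarrow> (real ^ 'a) \<times> (real ^ 'b) \<Rightarrow> real"
    and g :: "real ^ 'a \<Rightarrow> ereal" and h :: "real ^ 'b \<Rightarrow> ereal" +
  fixes \<eta> \<eta>' LP \<phi>s :: real
    and X V :: "nat \<Rightarrow> real ^ 'a ^ 'm" and \<Lambda> Y :: "nat \<Rightarrow> real ^ 'b ^ 'm"
    and d :: "nat \<Rightarrow> 'm \<Rightarrow> (real ^ 'a) \<times> (real ^ 'b)" and x0 :: "real ^ 'a" and y0 :: "real ^ 'b"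
  assumes eta: "\<eta> > 0" and eta': "\<eta>' > 0" and LP: "LP > 0"
    and x0: "x0 \<in> edom g" and y0: "y0 \<in> edom h"
    and X_0: "X 0 = rep x0" and Y_0: "Y 0 = rep y0" and V_0: "V 0 = (\<chi> i. fst (d 0 i))"
    and V_Suc: "\<And>t. V (Suc t) = W ** (V t + (\<chi> i. fst (d (Suc t) i)) - (\<chi> i. fst (d t i)))"
    and X_Suc: "\<And>t. X (Suc t) = prox_rows (\<lambda>v. ereal \<eta> * g v) (W ** X t - \<eta> *\<^sub>R V t)"
    and L_Suc: "\<And>t. \<Lambda> (Suc t) = \<Lambda> t + (L * \<eta>' / (2 * sqrt m)) *\<^sub>R ((W - mat 1) ** Y t)"
    and Y_Suc: "\<And>t. Y (Suc t) = dualstep (\<Lambda> t) (Y t) (\<chi> i. snd (d t i))"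
    and lower: "\<And>x \<Lambda>'. ereal \<phi>s \<le> phi L W f g h x \<Lambda>'"
begin

definition n1 where "n1 t = norm (X (Suc t) - rep (row_avg (X t)))"
definition n2 where "n2 t = norm (X (Suc t) - W ** X t)"
definition p where "p t = norm (perp (X t))"
definition v where "v t = norm (perp (V t))"
text \<open>Weighted as multiplier steps are in \<open>F_cross_difference\<close>.\<close>

definition l where "l t = sqrt m * norm (\<Lambda> (Suc t) - \<Lambda> t)"
definition D where "D t = norm (Y t - Yo (X t) (\<Lambda> t))"
definition E where "E t = norm (\<chi> i. d t i - grad (f i) (X t $ i, Y t $ i))"
definition b where "b t = norm (Y (Suc t) - Y t)"
definition x where "x t = norm (X (Suc t) - X t)"
definition gap where "gap t = F (X t) (\<Lambda> t) (Yo (X t) (\<Lambda> t)) - F (X t) (\<Lambda> t) (Y t)"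

lemmas seq_defs = n1_def n2_def p_def v_def l_def D_def E_def b_def x_def

lemma seq_nonneg: "0 \<le> n1 t" "0 \<le> n2 t" "0 \<le> p t" "0 \<le> v t" "0 \<le> l t" "0 \<le> D t" "0 \<le> E t" "0 \<le> b t" "0 \<le> x t"
  using m_pos by (simp_all add: seq_defs)

lemma err_x: "norm ((\<chi> i. fst (d t i)) - gradx (X t) (Y t)) \<le> E t"
  unfolding E_def
proof (rule power2_le_imp_le)
  show "(norm ((\<chi> i. fst (d t i)) - gradx (X t) (Y t)))\<^sup>2 \<le> (norm (\<chi> i. d t i - grad (f i) (X t $ i, Y t $ i)))\<^sup>2"
    by (subst norm_sq_rows, subst norm_sq_vec[where 'v = "(real ^ 'a) \<times> (real ^ 'b)"])
      (auto simp: gradx_def fst_diff[symmetric] norm_fst_snd_le intro!: sum_mono power_mono simp del: fst_diff)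
qed simp

lemma err_y: "norm ((\<chi> i. snd (d t i)) - grady (X t) (Y t)) \<le> E t"
  unfolding E_def
proof (rule power2_le_imp_le)
  show "(norm ((\<chi> i. snd (d t i)) - grady (X t) (Y t)))\<^sup>2 \<le> (norm (\<chi> i. d t i - grad (f i) (X t $ i, Y t $ i)))\<^sup>2"
    by (subst norm_sq_rows, subst norm_sq_vec[where 'v = "(real ^ 'a) \<times> (real ^ 'b)"])
      (auto simp: grady_def snd_diff[symmetric] norm_fst_snd_le intro!: sum_mono power_mono simp del: snd_diff)
qed simp

lemma ydom_run: "ydom (Y t)"
proof (cases t)
  case 0 then show ?thesis using y0 by (simp add: Y_0 ydom_def)
next
  case (Suc s) then show ?thesis unfolding Suc Y_Suc dualstep_def by (intro ydom_prox) (use L_pos in simp)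
qed

lemma gdom: "edom g \<noteq> {}" using x0 by auto

text \<open>Invariant of gradient tracking: \<open>W\<close> preserves averages, so the increments
  of the estimator telescope.\<close>

lemma avg_V: "row_avg (V t) = row_avg (\<chi> i. fst (d t i))"
  by (induction t) (simp_all add: V_0 V_Suc linear_diff[OF linear_row_avg] linear_add[OF linear_row_avg])

lemma avg_X_dom: "row_avg (X t) \<in> edom g"
proof (induction t)
  case 0 then show ?case using x0 by (simp add: X_0)
next
  case (Suc t)
  then show ?case unfolding X_Suc by (rule primal_step(1)[OF eta eta' err_x avg_V])
qed

lemma potential_step:
  "potential (row_avg (X (Suc t))) (\<Lambda> (Suc t)) \<le> potential (row_avg (X t)) (\<Lambda> t)
    + (L * (16 + 3 * \<kappa> + 26 * \<kappa>\<^sup>2) + 15 * LP - 1 / (2 * \<eta>)) * (n1 t)\<^sup>2 - (n2 t)\<^sup>2 / (2 * \<eta>)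
    + (L * (26 * \<kappa>\<^sup>2 + 3 * \<kappa>) - 1 / \<eta>') * (l t)\<^sup>2
    + (E t)\<^sup>2 / (60 * L) + (v t)\<^sup>2 / (60 * LP) + L / (52 * \<kappa>\<^sup>2) * (D t)\<^sup>2
    + (1 / (2 * \<eta>) + L / 2 * (1 + \<kappa>)) * (p t)\<^sup>2"
proof -
  have "potential (row_avg (X (Suc t))) (\<Lambda> (Suc t)) \<le> potential (row_avg (X t)) (\<Lambda> t)
    + n1 t * (E t + L * p t + L * (D t + \<kappa> * (n1 t + p t + l t)) + v t) + L / 2 * (n1 t)\<^sup>2
      + L * l t * (D t + \<kappa> * (n1 t + p t + l t)) - (l t)\<^sup>2 / \<eta>' - ((n1 t)\<^sup>2 + (n2 t)\<^sup>2) / (2 * \<eta>) + (p t)\<^sup>2 / (2 * \<eta>)"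
    using primal_step(2)[OF eta eta' err_x avg_V avg_X_dom, of t "\<Lambda> t"] unfolding seq_defs X_Suc L_Suc .
  then show ?thesis
    using primal_young[OF L_pos LP kappa_ge1, of "n1 t" "E t" "p t" "D t" "l t" "v t"]
    by (simp add: algebra_simps add_divide_distrib diff_divide_distrib)
qed

lemma xl_sq: "(x t + l t)\<^sup>2 \<le> 2 * (x t)\<^sup>2 + 2 * (l t)\<^sup>2"
  using sum_squares_bound[of "x t" "l t"] by (simp add: power2_sum)

text \<open>The triangle inequality is squared with Young weight \<open>1 / (8 * \<kappa>)\<close>,
  precisely the spare factor on the left of \<open>dual_contraction\<close>; the drift then carries
  the complementary weight \<open>1 + 8 * \<kappa>\<close>.\<close>

lemma D_step:
  "(D (Suc t))\<^sup>2 \<le> (1 - 1 / (4 * \<kappa>)) * (D t)\<^sup>2 + \<kappa> / (2 * L\<^sup>2) * (E t)\<^sup>2 + (1 + 8 * \<kappa>) * \<kappa>\<^sup>2 * (2 * (x t)\<^sup>2 + 2 * (l t)\<^sup>2)"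
proof -
  define d' where "d' = norm (Y (Suc t) - Yo (X t) (\<Lambda> t))"
  define w where "w = \<kappa> * (x t + l t)"
  have c: "(1 + 1 / (8 * \<kappa>)) * d'\<^sup>2 \<le> (1 - 1 / (4 * \<kappa>)) * (D t)\<^sup>2 + \<kappa> / (2 * L\<^sup>2) * (E t)\<^sup>2"
    using dual_contraction[OF err_y[of t], where \<Lambda> = "\<Lambda> t"] unfolding d'_def Y_Suc D_def
    by (smt (verit) zero_le_power2 divide_nonneg_nonneg mult_nonneg_nonneg)
  have "norm (Yo (X (Suc t)) (\<Lambda> (Suc t)) - Yo (X t) (\<Lambda> t)) \<le> w"
    unfolding w_def x_def l_def by (rule Yopt_lipschitz)
  then have "D (Suc t) \<le> d' + w"
    using norm_triangle_ineq4[of "Y (Suc t) - Yo (X t) (\<Lambda> t)" "Yo (X (Suc t)) (\<Lambda> (Suc t)) - Yo (X t) (\<Lambda> t)"]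
    by (simp add: D_def d'_def)
  then have "(D (Suc t))\<^sup>2 \<le> (d' + w)\<^sup>2" using seq_nonneg by (intro power_mono) auto
  also have "\<dots> \<le> (1 + 1 / (8 * \<kappa>)) * d'\<^sup>2 + (1 + 8 * \<kappa>) * w\<^sup>2"
  proof -
    have "2 * w * d' \<le> 8 * \<kappa> * w\<^sup>2 + d'\<^sup>2 / (8 * \<kappa>)"
      using young_le[of "4 * \<kappa>" w d'] kappa_ge1 by (simp add: field_simps)
    then show ?thesis by (simp add: power2_sum algebra_simps)
  qed
  also have "(1 + 8 * \<kappa>) * w\<^sup>2 \<le> (1 + 8 * \<kappa>) * (\<kappa>\<^sup>2 * (2 * (x t)\<^sup>2 + 2 * (l t)\<^sup>2))"
    unfolding w_def power_mult_distrib using kappa_ge1 by (intro mult_left_mono xl_sq) auto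
  finally show ?thesis using c by simp
qed

text \<open>Bound for the summed squared distances to the maximizer that no longer refers to the maximizers
  along the run, so that they need not be measurable.\<close>

definition SD where
  "SD T = 4 * \<kappa> * (D 0)\<^sup>2 + 2 * \<kappa>\<^sup>2 / L\<^sup>2 * sumsq E T + 4 * \<kappa> * (1 + 8 * \<kappa>) * \<kappa>\<^sup>2 * (2 * sumsq x T + 2 * sumsq l T)"

text \<open>The sum runs through index \<open>T\<close>, because the potential uses the distances at
  \<open>0\<close> to \<open>T - 1\<close> and the gap those at \<open>1\<close> to
  \<open>T\<close>. The contraction gap \<open>1 / (4 * \<kappa>)\<close> is the source of the
  factor \<open>4 * \<kappa>\<close>.\<close>

lemma run_D: "sumsq D (Suc T) \<le> SD T"
proof -
  let ?S = "sumsq D (Suc T)" and ?R = "(1 + 8 * \<kappa>) * \<kappa>\<^sup>2 * (2 * sumsq x T + 2 * sumsq l T)"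
  have "?S = (D 0)\<^sup>2 + (\<Sum>t<T. (D (Suc t))\<^sup>2)" by (rule sum.lessThan_Suc_shift)
  also have "\<dots> \<le> (D 0)\<^sup>2 + (\<Sum>t<T. (1 - 1 / (4 * \<kappa>)) * (D t)\<^sup>2 + \<kappa> / (2 * L\<^sup>2) * (E t)\<^sup>2 + (1 + 8 * \<kappa>) * \<kappa>\<^sup>2 * (2 * (x t)\<^sup>2 + 2 * (l t)\<^sup>2))"
    by (intro add_left_mono sum_mono D_step)
  also have "\<dots> = (D 0)\<^sup>2 + (1 - 1 / (4 * \<kappa>)) * sumsq D T + \<kappa> / (2 * L\<^sup>2) * sumsq E T + ?R"
    by (simp add: sum.distrib flip: sum_distrib_left sum_divide_distrib)
  also have "\<dots> \<le> (D 0)\<^sup>2 + (1 - 1 / (4 * \<kappa>)) * ?S + \<kappa> / (2 * L\<^sup>2) * sumsq E T + ?R"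
    using kappa_ge1 by (intro add_right_mono add_left_mono mult_left_mono) (auto simp: field_simps)
  finally have "?S / (4 * \<kappa>) \<le> (D 0)\<^sup>2 + \<kappa> / (2 * L\<^sup>2) * sumsq E T + ?R"
    by (simp only: left_diff_distrib) simp
  then have "?S \<le> ((D 0)\<^sup>2 + \<kappa> / (2 * L\<^sup>2) * sumsq E T + ?R) * (4 * \<kappa>)"
    using kappa_ge1 by (simp only: pos_divide_le_eq)
  also have "\<dots> = SD T"
    by (simp add: SD_def distrib_right distrib_left power2_eq_square mult_ac)
  finally show ?thesis .
qed

lemma run_potential:
  "(1 / (2 * \<eta>) - (L * (16 + 3 * \<kappa> + 26 * \<kappa>\<^sup>2) + 15 * LP)) * sumsq n1 T + sumsq n2 T / (2 * \<eta>)
        + (1 / \<eta>' - L * (26 * \<kappa>\<^sup>2 + 3 * \<kappa>)) * sumsq l T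
    \<le> (potential x0 (\<Lambda> 0) - m * \<phi>s) + sumsq E T / (60 * L) + sumsq v T / (60 * LP)
      + L / (52 * \<kappa>\<^sup>2) * SD T + (1 / (2 * \<eta>) + L / 2 * (1 + \<kappa>)) * sumsq p T"
proof -
  have tel: "potential (row_avg (X T)) (\<Lambda> T) \<le> potential x0 (\<Lambda> 0)
    + (L * (16 + 3 * \<kappa> + 26 * \<kappa>\<^sup>2) + 15 * LP - 1 / (2 * \<eta>)) * sumsq n1 T - sumsq n2 T / (2 * \<eta>)
    + (L * (26 * \<kappa>\<^sup>2 + 3 * \<kappa>) - 1 / \<eta>') * sumsq l T
    + sumsq E T / (60 * L) + sumsq v T / (60 * LP) + L / (52 * \<kappa>\<^sup>2) * sumsq D T
    + (1 / (2 * \<eta>) + L / 2 * (1 + \<kappa>)) * sumsq p T"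
  proof (induction T)
    case 0 then show ?case by (simp add: X_0)
  next
    case (Suc T)
    then show ?case using potential_step[of T]
      by (simp add: add_divide_distrib distrib_left)
  qed
  have "ereal \<phi>s \<le> ereal (potential (row_avg (X T)) (\<Lambda> T) / m)"
    using lower[of "row_avg (X T)" "\<Lambda> T"] phi_eq_F[OF avg_X_dom, of T "\<Lambda> T"] by (simp add: potential_def)
  then have "m * \<phi>s \<le> potential (row_avg (X T)) (\<Lambda> T)" using m_pos by (simp add: field_simps)
  moreover have "sumsq D T \<le> SD T" using run_D[of T] by (simp add: order_trans[rotated])
  then have "L / (52 * \<kappa>\<^sup>2) * sumsq D T \<le> L / (52 * \<kappa>\<^sup>2) * SD T"
    using L_pos by (intro mult_left_mono) auto
  ultimately show ?thesis using tel by (simp only: left_diff_distrib)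
qed

text \<open>Of the gain \<open>7 / 2 * L\<close>, the estimation error consumes
  \<open>L / 2\<close>. The weight on the distance is chosen so that, with the summed distance
  growing like \<open>\<kappa>\<^sup>4\<close> times the steps, both contributions of the drift end
  at order \<open>L * \<kappa>\<^sup>2\<close>.\<close>

lemma gap_step:
  "gap (Suc t) + 3 * L * (b t)\<^sup>2 \<le> gap t + (E t)\<^sup>2 / (2 * L) + L / (8 * \<kappa>\<^sup>2) * (D (Suc t))\<^sup>2 + 2 * L * \<kappa>\<^sup>2 * (2 * (x t)\<^sup>2 + 2 * (l t)\<^sup>2)"
proof -
  have 1: "F (X t) (\<Lambda> t) (Y t) + 7 / 2 * L * (b t)\<^sup>2 - E t * b t \<le> F (X t) (\<Lambda> t) (Y (Suc t))"
    using dual_ascent[OF err_y[of t] ydom_run, where \<Lambda> = "\<Lambda> t"] by (simp add: b_def Y_Suc)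
  have 2: "gap (Suc t) \<le> F (X t) (\<Lambda> t) (Yo (X t) (\<Lambda> t)) - F (X t) (\<Lambda> t) (Y (Suc t)) + L * (D (Suc t) * (x t + l t))"
    using gap_drift[of "X (Suc t)" "\<Lambda> (Suc t)" "Y (Suc t)" "X t" "\<Lambda> t"] by (simp add: gap_def seq_defs mult.assoc)
  have 3: "E t * b t \<le> L / 2 * (b t)\<^sup>2 + (E t)\<^sup>2 / (2 * L)"
    using young_le[of "L / 2" "b t" "E t"] L_pos by (simp add: mult.commute)
  have "D (Suc t) * (x t + l t) \<le> 2 * \<kappa>\<^sup>2 * (x t + l t)\<^sup>2 + (D (Suc t))\<^sup>2 / (8 * \<kappa>\<^sup>2)"
    using young_le[of "2 * \<kappa>\<^sup>2" "x t + l t" "D (Suc t)"] kappa_ge1 by (simp add: mult.commute)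
  then have "L * (D (Suc t) * (x t + l t)) \<le> L * (2 * \<kappa>\<^sup>2 * (x t + l t)\<^sup>2 + (D (Suc t))\<^sup>2 / (8 * \<kappa>\<^sup>2))"
    using L_pos by (intro mult_left_mono) auto
  also have "\<dots> = L / (8 * \<kappa>\<^sup>2) * (D (Suc t))\<^sup>2 + 2 * L * \<kappa>\<^sup>2 * (x t + l t)\<^sup>2" by (simp add: algebra_simps)
  finally have 4: "L * (D (Suc t) * (x t + l t)) \<le> L / (8 * \<kappa>\<^sup>2) * (D (Suc t))\<^sup>2 + 2 * L * \<kappa>\<^sup>2 * (x t + l t)\<^sup>2" .
  have "2 * L * \<kappa>\<^sup>2 * (x t + l t)\<^sup>2 \<le> 2 * L * \<kappa>\<^sup>2 * (2 * (x t)\<^sup>2 + 2 * (l t)\<^sup>2)"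
    using L_pos by (intro mult_left_mono xl_sq) auto
  then show ?thesis using 1 2 3 4 unfolding gap_def[of t] by argo
qed

lemma gap_nonneg: "gap t \<ge> 0"
  using Yopt_le[OF ydom_run] by (simp add: gap_def)

lemma run_gap:
  "3 * L * sumsq b T \<le> gap 0 + sumsq E T / (2 * L) + L / (8 * \<kappa>\<^sup>2) * SD T
     + 2 * L * \<kappa>\<^sup>2 * (2 * sumsq x T + 2 * sumsq l T)"
proof -
  have "gap T + 3 * L * sumsq b T \<le> gap 0 + sumsq E T / (2 * L) + L / (8 * \<kappa>\<^sup>2) * (\<Sum>t<T. (D (Suc t))\<^sup>2)
     + 2 * L * \<kappa>\<^sup>2 * (2 * sumsq x T + 2 * sumsq l T)"
  proof (induction T)
    case (Suc T)
    then show ?case using gap_step[of T] by (simp add: add_divide_distrib distrib_left)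
  qed simp
  moreover have "L / (8 * \<kappa>\<^sup>2) * (\<Sum>t<T. (D (Suc t))\<^sup>2) \<le> L / (8 * \<kappa>\<^sup>2) * SD T"
    using run_D[of T] L_pos unfolding sum.lessThan_Suc_shift by (intro mult_left_mono) (auto simp: order_trans[rotated])
  ultimately show ?thesis using gap_nonneg[of T] by linarith
qed

text \<open>All agents start at the same point, so the initial term of the contraction vanishes and
  only the driving term with its factor \<open>\<eta>\<^sup>2\<close> is left.\<close>

lemma run_p_v: "sumsq p T \<le> \<eta>\<^sup>2 * sumsq v T / (1 - \<rho>)\<^sup>2"
proof (cases T)
  case (Suc n)
  have "sumsq p (Suc n) \<le> (p 0)\<^sup>2 / (1 - \<rho>) + (\<Sum>t<n. (\<eta> * v t)\<^sup>2) / (1 - \<rho>)\<^sup>2"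
    using seq_nonneg eta rho0 rho1 consensus_step[OF eta gdom]
    by (intro contraction_sum_sq) (auto simp: p_def v_def X_Suc)
  also have "\<dots> \<le> \<eta>\<^sup>2 * sumsq v (Suc n) / (1 - \<rho>)\<^sup>2"
    by (simp add: p_def X_0 power_mult_distrib flip: sum_distrib_left)
      (intro divide_right_mono, simp_all add: distrib_left)
  finally show ?thesis using Suc by simp
qed simp

text \<open>The new consensus error is a distance to the nearest matrix with equal rows, hence at
  most the distance to the old average; the initial error is 0, so the shift of index loses
  nothing.\<close>

lemma run_p_n1: "sumsq p T \<le> sumsq n1 T"
proof (cases T)
  case (Suc n)
  have "sumsq p (Suc n) = (\<Sum>t<n. (p (Suc t))\<^sup>2)"
    unfolding sum.lessThan_Suc_shift by (simp add: p_def X_0)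
  also have "\<dots> \<le> sumsq n1 n"
    by (intro sum_mono power_mono) (auto simp: p_def n1_def norm_perp_le)
  also have "\<dots> \<le> sumsq n1 (Suc n)" by simp
  finally show ?thesis using Suc by simp
qed simp

text \<open>The tracking error is driven by increments of the estimator, each being two estimation
  errors and one change of the gradient. Every error occurs in at most two increments, whence
  \<open>6 = 3 + 3\<close>. The first \<open>T\<close> values depend on \<open>T - 1\<close>
  increments only, so no error beyond the sum appears.\<close>

lemma run_v:
  "sumsq v T \<le> (v 0)\<^sup>2 / (1 - \<rho>)
    + (6 * sumsq E T + 3 * L\<^sup>2 * (sumsq x T + sumsq b T)) / (1 - \<rho>)\<^sup>2"
proof (cases T)
  case 0 then show ?thesis using rho1 by simp
next
  case (Suc n)
  define c where "c t = norm ((\<chi> i. fst (d (Suc t) i)) - (\<chi> i. fst (d t i)))" for t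
  have "v (Suc t) \<le> \<rho> * v t + c t" for t
  proof -
    let ?\<Delta> = "(\<chi> i. fst (d (Suc t) i)) - (\<chi> i. fst (d t i))"
    have "v (Suc t) \<le> \<rho> * norm (perp (V t + ?\<Delta>))" unfolding v_def V_Suc add_diff_eq[symmetric] by (rule perp_W)
    also have "\<dots> \<le> \<rho> * (v t + c t)"
    proof (rule mult_left_mono[OF _ rho0])
      have "norm (perp (V t + ?\<Delta>)) \<le> norm (perp (V t)) + norm (perp ?\<Delta>)"
        unfolding linear_add[OF linear_perp] by (rule norm_triangle_ineq)
      then show "norm (perp (V t + ?\<Delta>)) \<le> v t + c t" using norm_perp_le_self[of ?\<Delta>] by (simp add: v_def c_def)
    qed
    also have "\<dots> \<le> \<rho> * v t + c t" using rho1 by (simp add: distrib_left c_def mult_left_le_one_le rho0)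
    finally show ?thesis .
  qed
  then have "sumsq v (Suc n) \<le> (v 0)\<^sup>2 / (1 - \<rho>) + sumsq c n / (1 - \<rho>)\<^sup>2"
    using seq_nonneg rho0 rho1 by (intro contraction_sum_sq) (auto simp: c_def)
  moreover have "sumsq c n \<le> 6 * sumsq E (Suc n) + 3 * L\<^sup>2 * (sumsq x (Suc n) + sumsq b (Suc n))"
  proof -
    have c: "(c t)\<^sup>2 \<le> 3 * ((E (Suc t))\<^sup>2 + (E t)\<^sup>2 + L\<^sup>2 * ((x t)\<^sup>2 + (b t)\<^sup>2))" for t
    proof -
      let ?a = "norm ((\<chi> i. fst (d (Suc t) i)) - gradx (X (Suc t)) (Y (Suc t)))"
      let ?b = "norm ((\<chi> i. fst (d t i)) - gradx (X t) (Y t))"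
      let ?c = "norm (gradx (X (Suc t)) (Y (Suc t)) - gradx (X t) (Y t))"
      have eq: "(\<chi> i. fst (d (Suc t) i)) - (\<chi> i. fst (d t i)) = ((\<chi> i. fst (d (Suc t) i)) - gradx (X (Suc t)) (Y (Suc t)))
         - ((\<chi> i. fst (d t i)) - gradx (X t) (Y t)) + (gradx (X (Suc t)) (Y (Suc t)) - gradx (X t) (Y t))" by simp
      have "c t \<le> ?a + ?b + ?c"
        unfolding c_def by (subst eq) (intro norm_triangle_mono norm_triangle_ineq4 order_refl)
      then have "(c t)\<^sup>2 \<le> (?a + ?b + ?c)\<^sup>2" by (intro power_mono) (auto simp: c_def)
      also have "\<dots> \<le> 3 * (?a\<^sup>2 + ?b\<^sup>2 + ?c\<^sup>2)" by (rule sq_sum3)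
      also have "\<dots> \<le> 3 * ((E (Suc t))\<^sup>2 + (E t)\<^sup>2 + L\<^sup>2 * ((x t)\<^sup>2 + (b t)\<^sup>2))"
        unfolding x_def b_def by (intro mult_left_mono add_mono power_mono err_x norm_gradx_diff_sq_le) auto
      finally show ?thesis .
    qed
    have "sumsq c n \<le> (\<Sum>t<n. 3 * ((E (Suc t))\<^sup>2 + (E t)\<^sup>2 + L\<^sup>2 * ((x t)\<^sup>2 + (b t)\<^sup>2)))"
      by (intro sum_mono c)
    also have "\<dots> = 3 * (\<Sum>t<n. (E (Suc t))\<^sup>2) + 3 * sumsq E n + 3 * L\<^sup>2 * (sumsq x n + sumsq b n)"
      by (simp add: sum.distrib distrib_left sum_distrib_left mult.assoc)
    also have "\<dots> \<le> 3 * sumsq E (Suc n) + 3 * sumsq E (Suc n) + 3 * L\<^sup>2 * (sumsq x (Suc n) + sumsq b (Suc n))"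
    proof (intro add_mono mult_left_mono)
      show "(\<Sum>t<n. (E (Suc t))\<^sup>2) \<le> sumsq E (Suc n)" unfolding sum.lessThan_Suc_shift by simp
    qed auto
    finally show ?thesis by simp
  qed
  ultimately show ?thesis
    unfolding Suc by (meson add_left_mono divide_right_mono order_trans zero_le_power2)
qed

lemma run_x: "sumsq x T \<le> 2 * sumsq n1 T + 2 * sumsq p T"
proof -
  have "(x t)\<^sup>2 \<le> 2 * (n1 t)\<^sup>2 + 2 * (p t)\<^sup>2" for t
  proof -
    have "X (Suc t) - X t = (X (Suc t) - rep (row_avg (X t))) - perp (X t)" by (simp add: perp_def)
    then have "x t \<le> n1 t + p t" unfolding x_def n1_def p_def by (metis norm_triangle_ineq4)
    then have "(x t)\<^sup>2 \<le> (n1 t + p t)\<^sup>2" using seq_nonneg by (intro power_mono) auto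
    also have "\<dots> \<le> 2 * (n1 t)\<^sup>2 + 2 * (p t)\<^sup>2" using sum_squares_bound[of "n1 t" "p t"] by (simp add: power2_sum)
    finally show ?thesis .
  qed
  then have "sumsq x T \<le> (\<Sum>t<T. 2 * (n1 t)\<^sup>2 + 2 * (p t)\<^sup>2)" by (intro sum_mono)
  then show ?thesis by (simp add: sum.distrib sum_distrib_left)
qed

end

subsection \<open>The error of the SPIDER estimator\<close>

text \<open>An amortization argument. The excess of \<open>r\<close> over \<open>U\<close> is
  prepaid for the iterations left before the next restart, whose number
  \<open>q - 1 - n mod q\<close> is the weight in \<open>pot\<close>. A fresh increment is thus
  charged at most \<open>q\<close> times, which cancels its division by \<open>q\<close>.\<close>

lemma spider_sum:
  fixes r \<delta> :: "nat \<Rightarrow> real" and q :: nat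
  assumes q: "q \<ge> 1" and \<delta>: "\<And>t. 0 \<le> \<delta> t"
    and restart: "\<And>t. t mod q = 0 \<Longrightarrow> r t \<le> U"
    and step: "\<And>t. Suc t mod q \<noteq> 0 \<Longrightarrow> r (Suc t) \<le> r t + \<delta> t / real q"
  shows "(\<Sum>t<T. r t) \<le> real T * U + (\<Sum>t<T. \<delta> t)"
proof -
  define w where "w t = max 0 (r t - U)" for t
  have pot: "(\<Sum>t<Suc n. w t) + (real q - 1 - real (n mod q)) * w n \<le> (\<Sum>t<n. \<delta> t)" for n
  proof (induction n)
    case 0 then show ?case using restart[of 0] by (simp add: w_def)
  next
    case (Suc n)
    show ?case
    proof (cases "Suc n mod q = 0")
      case True
      then have "w (Suc n) = 0" using restart[of "Suc n"] by (simp add: w_def)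
      moreover have "0 \<le> (real q - 1 - real (n mod q)) * w n"
      proof (rule mult_nonneg_nonneg)
        have "n mod q < q" using q by simp
        then show "0 \<le> real q - 1 - real (n mod q)" by linarith
      qed (simp add: w_def)
      ultimately show ?thesis using Suc \<delta>[of n] by simp
    next
      case False
      then have md: "Suc n mod q = Suc (n mod q)" by (metis mod_Suc)
      then have lt: "Suc (n mod q) < q" using q by (metis mod_less_divisor le_zero_eq not_one_le_zero not_gr_zero)
      have w: "w (Suc n) \<le> w n + \<delta> n / real q"
        using step[OF False] \<delta>[of n] q by (auto simp: w_def max_def)
      have "(real q - 1 - real (n mod q)) * w (Suc n) \<le> (real q - 1 - real (n mod q)) * (w n + \<delta> n / real q)"
        using lt w by (intro mult_left_mono) auto
      also have "\<dots> = (real q - 1 - real (n mod q)) * w n + (real q - 1 - real (n mod q)) / real q * \<delta> n"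
        by (simp only: distrib_left times_divide_eq_left times_divide_eq_right)
      also have "\<dots> \<le> (real q - 1 - real (n mod q)) * w n + 1 * \<delta> n"
        using q \<delta>[of n] by (intro add_left_mono mult_right_mono) auto
      finally have "(real q - 1 - real (n mod q)) * w (Suc n) \<le> (real q - 1 - real (n mod q)) * w n + \<delta> n" by simp
      moreover have "w (Suc n) + (real q - 1 - real (Suc n mod q)) * w (Suc n) = (real q - 1 - real (n mod q)) * w (Suc n)"
        by (simp add: md algebra_simps)
      ultimately show ?thesis using Suc by simp
    qed
  qed
  have "(\<Sum>t<T. w t) \<le> (\<Sum>t<T. \<delta> t)"
  proof (cases T)
    case (Suc n)
    have "n mod q < q" using q by simp
    then have "0 \<le> real q - 1 - real (n mod q)" by linarith
    then have "0 \<le> (real q - 1 - real (n mod q)) * w n" by (intro mult_nonneg_nonneg) (simp_all add: w_def)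
    then show ?thesis using pot[of n] \<delta>[of n] Suc by simp
  qed simp
  moreover have "(\<Sum>t<T. r t) \<le> (\<Sum>t<T. U + w t)" by (intro sum_mono) (auto simp: w_def)
  ultimately show ?thesis by (simp add: sum.distrib)
qed

section \<open>Second moments under independence\<close>

abbreviation nsq :: "'w measure \<Rightarrow> ('w \<Rightarrow> 'v::real_normed_vector) \<Rightarrow> ennreal" where
  "nsq M Z \<equiv> \<integral>\<^sup>+ \<omega>. ennreal ((norm (Z \<omega>))\<^sup>2) \<partial>M"

text \<open>Expand the square and integrate the linear term; an infinite second moment is trivial in
  \<open>ennreal\<close>. The \<open>max\<close> guards against a negative constant part. Two cases
  matter: \<open>c = 0\<close> makes noise orthogonal to a known vector, and \<open>a = - c\<close>
  bounds the variance by the second moment.\<close>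

lemma second_moment_shift:
  fixes Z :: "'s \<Rightarrow> 'v::euclidean_space"
  assumes D: "prob_space D" and Z: "has_bochner_integral D Z c"
  shows "nsq D (\<lambda>s. a + Z s) \<le> ennreal (max 0 ((norm a)\<^sup>2 + 2 * inner a c)) + nsq D Z"
proof (cases "nsq D Z = \<infinity>")
  case False
  interpret D: prob_space D by fact
  have Zi: "integrable D Z" and Zc: "integral\<^sup>L D Z = c"
    using Z by (auto simp: has_bochner_integral_iff)
  have [measurable]: "Z \<in> borel_measurable D" using Zi by auto
  have sq: "integrable D (\<lambda>s. (norm (Z s))\<^sup>2)"
    using False by (intro integrableI_nonneg) (auto simp: top.not_eq_extremum)
  have ii: "integrable D (\<lambda>s. inner a (Z s))" "integral\<^sup>L D (\<lambda>s. inner a (Z s)) = inner a c"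
    using Zi Zc by (auto simp: integral_inner_right)
  have eq: "(norm (a + Z s))\<^sup>2 = (norm a)\<^sup>2 + 2 * inner a (Z s) + (norm (Z s))\<^sup>2" for s
    by (simp add: power2_norm_eq_inner inner_add_left inner_add_right inner_commute)
  have "nsq D (\<lambda>s. a + Z s) = ennreal (\<integral>s. (norm (a + Z s))\<^sup>2 \<partial>D)"
    by (rule nn_integral_eq_integral) (use sq ii in \<open>simp add: eq\<close>, simp)
  also have "(\<integral>s. (norm (a + Z s))\<^sup>2 \<partial>D) \<le> max 0 ((norm a)\<^sup>2 + 2 * inner a c) + (\<integral>s. (norm (Z s))\<^sup>2 \<partial>D)"
    using sq ii by (simp add: eq D.prob_space)
  also have "ennreal \<dots> = ennreal (max 0 ((norm a)\<^sup>2 + 2 * inner a c)) + ennreal (\<integral>s. (norm (Z s))\<^sup>2 \<partial>D)"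
    by (intro ennreal_plus) auto
  also have "ennreal (\<integral>s. (norm (Z s))\<^sup>2 \<partial>D) = nsq D Z"
    by (rule nn_integral_eq_integral[symmetric]) (use sq in auto)
  finally show ?thesis by (simp add: ennreal_leI)
qed simp

lemma centered_second_moment:
  fixes Z :: "'s \<Rightarrow> 'v::euclidean_space"
  assumes "prob_space D" "has_bochner_integral D Z c"
  shows "nsq D (\<lambda>s. Z s - c) \<le> nsq D Z"
proof -
  have "max 0 ((norm (- c))\<^sup>2 + 2 * inner (- c) c) = 0" by (simp add: power2_norm_eq_inner)
  then show ?thesis using second_moment_shift[OF assms, of "- c"] by simp
qed

text \<open>Turns independence of event systems into a product law, the form in which Fubini can use
  it; agreement on rectangles determines the law.\<close>

lemma (in prob_space) joint_distr_of_indep_set: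
  assumes ind: "indep_set A B" and U[measurable]: "U \<in> measurable M S" and \<xi>[measurable]: "\<xi> \<in> measurable M D"
    and A: "\<And>C. C \<in> sets S \<Longrightarrow> U -` C \<inter> space M \<in> A" and B: "\<And>C. C \<in> sets D \<Longrightarrow> \<xi> -` C \<inter> space M \<in> B"
  shows "distr M (S \<Otimes>\<^sub>M D) (\<lambda>\<omega>. (U \<omega>, \<xi> \<omega>)) = distr M S U \<Otimes>\<^sub>M distr M D \<xi>"
proof (rule pair_measure_eqI[symmetric])
  interpret S: prob_space "distr M S U" by (rule prob_space_distr) measurable
  interpret D: prob_space "distr M D \<xi>" by (rule prob_space_distr) measurable
  show "sigma_finite_measure (distr M S U)" "sigma_finite_measure (distr M D \<xi>)" by unfold_locales
  show "sets (distr M S U \<Otimes>\<^sub>M distr M D \<xi>) = sets (distr M (S \<Otimes>\<^sub>M D) (\<lambda>\<omega>. (U \<omega>, \<xi> \<omega>)))"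
    by (simp cong: sets_pair_measure_cong)
  fix C C' assume "C \<in> sets (distr M S U)" "C' \<in> sets (distr M D \<xi>)"
  then have C: "C \<in> sets S" "C' \<in> sets D" by auto
  have "(\<lambda>\<omega>. (U \<omega>, \<xi> \<omega>)) -` (C \<times> C') \<inter> space M = (U -` C \<inter> space M) \<inter> (\<xi> -` C' \<inter> space M)" by auto
  then have "emeasure (distr M (S \<Otimes>\<^sub>M D) (\<lambda>\<omega>. (U \<omega>, \<xi> \<omega>))) (C \<times> C') = emeasure M ((U -` C \<inter> space M) \<inter> (\<xi> -` C' \<inter> space M))"
    using C by (simp add: emeasure_distr)
  also have "\<dots> = emeasure M (U -` C \<inter> space M) * emeasure M (\<xi> -` C' \<inter> space M)"
    using indep_setD[OF ind A[OF C(1)] B[OF C(2)]] by (simp add: emeasure_eq_measure ennreal_mult')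
  finally show "emeasure (distr M S U) C * emeasure (distr M D \<xi>) C' = emeasure (distr M (S \<Otimes>\<^sub>M D) (\<lambda>\<omega>. (U \<omega>, \<xi> \<omega>))) (C \<times> C')"
    using C by (simp add: emeasure_distr)
qed

text \<open>Conditioning on \<open>U\<close> becomes an inner integral over \<open>D\<close> for
  fixed \<open>u\<close>. There the noise has mean 0, so the cross term vanishes and the second
  moments add.\<close>

lemma (in prob_space) independent_second_moment:
  fixes a :: "'u \<Rightarrow> 'v::euclidean_space" and G :: "'u \<Rightarrow> 's \<Rightarrow> 'v"
  assumes U[measurable]: "U \<in> measurable M S" and \<xi>[measurable]: "\<xi> \<in> measurable M D"
    and joint: "distr M (S \<Otimes>\<^sub>M D) (\<lambda>\<omega>. (U \<omega>, \<xi> \<omega>)) = distr M S U \<Otimes>\<^sub>M D" and D: "prob_space D"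
    and a[measurable]: "a \<in> borel_measurable S" and G[measurable]: "(\<lambda>(u, s). G u s) \<in> borel_measurable (S \<Otimes>\<^sub>M D)"
    and c[measurable]: "c \<in> borel_measurable S"
    and mean: "\<And>u. u \<in> space S \<Longrightarrow> has_bochner_integral D (G u) 0"
    and var: "\<And>u. u \<in> space S \<Longrightarrow> nsq D (\<lambda>s. G u s) \<le> c u"
  shows "nsq M (\<lambda>\<omega>. a (U \<omega>) + G (U \<omega>) (\<xi> \<omega>))
     \<le> nsq M (\<lambda>\<omega>. a (U \<omega>)) + (\<integral>\<^sup>+ \<omega>. c (U \<omega>) \<partial>M)"
proof -
  interpret D: prob_space D by fact
  have meas[measurable]: "(\<lambda>(u, s). ennreal ((norm (a u + G u s))\<^sup>2)) \<in> borel_measurable (S \<Otimes>\<^sub>M D)"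
    unfolding split_beta' using G unfolding split_beta' by measurable
  have "nsq M (\<lambda>\<omega>. a (U \<omega>) + G (U \<omega>) (\<xi> \<omega>))
      = (\<integral>\<^sup>+ z. (case z of (u, s) \<Rightarrow> ennreal ((norm (a u + G u s))\<^sup>2)) \<partial>distr M (S \<Otimes>\<^sub>M D) (\<lambda>\<omega>. (U \<omega>, \<xi> \<omega>)))"
    by (subst nn_integral_distr) auto
  also have "\<dots> = (\<integral>\<^sup>+ u. \<integral>\<^sup>+ s. ennreal ((norm (a u + G u s))\<^sup>2) \<partial>D \<partial>distr M S U)"
    unfolding joint by (subst D.nn_integral_fst[symmetric]) (auto cong: measurable_cong_sets)
  also have "\<dots> \<le> (\<integral>\<^sup>+ u. ennreal ((norm (a u))\<^sup>2) + c u \<partial>distr M S U)"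
  proof (rule nn_integral_mono)
    fix u assume "u \<in> space (distr M S U)"
    then have u: "u \<in> space S" by simp
    show "nsq D (\<lambda>s. a u + G u s) \<le> ennreal ((norm (a u))\<^sup>2) + c u"
      using second_moment_shift[OF D mean[OF u], of "a u"] var[OF u] by (auto intro: order_trans add_left_mono)
  qed
  also have "\<dots> = (\<integral>\<^sup>+ \<omega>. ennreal ((norm (a (U \<omega>)))\<^sup>2) + c (U \<omega>) \<partial>M)"
    by (subst nn_integral_distr) auto
  also have "\<dots> = nsq M (\<lambda>\<omega>. a (U \<omega>)) + (\<integral>\<^sup>+ \<omega>. c (U \<omega>) \<partial>M)"
    by (rule nn_integral_add) auto
  finally show ?thesis .
qed

text \<open>The samples of a batch are added one at a time, so that only the independence of one sample
  from everything before it enters.\<close>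

lemma (in prob_space) batch_second_moment:
  fixes e :: "'a \<Rightarrow> 'v::euclidean_space" and \<psi> :: "'u \<Rightarrow> 's \<Rightarrow> 'v" and \<xi> :: "nat \<Rightarrow> 'a \<Rightarrow> 's"
  assumes D: "prob_space D"
    and ind: "indep_sets (case_option (sets F) (\<lambda>k. {\<xi> k -` A \<inter> space M | A. A \<in> sets D})) (insert None (Some ` {..<n}))"
    and F: "space F = space M"
    and \<xi>: "\<And>k. k < n \<Longrightarrow> \<xi> k \<in> measurable M D" "\<And>k. k < n \<Longrightarrow> distr M D (\<xi> k) = D"
    and e: "e \<in> borel_measurable F" and p: "p \<in> measurable F S"
    and \<psi>: "(\<lambda>(u, s). \<psi> u s) \<in> borel_measurable (S \<Otimes>\<^sub>M D)" and c: "c \<in> borel_measurable S"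
    and mean: "\<And>u. u \<in> space S \<Longrightarrow> has_bochner_integral D (\<psi> u) 0"
    and var: "\<And>u. u \<in> space S \<Longrightarrow> nsq D (\<lambda>s. \<psi> u s) \<le> c u"
    and n: "n \<ge> 1"
  shows "nsq M (\<lambda>\<omega>. e \<omega> + (1 / real n) *\<^sub>R (\<Sum>k<n. \<psi> (p \<omega>) (\<xi> k \<omega>)))
    \<le> nsq M (\<lambda>\<omega>. e \<omega>) + ennreal (1 / real n) * (\<integral>\<^sup>+ \<omega>. c (p \<omega>) \<partial>M)"
proof -
  let ?E = "case_option (sets F) (\<lambda>k. {\<xi> k -` A \<inter> space M | A. A \<in> sets D})"
  define s where "s k \<omega> = e \<omega> + (1 / real n) *\<^sub>R (\<Sum>j<k. \<psi> (p \<omega>) (\<xi> j \<omega>))" for k \<omega>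
  have "sets F \<subseteq> events" using ind by (auto simp: indep_sets_def)
  then have subF: "subalgebra M F" using F by (simp add: subalgebra_def)
  have pM: "p \<in> measurable M S" by (rule measurable_from_subalg[OF subF p])
  have "nsq M (\<lambda>\<omega>. s k \<omega>)
    \<le> nsq M (\<lambda>\<omega>. e \<omega>) + of_nat k * (ennreal ((1 / real n)\<^sup>2) * (\<integral>\<^sup>+ \<omega>. c (p \<omega>) \<partial>M))"
    if "k \<le> n" for k
    using that
  proof (induction k)
    case 0 then show ?case by (simp add: s_def)
  next
    case (Suc k)
    \<comment> \<open>Two disjoint groups of indices: the past with the first \<open>k\<close>
      samples, and sample \<open>k\<close> alone. Intersection-stability of the generators lifts
      independence to the generated sigma-algebras.\<close>
    let ?I = "case_bool (insert None (Some ` {..<k})) {Some k}"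
    have kn: "k < n" using Suc by simp
    have UI: "(\<Union>b\<in>UNIV. ?I b) \<subseteq> insert None (Some ` {..<n})"
      using kn by (auto split: bool.splits)
    have st: "Int_stable (?E i)" for i
    proof (cases i)
      case None then show ?thesis by (auto simp: Int_stable_def)
    next
      case (Some k)
      have "\<exists>C. \<xi> k -` A \<inter> space M \<inter> (\<xi> k -` B \<inter> space M) = \<xi> k -` C \<inter> space M \<and> C \<in> sets D"
        if "A \<in> sets D" "B \<in> sets D" for A B
        using that by (intro exI[of _ "A \<inter> B"]) auto
      then show ?thesis using Some by (auto simp: Int_stable_def)
    qed
    define H where "H b = sigma (space M) (\<Union>i\<in>?I b. ?E i)" for b
    have pow: "(\<Union>i\<in>?I b. ?E i) \<subseteq> Pow (space M)" for b
    proof (rule UN_least)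
      fix i assume "i \<in> ?I b"
      then have "i \<in> insert None (Some ` {..<n})" using UI by blast
      then have "?E i \<subseteq> events" using ind unfolding indep_sets_def by blast
      then show "?E i \<subseteq> Pow (space M)" using sets.space_closed by blast
    qed
    have setsH: "sets (H b) = sigma_sets (space M) (\<Union>i\<in>?I b. ?E i)" for b
      unfolding H_def using pow[of b] by simp
    have spH: "space (H b) = space M" for b unfolding H_def by (rule space_measure_of[OF pow])
    have indH: "indep_sets (\<lambda>b. sets (H b)) UNIV"
      unfolding setsH
    proof (rule indep_sets_collect_sigma)
      show "indep_sets ?E (\<Union>b\<in>UNIV. ?I b)" by (rule indep_sets_mono_index[OF UI ind])
      show "disjoint_family_on ?I UNIV" by (auto simp: disjoint_family_on_def split: bool.splits)
    qed (rule st)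
    have subH: "subalgebra M (H b)" for b
      using indH spH by (auto simp: subalgebra_def indep_sets_def)
    have HF: "subalgebra (H True) F"
      unfolding subalgebra_def setsH spH using F by (auto intro!: sigma_sets.Basic)
    have H\<xi>: "\<xi> j \<in> measurable (H b) D" if "Some j \<in> ?I b" "j < n" for j b
    proof (rule measurableI)
      show "\<xi> j x \<in> space D" if "x \<in> space (H b)" for x
        using that \<xi>(1)[OF \<open>j < n\<close>] spH by (auto dest: measurable_space)
      show "\<xi> j -` A \<inter> space (H b) \<in> sets (H b)" if "A \<in> sets D" for A
        unfolding spH setsH using that \<open>Some j \<in> ?I b\<close> by (intro sigma_sets.Basic) force
    qed
    have [measurable]: "e \<in> borel_measurable (H True)" "p \<in> measurable (H True) S"
      using measurable_from_subalg[OF HF] e p by auto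
    have [measurable]: "(\<lambda>\<omega>. \<psi> (p \<omega>) (\<xi> j \<omega>)) \<in> borel_measurable (H True)" if "j < k" for j
    proof -
      have "(\<lambda>\<omega>. (p \<omega>, \<xi> j \<omega>)) \<in> measurable (H True) (S \<Otimes>\<^sub>M D)"
        using H\<xi>[of j True] that kn by auto
      from measurable_compose[OF this \<psi>] show ?thesis by simp
    qed
    have sk[measurable]: "s k \<in> borel_measurable (H True)"
      unfolding s_def by (intro borel_measurable_add borel_measurable_scaleR borel_measurable_sum) auto
    \<comment> \<open>Known before sample \<open>k\<close>: the partial sum and the query point,
      paired into one random element so that the two-variable lemma applies.\<close>
    have U[measurable]: "(\<lambda>\<omega>. (s k \<omega>, p \<omega>)) \<in> measurable (H True) (borel \<Otimes>\<^sub>M S)" by measurable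
    have 1: "indep_set (sets (H True)) (sets (H False))"
      unfolding indep_set_def using indH by (rule indep_sets_mono_sets) (auto split: bool.splits)
    have UM: "(\<lambda>\<omega>. (s k \<omega>, p \<omega>)) \<in> measurable M (borel \<Otimes>\<^sub>M S)" by (rule measurable_from_subalg[OF subH U])
    have joint: "distr M ((borel \<Otimes>\<^sub>M S) \<Otimes>\<^sub>M D) (\<lambda>\<omega>. ((s k \<omega>, p \<omega>), \<xi> k \<omega>))
        = distr M (borel \<Otimes>\<^sub>M S) (\<lambda>\<omega>. (s k \<omega>, p \<omega>)) \<Otimes>\<^sub>M distr M D (\<xi> k)"
    proof (rule joint_distr_of_indep_set[OF 1 UM \<xi>(1)[OF kn]])
      show "(\<lambda>\<omega>. (s k \<omega>, p \<omega>)) -` C \<inter> space M \<in> sets (H True)" if "C \<in> sets (borel \<Otimes>\<^sub>M S)" for C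
        using measurable_sets[OF U that] spH by simp
      show "\<xi> k -` C \<inter> space M \<in> sets (H False)" if "C \<in> sets D" for C
        using measurable_sets[OF H\<xi>[of k False] that] kn spH by simp
    qed
    note joint = joint[unfolded \<xi>(2)[OF kn]]
    have "nsq M (\<lambda>\<omega>. fst (s k \<omega>, p \<omega>) + (1 / real n) *\<^sub>R \<psi> (snd (s k \<omega>, p \<omega>)) (\<xi> k \<omega>))
      \<le> nsq M (\<lambda>\<omega>. fst (s k \<omega>, p \<omega>)) + (\<integral>\<^sup>+ \<omega>. ennreal ((1 / real n)\<^sup>2) * c (snd (s k \<omega>, p \<omega>)) \<partial>M)"
    proof (rule independent_second_moment[OF UM \<xi>(1)[OF kn] joint D, where c = "\<lambda>u. ennreal ((1 / real n)\<^sup>2) * c (snd u)"])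
      have [measurable]: "(\<lambda>x. \<psi> (snd (fst x)) (snd x)) \<in> borel_measurable ((borel \<Otimes>\<^sub>M S) \<Otimes>\<^sub>M D)"
      proof -
        have "(\<lambda>x. (snd (fst x), snd x)) \<in> measurable ((borel \<Otimes>\<^sub>M S) \<Otimes>\<^sub>M D) (S \<Otimes>\<^sub>M D)" by measurable
        from measurable_compose[OF this \<psi>] show ?thesis by simp
      qed
      show "(\<lambda>(u, s). (1 / real n) *\<^sub>R \<psi> (snd u) s) \<in> borel_measurable ((borel \<Otimes>\<^sub>M S) \<Otimes>\<^sub>M D)"
        unfolding split_beta' by measurable
      show "(\<lambda>u. ennreal ((1 / real n)\<^sup>2) * c (snd u)) \<in> borel_measurable (borel \<Otimes>\<^sub>M S)"
        using c by measurable
      fix u :: "'v \<times> 'u" assume "u \<in> space (borel \<Otimes>\<^sub>M S)"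
      then have u: "snd u \<in> space S" by (auto simp: space_pair_measure)
      show "has_bochner_integral D (\<lambda>s. (1 / real n) *\<^sub>R \<psi> (snd u) s) 0"
        using has_bochner_integral_scaleR_right[OF mean[OF u], of "1 / real n"] by simp
      have "(\<lambda>s. \<psi> (snd u) s) \<in> borel_measurable D" using mean[OF u] by (auto simp: has_bochner_integral_iff)
      then have "nsq D (\<lambda>s. (1 / real n) *\<^sub>R \<psi> (snd u) s)
         = ennreal ((1 / real n)\<^sup>2) * nsq D (\<lambda>s. \<psi> (snd u) s)"
        by (subst nn_integral_cmult[symmetric]) (auto simp: power_mult_distrib power_divide ennreal_mult'[symmetric])
      also have "\<dots> \<le> ennreal ((1 / real n)\<^sup>2) * c (snd u)" by (intro mult_left_mono var[OF u]) auto
      finally show "nsq D (\<lambda>s. (1 / real n) *\<^sub>R \<psi> (snd u) s) \<le> ennreal ((1 / real n)\<^sup>2) * c (snd u)" .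
    qed measurable
    also have "(\<lambda>\<omega>. fst (s k \<omega>, p \<omega>) + (1 / real n) *\<^sub>R \<psi> (snd (s k \<omega>, p \<omega>)) (\<xi> k \<omega>)) = s (Suc k)"
      by (auto simp: s_def algebra_simps fun_eq_iff)
    also have "(\<integral>\<^sup>+ \<omega>. ennreal ((1 / real n)\<^sup>2) * c (snd (s k \<omega>, p \<omega>)) \<partial>M) = ennreal ((1 / real n)\<^sup>2) * (\<integral>\<^sup>+ \<omega>. c (p \<omega>) \<partial>M)"
      using measurable_compose[OF pM c] by (simp add: nn_integral_cmult)
    finally have "nsq M (\<lambda>\<omega>. s (Suc k) \<omega>)
       \<le> nsq M (\<lambda>\<omega>. s k \<omega>) + ennreal ((1 / real n)\<^sup>2) * (\<integral>\<^sup>+ \<omega>. c (p \<omega>) \<partial>M)" by simp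
    also have "\<dots> \<le> (nsq M (\<lambda>\<omega>. e \<omega>) + of_nat k * (ennreal ((1 / real n)\<^sup>2) * (\<integral>\<^sup>+ \<omega>. c (p \<omega>) \<partial>M)))
       + ennreal ((1 / real n)\<^sup>2) * (\<integral>\<^sup>+ \<omega>. c (p \<omega>) \<partial>M)"
      using Suc.IH kn by (intro add_right_mono) simp
    also have "\<dots> = nsq M (\<lambda>\<omega>. e \<omega>) + of_nat (Suc k) * (ennreal ((1 / real n)\<^sup>2) * (\<integral>\<^sup>+ \<omega>. c (p \<omega>) \<partial>M))"
      by (simp add: distrib_right add_ac)
    finally show ?case .
  qed
  from this[of n] have "nsq M (\<lambda>\<omega>. s n \<omega>)
    \<le> nsq M (\<lambda>\<omega>. e \<omega>) + (of_nat n * ennreal ((1 / real n)\<^sup>2)) * (\<integral>\<^sup>+ \<omega>. c (p \<omega>) \<partial>M)"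
    by (simp add: mult.assoc)
  \<comment> \<open>Each of the \<open>n\<close> samples contributes with its squared
    weight.\<close>
  moreover have "of_nat n * ennreal ((1 / real n)\<^sup>2) = ennreal (1 / real n)"
    using n by (simp add: ennreal_of_nat_eq_real_of_nat power2_eq_square flip: ennreal_mult')
  ultimately show ?thesis by (simp add: s_def)
qed

section \<open>Measurability and square integrability of row-wise maps\<close>

lemma batch_grad_map: "batch_grad sg (map \<zeta> [0..<n]) z = (1 / real n) *\<^sub>R (\<Sum>k<n. sg z (\<zeta> k))"
  by (simp add: batch_grad_def comp_def interv_sum_list_conv_sum_set_nat atLeast0LessThan)

lemma borel_measurable_rows:
  fixes Z :: "'m::finite \<Rightarrow> 'w \<Rightarrow> real ^ 'd"
  assumes "\<And>i. Z i \<in> borel_measurable N"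
  shows "(\<lambda>\<omega>. \<chi> i. Z i \<omega> :: real ^ 'd ^ 'm) \<in> borel_measurable N"
proof -
  have eq: "(\<chi> i. Z i \<omega>) = (\<Sum>i\<in>UNIV. axis i (Z i \<omega>))" for \<omega>
    by (simp add: vec_eq_iff axis_def if_distrib cong: if_cong)
  have "linear (axis i :: real ^ 'd \<Rightarrow> real ^ 'd ^ 'm)" for i
    by (intro linearI) (auto simp: vec_eq_iff axis_def)
  then have "continuous_on UNIV (axis i :: real ^ 'd \<Rightarrow> real ^ 'd ^ 'm)" for i
    by (simp add: linear_continuous_on linear_conv_bounded_linear)
  then have "(axis i :: real ^ 'd \<Rightarrow> real ^ 'd ^ 'm) \<in> borel_measurable borel" for i
    by (rule borel_measurable_continuous_onI)
  then show ?thesis unfolding eq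
    by (intro borel_measurable_sum measurable_compose[OF assms])
qed

lemma borel_measurable_row [measurable (raw)]:
  fixes Z :: "'w \<Rightarrow> real ^ 'd ^ 'm"
  assumes "Z \<in> borel_measurable N"
  shows "(\<lambda>\<omega>. Z \<omega> $ i) \<in> borel_measurable N"
  by (rule measurable_compose[OF assms borel_measurable_continuous_onI]) (intro continuous_intros)

lemma borel_measurable_linear:
  fixes l :: "'x::euclidean_space \<Rightarrow> 'y::euclidean_space"
  assumes "linear l" "Z \<in> borel_measurable N"
  shows "(\<lambda>\<omega>. l (Z \<omega>)) \<in> borel_measurable N"
  using assms(1) by (intro measurable_compose[OF assms(2) borel_measurable_continuous_onI])
    (simp add: linear_continuous_on linear_conv_bounded_linear)

text \<open>Nonexpansiveness makes the proximal map continuous, so the choice in its definition does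
  no harm to measurability.\<close>

lemma borel_measurable_prox_rows:
  assumes r: "closed_convex_fun r" "edom r \<noteq> {}" and \<eta>: "\<eta> > 0" and Z: "Z \<in> borel_measurable N"
  shows "(\<lambda>\<omega>. prox_rows (\<lambda>v. ereal \<eta> * r v) (Z \<omega> :: real ^ 'd ^ 'm)) \<in> borel_measurable N"
proof -
  have "continuous_on UNIV (prox (\<lambda>v. ereal \<eta> * r v))"
    using prox_nonexpansive[OF r \<eta>]
    by (intro lipschitz_on_continuous_on[of 1] lipschitz_onI) (auto simp: dist_norm)
  then have p: "prox (\<lambda>v. ereal \<eta> * r v) \<in> borel_measurable borel" by (rule borel_measurable_continuous_onI)
  show ?thesis unfolding prox_rows_def
    by (intro borel_measurable_rows measurable_compose[OF borel_measurable_row[OF Z] p])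
qed

lemma norm_prox_rows_diff_le:
  assumes r: "closed_convex_fun r" "edom r \<noteq> {}" and \<eta>: "\<eta> > 0"
  shows "norm (prox_rows (\<lambda>v. ereal \<eta> * r v) U - prox_rows (\<lambda>v. ereal \<eta> * r v) U' :: real ^ 'd ^ 'm) \<le> norm (U - U')"
proof (rule power2_le_imp_le)
  show "(norm (prox_rows (\<lambda>v. ereal \<eta> * r v) U - prox_rows (\<lambda>v. ereal \<eta> * r v) U' :: real ^ 'd ^ 'm))\<^sup>2 \<le> (norm (U - U'))\<^sup>2"
    unfolding norm_sq_rows by (intro sum_mono power_mono) (simp_all add: prox_rows_def prox_nonexpansive[OF r \<eta>])
qed simp

definition square_integrable :: "'w measure \<Rightarrow> ('w \<Rightarrow> 'v::euclidean_space) \<Rightarrow> bool" where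
  "square_integrable M Z \<longleftrightarrow> Z \<in> borel_measurable M \<and> integrable M (\<lambda>\<omega>. (norm (Z \<omega>))\<^sup>2)"

lemma Esq_eq_integral:
  assumes "square_integrable M Z"
  shows "Esq M Z = ereal (\<integral>\<omega>. (norm (Z \<omega>))\<^sup>2 \<partial>M)"
  using assms by (simp add: Esq_def square_integrable_def nn_integral_eq_integral enn2ereal_ennreal)

lemma square_integrableI_nn:
  assumes "Z \<in> borel_measurable M" "nsq M (\<lambda>\<omega>. Z \<omega>) < \<infinity>"
  shows "square_integrable M Z"
  using assms by (auto simp: square_integrable_def intro!: integrableI_nonneg)

lemma (in prob_space) square_integrable_bound:
  fixes Z :: "'a \<Rightarrow> 'v::euclidean_space" and A :: "'a \<Rightarrow> 'x::euclidean_space" and B :: "'a \<Rightarrow> 'y::euclidean_space"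
  assumes A: "square_integrable M A" and B: "square_integrable M B" and Z: "Z \<in> borel_measurable M"
    and bound: "\<And>\<omega>. \<omega> \<in> space M \<Longrightarrow> norm (Z \<omega>) \<le> a * norm (A \<omega>) + b * norm (B \<omega>) + c"
  shows "square_integrable M Z"
  unfolding square_integrable_def
proof (intro conjI Z)
  have "integrable M (\<lambda>\<omega>. 3 * (a\<^sup>2 * (norm (A \<omega>))\<^sup>2 + b\<^sup>2 * (norm (B \<omega>))\<^sup>2 + c\<^sup>2))"
    using A B by (auto simp: square_integrable_def)
  then show "integrable M (\<lambda>\<omega>. (norm (Z \<omega>))\<^sup>2)"
  proof (rule Bochner_Integration.integrable_bound)
    show "AE \<omega> in M. norm ((norm (Z \<omega>))\<^sup>2) \<le> norm (3 * (a\<^sup>2 * (norm (A \<omega>))\<^sup>2 + b\<^sup>2 * (norm (B \<omega>))\<^sup>2 + c\<^sup>2))"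
    proof (rule AE_I2)
      fix \<omega> assume \<omega>: "\<omega> \<in> space M"
      have "(norm (Z \<omega>))\<^sup>2 \<le> (a * norm (A \<omega>) + b * norm (B \<omega>) + c)\<^sup>2" using bound[OF \<omega>] by (intro power_mono) auto
      also have "\<dots> \<le> 3 * (a\<^sup>2 * (norm (A \<omega>))\<^sup>2 + b\<^sup>2 * (norm (B \<omega>))\<^sup>2 + c\<^sup>2)"
        using sq_sum3[of "a * norm (A \<omega>)" "b * norm (B \<omega>)" c] by (simp add: power_mult_distrib)
      finally show "norm ((norm (Z \<omega>))\<^sup>2) \<le> norm (3 * (a\<^sup>2 * (norm (A \<omega>))\<^sup>2 + b\<^sup>2 * (norm (B \<omega>))\<^sup>2 + c\<^sup>2))" by simp
    qed
  qed (use Z in measurable)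
qed

lemma (in prob_space) square_integrable_const: "square_integrable M (\<lambda>\<omega>. c)"
  by (simp add: square_integrable_def)

lemma (in prob_space) square_integrable_cong:
  assumes "square_integrable M A" "\<And>\<omega>. \<omega> \<in> space M \<Longrightarrow> Z \<omega> = A \<omega>"
  shows "square_integrable M Z"
proof -
  have "Z \<in> borel_measurable M" using assms by (subst measurable_cong[of M Z A]) (auto simp: square_integrable_def)
  moreover have "integrable M (\<lambda>\<omega>. (norm (Z \<omega>))\<^sup>2)"
    using assms by (subst Bochner_Integration.integrable_cong[of M M _ "\<lambda>\<omega>. (norm (A \<omega>))\<^sup>2"]) (auto simp: square_integrable_def)
  ultimately show ?thesis by (simp add: square_integrable_def)
qed

lemma (in prob_space) square_integrable_add:
  assumes "square_integrable M A" "square_integrable M B"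
  shows "square_integrable M (\<lambda>\<omega>. A \<omega> + B \<omega>)" "square_integrable M (\<lambda>\<omega>. A \<omega> - B \<omega>)"
  by (rule square_integrable_bound[OF assms, of _ 1 1 0];
      use assms in \<open>auto simp: square_integrable_def norm_triangle_ineq norm_triangle_ineq4\<close>)+

lemma (in prob_space) square_integrable_linear:
  fixes l :: "'x::euclidean_space \<Rightarrow> 'y::euclidean_space"
  assumes l: "linear l" and A: "square_integrable M A"
  shows "square_integrable M (\<lambda>\<omega>. l (A \<omega>))"
proof -
  obtain C where C: "\<And>x. norm (l x) \<le> C * norm x" using linear_bounded[OF l] by blast
  show ?thesis
    by (rule square_integrable_bound[OF A A, of _ C 0 0])
      (use A C borel_measurable_linear[OF l] in \<open>auto simp: square_integrable_def\<close>)
qed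

lemma (in prob_space) square_integrable_prox_rows:
  fixes A :: "'a \<Rightarrow> real ^ 'd ^ 'm"
  assumes r: "closed_convex_fun r" "edom r \<noteq> {}" and \<eta>: "\<eta> > 0" and A: "square_integrable M A"
  shows "square_integrable M (\<lambda>\<omega>. prox_rows (\<lambda>v. ereal \<eta> * r v) (A \<omega>))"
proof (rule square_integrable_bound[OF A A, of _ 1 0 "norm (prox_rows (\<lambda>v. ereal \<eta> * r v) (0 :: real ^ 'd ^ 'm))"])
  show "(\<lambda>\<omega>. prox_rows (\<lambda>v. ereal \<eta> * r v) (A \<omega>)) \<in> borel_measurable M"
    using A by (intro borel_measurable_prox_rows[OF r \<eta>]) (simp add: square_integrable_def)
  fix \<omega>
  show "norm (prox_rows (\<lambda>v. ereal \<eta> * r v) (A \<omega>)) \<le> 1 * norm (A \<omega>) + 0 * norm (A \<omega>)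
     + norm (prox_rows (\<lambda>v. ereal \<eta> * r v) (0 :: real ^ 'd ^ 'm))"
    using norm_prox_rows_diff_le[OF r \<eta>, of "A \<omega>" 0]
      norm_triangle_ineq2[of "prox_rows (\<lambda>v. ereal \<eta> * r v) (A \<omega>)" "prox_rows (\<lambda>v. ereal \<eta> * r v) 0"] by simp
qed

lemma (in prob_space) square_integrable_rows:
  fixes A :: "'m::finite \<Rightarrow> 'a \<Rightarrow> real ^ 'd"
  assumes "\<And>i. square_integrable M (A i)"
  shows "square_integrable M (\<lambda>\<omega>. \<chi> i. A i \<omega> :: real ^ 'd ^ 'm)"
  using assms borel_measurable_rows[of A M] by (auto simp: square_integrable_def norm_sq_rows)

text \<open>Common form of the two sampling settings. \<open>b t\<close> counts the samples drawn at
  iteration \<open>t\<close>; at a restart either the batch gradient is exact for every agent, or it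
  averages at least one fresh sample with variance at most \<Upsilon>. Between restarts the batch
  size equals the period \<open>q\<close>, as the amortization in \<open>spider_sum\<close>
  requires.\<close>

locale vrlm_process = prob_space M + minimax W \<rho> m L \<mu> \<kappa> f g h
  for M :: "'w measure" and W :: "real ^ 'm ^ 'm" and \<rho> m L \<mu> \<kappa> :: real
    and f :: "'m \<Rightarrow> (real ^ 'a) \<times> (real ^ 'b) \<Rightarrow> real"
    and g :: "real ^ 'a \<Rightarrow> ereal" and h :: "real ^ 'b \<Rightarrow> ereal" +
  fixes \<eta> \<eta>' LP \<phi>s \<sigma> \<Upsilon> :: real and q :: nat and b :: "nat \<Rightarrow> nat"
    and D :: "'m \<Rightarrow> 's measure"
    and sg :: "'m \<Rightarrow> (real ^ 'a) \<times> (real ^ 'b) \<Rightarrow> 's \<Rightarrow> (real ^ 'a) \<times> (real ^ 'b)"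
    and \<xi> :: "'m \<Rightarrow> nat \<Rightarrow> nat \<Rightarrow> 'w \<Rightarrow> 's" and B :: "'m \<Rightarrow> nat \<Rightarrow> 'w \<Rightarrow> 's list"
    and X V :: "nat \<Rightarrow> 'w \<Rightarrow> real ^ 'a ^ 'm" and \<Lambda> Y :: "nat \<Rightarrow> 'w \<Rightarrow> real ^ 'b ^ 'm"
    and d :: "nat \<Rightarrow> 'w \<Rightarrow> 'm \<Rightarrow> (real ^ 'a) \<times> (real ^ 'b)" and x0 :: "real ^ 'a" and y0 :: "real ^ 'b"
  assumes q: "q \<ge> 1" and Ups: "\<Upsilon> \<ge> 0"
    and prob_D: "\<And>i. prob_space (D i)"
    and sg_meas: "\<And>i. (\<lambda>(z, s). sg i z s) \<in> borel_measurable (borel \<Otimes>\<^sub>M D i)"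
    and sg_mean: "\<And>i z. has_bochner_integral (D i) (sg i z) (grad (f i) z)"
    and sg_var: "\<And>i z. nsq (D i) (\<lambda>s. sg i z s - grad (f i) z) \<le> ennreal (\<sigma>\<^sup>2)"
    and sg_mss: "\<And>i z z'. nsq (D i) (\<lambda>s. sg i z s - sg i z' s) \<le> ennreal (L\<^sup>2 * (norm (z - z'))\<^sup>2)"
    and fresh: "fresh_iid M D \<xi> b"
    and inner_batch: "\<And>i t \<omega>. t mod q \<noteq> 0 \<Longrightarrow> B i t \<omega> = map (\<lambda>k. \<xi> i t k \<omega>) [0..<b t]" "\<And>t. t mod q \<noteq> 0 \<Longrightarrow> b t = q"
    and restart_batch: "\<And>t. t mod q = 0 \<Longrightarrow> (\<forall>i \<omega> z. batch_grad (sg i) (B i t \<omega>) z = grad (f i) z)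
        \<or> (\<forall>i \<omega>. B i t \<omega> = map (\<lambda>k. \<xi> i t k \<omega>) [0..<b t]) \<and> b t \<ge> 1 \<and> \<sigma>\<^sup>2 / real (b t) \<le> \<Upsilon>"
    and run: "\<And>\<omega>. \<omega> \<in> space M \<Longrightarrow> vrlm_run W \<rho> m L \<mu> \<kappa> f g h \<eta> \<eta>' LP \<phi>s
        (\<lambda>t. X t \<omega>) (\<lambda>t. V t \<omega>) (\<lambda>t. \<Lambda> t \<omega>) (\<lambda>t. Y t \<omega>) (\<lambda>t. d t \<omega>) x0 y0"
    and Lam_0: "\<And>\<omega>. \<omega> \<in> space M \<Longrightarrow> \<Lambda> 0 \<omega> = 0"
    and d_restart: "\<And>\<omega> t i. \<omega> \<in> space M \<Longrightarrow> t mod q = 0 \<Longrightarrow> d t \<omega> i = batch_grad (sg i) (B i t \<omega>) (X t \<omega> $ i, Y t \<omega> $ i)"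
    and d_inner: "\<And>\<omega> t i. \<omega> \<in> space M \<Longrightarrow> Suc t mod q \<noteq> 0 \<Longrightarrow> d (Suc t) \<omega> i =
        batch_grad (sg i) (B i (Suc t) \<omega>) (X (Suc t) \<omega> $ i, Y (Suc t) \<omega> $ i)
        - batch_grad (sg i) (B i (Suc t) \<omega>) (X t \<omega> $ i, Y t \<omega> $ i) + d t \<omega> i"
begin

lemma step_sizes: "\<eta> > 0" "\<eta>' > 0" "LP > 0"
  using run not_empty by (auto simp: vrlm_run_def vrlm_run_axioms_def)

lemma run_eqs:
  assumes "\<omega> \<in> space M"
  shows "X 0 \<omega> = rep x0" "Y 0 \<omega> = rep y0" "V 0 \<omega> = (\<chi> i. fst (d 0 \<omega> i))"
    "V (Suc t) \<omega> = W ** (V t \<omega> + (\<chi> i. fst (d (Suc t) \<omega> i)) - (\<chi> i. fst (d t \<omega> i)))"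
    "X (Suc t) \<omega> = prox_rows (\<lambda>v. ereal \<eta> * g v) (W ** X t \<omega> - \<eta> *\<^sub>R V t \<omega>)"
    "\<Lambda> (Suc t) \<omega> = \<Lambda> t \<omega> + (L * \<eta>' / (2 * sqrt m)) *\<^sub>R ((W - mat 1) ** Y t \<omega>)"
    "Y (Suc t) \<omega> = prox_rows (\<lambda>v. ereal (1 / (4 * L)) * h v)
      (Y t \<omega> + (1 / (4 * L)) *\<^sub>R ((\<chi> i. snd (d t \<omega> i)) - (L * sqrt m / 2) *\<^sub>R (transpose (W - mat 1) ** \<Lambda> t \<omega>)))"
    "edom g \<noteq> {}"
  using run[OF assms] unfolding vrlm_run_def vrlm_run_axioms_def dualstep_def by auto

lemma g_dom: "edom g \<noteq> {}"
  using run_eqs(8) not_empty by blast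

definition past :: "nat \<Rightarrow> 'w measure" where
  "past t = sigma (space M) {\<xi> j s k -` A \<inter> space M | j s k A. s < t \<and> k < b s \<and> A \<in> sets (D j)}"

lemma sample: "k < b t \<Longrightarrow> \<xi> i t k \<in> measurable M (D i)" "k < b t \<Longrightarrow> distr M (D i) (\<xi> i t k) = D i"
  using fresh by (auto simp: fresh_iid_def)

lemma sets_past: "sets (past t) = past_events M D \<xi> b t" and space_past: "space (past t) = space M"
proof -
  have "{\<xi> j s k -` A \<inter> space M | j s k A. s < t \<and> k < b s \<and> A \<in> sets (D j)} \<subseteq> Pow (space M)" by auto
  then show "sets (past t) = past_events M D \<xi> b t" "space (past t) = space M"
    by (simp_all add: past_def past_events_def space_measure_of)
qed

lemma past_sub: "subalgebra M (past t)"
  unfolding subalgebra_def space_past sets_past past_events_def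
  using measurable_sets[OF sample(1)] by (auto intro!: sets.sigma_sets_subset)

lemma past_mono:
  assumes "s \<le> t" shows "subalgebra (past t) (past s)"
  unfolding subalgebra_def space_past sets_past past_events_def
proof (intro conjI refl sigma_sets_mono')
  show "{\<xi> j r k -` A \<inter> space M | j r k A. r < s \<and> k < b r \<and> A \<in> sets (D j)}
    \<subseteq> {\<xi> j r k -` A \<inter> space M | j r k A. r < t \<and> k < b r \<and> A \<in> sets (D j)}"
    using assms less_le_trans by blast
qed

lemma sample_past: "s < t \<Longrightarrow> k < b s \<Longrightarrow> \<xi> i s k \<in> measurable (past t) (D i)"
proof (rule measurableI)
  fix A assume *: "s < t" "k < b s" "A \<in> sets (D i)"
  show "\<xi> i s k -` A \<inter> space (past t) \<in> sets (past t)"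
    unfolding space_past sets_past past_events_def
    by (rule sigma_sets.Basic) (use * in blast)
next
  fix x assume "s < t" "k < b s" "x \<in> space (past t)"
  then show "\<xi> i s k x \<in> space (D i)" using measurable_space[OF sample(1)] by (auto simp: space_past)
qed

lemma past_indep: "indep_sets (case_option (sets (past t)) (\<lambda>k. {\<xi> i t k -` A \<inter> space M | A. A \<in> sets (D i)})) (insert None (Some ` {..<b t}))"
  using fresh unfolding fresh_iid_def sets_past by blast

lemma grad_measurable: "grad (f i) \<in> borel_measurable borel"
  using f_smooth[of i] by (intro borel_measurable_continuous_onI lipschitz_on_continuous_on) (auto simp: smooth_def)

lemma sg_compose:
  assumes "Z \<in> borel_measurable N" "\<zeta> \<in> measurable N (D i)"
  shows "(\<lambda>\<omega>. sg i (Z \<omega>) (\<zeta> \<omega>)) \<in> borel_measurable N"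
  using measurable_compose[OF measurable_Pair[OF assms] sg_meas[of i]] by simp

definition z where "z t i \<omega> = (X t \<omega> $ i, Y t \<omega> $ i)"

lemma z_measurable:
  assumes "X t \<in> borel_measurable N" "Y t \<in> borel_measurable N"
  shows "z t i \<in> borel_measurable N"
  unfolding z_def using assms by measurable

lemma past_Suc: "u \<in> borel_measurable (past t) \<Longrightarrow> u \<in> borel_measurable (past (Suc t))"
  by (rule measurable_from_subalg[OF past_mono[of t "Suc t"]]) simp_all

lemma batch_measurable:
  assumes "Z \<in> borel_measurable (past t)"
  shows "(\<lambda>\<omega>. (1 / real (b t)) *\<^sub>R (\<Sum>k<b t. sg i (Z \<omega>) (\<xi> i t k \<omega>))) \<in> borel_measurable (past (Suc t))"
  using past_Suc[OF assms]
  by (intro borel_measurable_scaleR borel_measurable_sum sg_compose sample_past) auto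

lemma past_cong:
  assumes "\<And>\<omega>. \<omega> \<in> space M \<Longrightarrow> u \<omega> = w \<omega>" "w \<in> borel_measurable (past t)"
  shows "u \<in> borel_measurable (past t)"
  using assms by (subst measurable_cong[of _ u w]) (auto simp: space_past)

lemma d_measurable_restart:
  assumes t: "t mod q = 0" and z: "z t i \<in> borel_measurable (past t)"
  shows "(\<lambda>\<omega>. d t \<omega> i) \<in> borel_measurable (past (Suc t))"
proof (cases "\<forall>\<omega> z. batch_grad (sg i) (B i t \<omega>) z = grad (f i) z")
  case True
  then show ?thesis
    by (intro past_cong[OF _ measurable_compose[OF past_Suc[OF z] grad_measurable[of i]]])
      (simp add: d_restart[OF _ t] z_def)
next
  case False
  then have B: "B i t \<omega> = map (\<lambda>k. \<xi> i t k \<omega>) [0..<b t]" for \<omega> using restart_batch[OF t] by blast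
  show ?thesis
    by (rule past_cong[OF _ batch_measurable[OF z, of i]]) (simp add: d_restart[OF _ t] B batch_grad_map z_def)
qed

lemma d_measurable_inner:
  assumes t: "Suc t mod q \<noteq> 0" and z: "z (Suc t) i \<in> borel_measurable (past (Suc t))" "z t i \<in> borel_measurable (past (Suc t))"
    and d: "(\<lambda>\<omega>. d t \<omega> i) \<in> borel_measurable (past (Suc t))"
  shows "(\<lambda>\<omega>. d (Suc t) \<omega> i) \<in> borel_measurable (past (Suc (Suc t)))"
  by (rule past_cong[OF _ borel_measurable_add[OF borel_measurable_diff[OF batch_measurable[OF z(1), of i] batch_measurable[OF z(2), of i]] past_Suc[OF d]]])
    (simp add: d_inner[OF _ t] inner_batch(1)[OF t] batch_grad_map z_def)

lemma borel_measurable_fst_rows: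
  assumes "\<And>i. (\<lambda>\<omega>. e \<omega> i) \<in> borel_measurable N"
  shows "(\<lambda>\<omega>. \<chi> i. fst (e \<omega> i :: (real ^ 'a) \<times> (real ^ 'b)) :: real ^ 'a ^ 'm) \<in> borel_measurable N"
    "(\<lambda>\<omega>. \<chi> i. snd (e \<omega> i :: (real ^ 'a) \<times> (real ^ 'b)) :: real ^ 'b ^ 'm) \<in> borel_measurable N"
  by (intro borel_measurable_rows borel_measurable_linear[OF linear_fst assms] borel_measurable_linear[OF linear_snd assms])+

text \<open>The shift of index is essential: \<open>X t\<close>, \<open>Y t\<close> and
  \<open>\<Lambda> t\<close> are fixed before the samples of iteration \<open>t\<close> are drawn,
  whereas \<open>V t\<close> and \<open>d t\<close> already use them. Hence the query points are
  independent of the current batch.\<close>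

lemma process_measurable:
  "X t \<in> borel_measurable (past t) \<and> Y t \<in> borel_measurable (past t) \<and> \<Lambda> t \<in> borel_measurable (past t)
   \<and> V t \<in> borel_measurable (past (Suc t)) \<and> (\<forall>i. (\<lambda>\<omega>. d t \<omega> i) \<in> borel_measurable (past (Suc t)))"
proof (induction t)
  case 0
  have X: "X 0 \<in> borel_measurable (past s)" "Y 0 \<in> borel_measurable (past s)" "\<Lambda> 0 \<in> borel_measurable (past s)" for s
    by (rule past_cong[where w = "\<lambda>_. rep x0"], use run_eqs Lam_0 in auto)
      (rule past_cong[where w = "\<lambda>_. rep y0"], use run_eqs Lam_0 in auto,
       rule past_cong[where w = "\<lambda>_. 0"], use run_eqs Lam_0 in auto)
  have d: "(\<lambda>\<omega>. d 0 \<omega> i) \<in> borel_measurable (past (Suc 0))" for i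
    by (intro d_measurable_restart z_measurable X) simp
  have "V 0 \<in> borel_measurable (past (Suc 0))"
    by (rule past_cong[OF _ borel_measurable_fst_rows(1)[of "d 0"]]) (use run_eqs d in auto)
  then show ?case using X d by blast
next
  case (Suc t)
  then have X: "X t \<in> borel_measurable (past (Suc t))" and Y: "Y t \<in> borel_measurable (past (Suc t))"
    and L: "\<Lambda> t \<in> borel_measurable (past (Suc t))" and V: "V t \<in> borel_measurable (past (Suc t))"
    and d: "(\<lambda>\<omega>. d t \<omega> i) \<in> borel_measurable (past (Suc t))" for i
    using past_Suc by blast+
  have X': "X (Suc t) \<in> borel_measurable (past (Suc t))"
    by (rule past_cong[OF run_eqs(5) borel_measurable_prox_rows[OF g_cc g_dom step_sizes(1)]])
      (assumption, intro borel_measurable_diff borel_measurable_scaleR borel_measurable_const borel_measurable_linear[OF linear_matrix_mult X] V)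
  have Y': "Y (Suc t) \<in> borel_measurable (past (Suc t))"
    by (rule past_cong[OF run_eqs(7) borel_measurable_prox_rows[OF h_cc h_dom]])
      (assumption, use L_pos in simp, intro borel_measurable_add borel_measurable_diff borel_measurable_scaleR borel_measurable_const
        borel_measurable_linear[OF linear_matrix_mult L] Y borel_measurable_fst_rows(2) d)
  have L': "\<Lambda> (Suc t) \<in> borel_measurable (past (Suc t))"
    by (rule past_cong[OF run_eqs(6)])
      (simp, intro borel_measurable_add borel_measurable_scaleR borel_measurable_const borel_measurable_linear[OF linear_matrix_mult Y] L)
  have d': "(\<lambda>\<omega>. d (Suc t) \<omega> i) \<in> borel_measurable (past (Suc (Suc t)))" for i
    using d_measurable_restart[of "Suc t" i] d_measurable_inner[of t i] z_measurable X Y X' Y' d by blast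
  have V': "V (Suc t) \<in> borel_measurable (past (Suc (Suc t)))"
    by (rule past_cong[OF run_eqs(4)])
      (simp, intro borel_measurable_linear[OF linear_matrix_mult] borel_measurable_add borel_measurable_diff
        past_Suc[OF V] borel_measurable_fst_rows(1) d' past_Suc[OF d])
  show ?case using X' Y' L' d' V' by blast
qed

lemma measurable_M: "u \<in> borel_measurable (past t) \<Longrightarrow> u \<in> borel_measurable M"
  by (rule measurable_from_subalg[OF past_sub])

lemma z_past: "s \<le> t \<Longrightarrow> z s i \<in> borel_measurable (past t)"
  using process_measurable[of s] by (intro measurable_from_subalg[OF past_mono z_measurable]) auto

definition err where "err t i \<omega> = d t \<omega> i - grad (f i) (z t i \<omega>)"

lemma err_past: "err t i \<in> borel_measurable (past (Suc t))"
  unfolding err_def using process_measurable[of t] measurable_compose[OF z_past[of t "Suc t" i] grad_measurable[of i]]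
  by (intro borel_measurable_diff) auto

text \<open>Nothing is inherited from earlier iterations: the error is 0, or a mean of fresh
  centered samples to which the batch lemma applies with starting vector 0.\<close>

lemma err_restart:
  assumes t: "t mod q = 0"
  shows "nsq M (\<lambda>\<omega>. err t i \<omega>) \<le> ennreal \<Upsilon>"
proof (cases "\<forall>\<omega> z. batch_grad (sg i) (B i t \<omega>) z = grad (f i) z")
  case True
  then have "err t i \<omega> = 0" if "\<omega> \<in> space M" for \<omega> using that by (simp add: err_def z_def d_restart[OF _ t])
  then have "nsq M (\<lambda>\<omega>. err t i \<omega>) = (\<integral>\<^sup>+ \<omega>. 0 \<partial>M)" by (intro nn_integral_cong) simp
  then show ?thesis by simp
next
  case False
  then have B: "B i t \<omega> = map (\<lambda>k. \<xi> i t k \<omega>) [0..<b t]" for \<omega> using restart_batch[OF t] by blast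
  have n: "b t \<ge> 1" and v: "\<sigma>\<^sup>2 / real (b t) \<le> \<Upsilon>" using False restart_batch[OF t] by auto
  define \<psi> where "\<psi> u s = sg i u s - grad (f i) u" for u s
  have "err t i \<omega> = 0 + (1 / real (b t)) *\<^sub>R (\<Sum>k<b t. \<psi> (z t i \<omega>) (\<xi> i t k \<omega>))" if "\<omega> \<in> space M" for \<omega>
    using that n by (simp add: err_def \<psi>_def d_restart[OF _ t] B batch_grad_map z_def sum_subtractf scaleR_diff_right sum_constant_scaleR del: sum_constant)
  then have "nsq M (\<lambda>\<omega>. err t i \<omega>)
      = nsq M (\<lambda>\<omega>. 0 + (1 / real (b t)) *\<^sub>R (\<Sum>k<b t. \<psi> (z t i \<omega>) (\<xi> i t k \<omega>)))"
    by (intro nn_integral_cong) simp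
  also have "\<dots> \<le> nsq M (\<lambda>\<omega>. 0 :: (real ^ 'a) \<times> (real ^ 'b)) + ennreal (1 / real (b t)) * (\<integral>\<^sup>+ \<omega>. ennreal (\<sigma>\<^sup>2) \<partial>M)"
  proof (rule batch_second_moment[OF prob_D[of i] past_indep space_past sample, where S = borel])
    show "(\<lambda>(u, s). \<psi> u s) \<in> borel_measurable (borel \<Otimes>\<^sub>M D i)"
      unfolding \<psi>_def split_beta' using sg_meas[of i] measurable_compose[OF measurable_fst grad_measurable[of i]]
      by (intro borel_measurable_diff) (auto simp: split_beta')
    show "has_bochner_integral (D i) (\<psi> u) 0" for u
    proof -
      interpret Di: prob_space "D i" by (rule prob_D)
      have "has_bochner_integral (D i) (\<lambda>s. grad (f i) u) (grad (f i) u)"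
        by (simp add: has_bochner_integral_iff Di.prob_space)
      moreover have "\<psi> u = (\<lambda>s. sg i u s - grad (f i) u)" by (simp add: \<psi>_def fun_eq_iff)
      ultimately show ?thesis using has_bochner_integral_diff[OF sg_mean[of i u]] by fastforce
    qed
    show "nsq (D i) (\<lambda>s. \<psi> u s) \<le> ennreal (\<sigma>\<^sup>2)" for u unfolding \<psi>_def by (rule sg_var)
  qed (use n z_past in auto)
  also have "\<dots> = ennreal (\<sigma>\<^sup>2 / real (b t))" by (simp add: emeasure_space_1 flip: ennreal_mult')
  also have "\<dots> \<le> ennreal \<Upsilon>" using v by (rule ennreal_leI)
  finally show ?thesis .
qed

text \<open>The new error is the old one plus a batch mean of centered gradient differences. The old
  error belongs to the past, so second moments add; centering does not enlarge the second moment,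
  which mean-square smoothness bounds.\<close>

lemma err_inner:
  assumes t: "Suc t mod q \<noteq> 0"
  shows "nsq M (\<lambda>\<omega>. err (Suc t) i \<omega>)
    \<le> nsq M (\<lambda>\<omega>. err t i \<omega>)
      + ennreal (1 / real q) * (\<integral>\<^sup>+ \<omega>. ennreal (L\<^sup>2 * (norm (z (Suc t) i \<omega> - z t i \<omega>))\<^sup>2) \<partial>M)"
proof -
  note bq = inner_batch(2)[OF t]
  define \<psi> where "\<psi> u s = (sg i (fst u) s - sg i (snd u) s) - (grad (f i) (fst u) - grad (f i) (snd u))" for u s
  define p where "p \<omega> = (z (Suc t) i \<omega>, z t i \<omega>)" for \<omega>
  have "err (Suc t) i \<omega> = err t i \<omega> + (1 / real (b (Suc t))) *\<^sub>R (\<Sum>k<b (Suc t). \<psi> (p \<omega>) (\<xi> i (Suc t) k \<omega>))" if "\<omega> \<in> space M" for \<omega>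
    using that q bq by (simp add: err_def \<psi>_def p_def d_inner[OF _ t] inner_batch(1)[OF t] batch_grad_map z_def
        sum_subtractf scaleR_diff_right sum_constant_scaleR del: sum_constant)
  then have "nsq M (\<lambda>\<omega>. err (Suc t) i \<omega>)
      = nsq M (\<lambda>\<omega>. err t i \<omega> + (1 / real (b (Suc t))) *\<^sub>R (\<Sum>k<b (Suc t). \<psi> (p \<omega>) (\<xi> i (Suc t) k \<omega>)))"
    by (intro nn_integral_cong) simp
  also have "\<dots> \<le> nsq M (\<lambda>\<omega>. err t i \<omega>)
      + ennreal (1 / real (b (Suc t))) * (\<integral>\<^sup>+ \<omega>. ennreal (L\<^sup>2 * (norm (fst (p \<omega>) - snd (p \<omega>)))\<^sup>2) \<partial>M)"
  proof (rule batch_second_moment[OF prob_D[of i] past_indep space_past sample, where S = "borel \<Otimes>\<^sub>M borel"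
        and c = "\<lambda>u. ennreal (L\<^sup>2 * (norm (fst u - snd u))\<^sup>2)"])
    show "p \<in> measurable (past (Suc t)) (borel \<Otimes>\<^sub>M borel)"
      unfolding p_def using z_past[of "Suc t" "Suc t" i] z_past[of t "Suc t" i] by measurable
    have sg_c: "(\<lambda>x. sg i (l x) (snd x)) \<in> borel_measurable ((borel \<Otimes>\<^sub>M borel) \<Otimes>\<^sub>M D i)"
      if "l \<in> borel_measurable ((borel \<Otimes>\<^sub>M borel) \<Otimes>\<^sub>M D i)" for l
      by (rule sg_compose[OF that]) measurable
    note [measurable] = grad_measurable[of i]
    show "(\<lambda>(u, s). \<psi> u s) \<in> borel_measurable ((borel \<Otimes>\<^sub>M borel) \<Otimes>\<^sub>M D i)"
      unfolding \<psi>_def split_beta'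
      by (intro borel_measurable_diff sg_c measurable_compose[OF _ grad_measurable[of i]]) measurable
    show "has_bochner_integral (D i) (\<psi> u) 0" for u
    proof -
      interpret Di: prob_space "D i" by (rule prob_D)
      let ?c = "grad (f i) (fst u) - grad (f i) (snd u)"
      have "has_bochner_integral (D i) (\<lambda>s. ?c) ?c"
        by (simp add: has_bochner_integral_iff Di.prob_space)
      moreover have "\<psi> u = (\<lambda>s. (sg i (fst u) s - sg i (snd u) s) - ?c)" by (simp add: \<psi>_def fun_eq_iff)
      ultimately show ?thesis
        using has_bochner_integral_diff[OF has_bochner_integral_diff[OF sg_mean[of i "fst u"] sg_mean[of i "snd u"]]] by fastforce
    qed
    show "nsq (D i) (\<lambda>s. \<psi> u s) \<le> ennreal (L\<^sup>2 * (norm (fst u - snd u))\<^sup>2)" for u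
      unfolding \<psi>_def
      by (rule order_trans[OF centered_second_moment[OF prob_D has_bochner_integral_diff[OF sg_mean sg_mean]] sg_mss])
  qed (use q bq err_past in auto)
  finally show ?thesis by (simp add: p_def bq)
qed

lemma square_integrable_z:
  assumes "square_integrable M (X t)" "square_integrable M (Y t)"
  shows "square_integrable M (z t i)"
proof (rule square_integrable_bound[OF assms, of _ 1 1 0])
  show "z t i \<in> borel_measurable M" using z_past[of t t] by (intro measurable_M) simp
  fix \<omega>
  have "norm (z t i \<omega>) \<le> norm (X t \<omega> $ i) + norm (Y t \<omega> $ i)" unfolding z_def by (rule norm_Pair_le)
  then show "norm (z t i \<omega>) \<le> 1 * norm (X t \<omega>) + 1 * norm (Y t \<omega>) + 0"
    using Finite_Cartesian_Product.norm_nth_le[of "X t \<omega>" i] Finite_Cartesian_Product.norm_nth_le[of "Y t \<omega>" i] by simp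
qed

lemma square_integrable_d:
  assumes "square_integrable M (z t i)" "square_integrable M (err t i)"
  shows "square_integrable M (\<lambda>\<omega>. d t \<omega> i)"
proof (rule square_integrable_bound[OF assms, of _ L 1 "norm (grad (f i) 0)"])
  show "(\<lambda>\<omega>. d t \<omega> i) \<in> borel_measurable M" using process_measurable[of t] measurable_M by blast
  fix \<omega>
  have "d t \<omega> i = err t i \<omega> + (grad (f i) (z t i \<omega>) - grad (f i) 0) + grad (f i) 0" by (simp add: err_def)
  then have "norm (d t \<omega> i) \<le> norm (err t i \<omega>) + norm (grad (f i) (z t i \<omega>) - grad (f i) 0) + norm (grad (f i) 0)"
    by (metis norm_triangle_mono norm_triangle_ineq order_refl)
  then show "norm (d t \<omega> i) \<le> L * norm (z t i \<omega>) + 1 * norm (err t i \<omega>) + norm (grad (f i) 0)"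
    using smooth_lipschitz[OF f_smooth[of i], of "z t i \<omega>" 0] by simp
qed

text \<open>Later inequalities have terms of either sign, so they must be integrated over the reals.
  The induction follows the order of the algorithm: iterates are Lipschitz images of earlier
  quantities, finite steps give a finite estimator error, and this in turn bounds \<open>d\<close>
  and \<open>V\<close>.\<close>

lemma process_square_integrable:
  "square_integrable M (X t) \<and> square_integrable M (Y t) \<and> square_integrable M (\<Lambda> t) \<and> square_integrable M (V t)
   \<and> (\<forall>i. square_integrable M (err t i) \<and> square_integrable M (\<lambda>\<omega>. d t \<omega> i))"
proof (induction t)
  case 0
  have X: "square_integrable M (X 0)" "square_integrable M (Y 0)" "square_integrable M (\<Lambda> 0)"
    by (rule square_integrable_cong[OF square_integrable_const], erule run_eqs Lam_0)+
  have e: "square_integrable M (err 0 i)" for i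
    using err_past[THEN measurable_M] err_restart[of 0 i] by (intro square_integrableI_nn) (auto intro: le_less_trans)
  have d: "square_integrable M (\<lambda>\<omega>. d 0 \<omega> i)" for i by (intro square_integrable_d square_integrable_z X e)
  have "square_integrable M (V 0)"
    by (rule square_integrable_cong[OF square_integrable_rows[OF square_integrable_linear[OF linear_fst d]] run_eqs(3)])
  then show ?case using X e d by blast
next
  case (Suc t)
  then have X: "square_integrable M (X t)" and Y: "square_integrable M (Y t)" and L: "square_integrable M (\<Lambda> t)"
    and V: "square_integrable M (V t)" and e: "\<And>i. square_integrable M (err t i)" and d: "\<And>i. square_integrable M (\<lambda>\<omega>. d t \<omega> i)"
    by blast+
  have sc: "square_integrable M (\<lambda>\<omega>. c *\<^sub>R A \<omega>)" if "square_integrable M A" for c and A :: "'w \<Rightarrow> 'x::euclidean_space"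
    by (rule square_integrable_linear[OF _ that]) (rule linear_scaleR)
  note lin = square_integrable_linear[OF linear_matrix_mult]
  have X': "square_integrable M (X (Suc t))"
    by (rule square_integrable_cong[OF square_integrable_prox_rows[OF g_cc g_dom step_sizes(1)] run_eqs(5)])
      (intro square_integrable_add lin sc X V)
  have Y': "square_integrable M (Y (Suc t))"
    by (rule square_integrable_cong[OF square_integrable_prox_rows[OF h_cc h_dom] run_eqs(7)])
      (use L_pos in simp, intro square_integrable_add lin sc Y L square_integrable_rows square_integrable_linear[OF linear_snd d])
  have L': "square_integrable M (\<Lambda> (Suc t))"
    by (rule square_integrable_cong[OF _ run_eqs(6)]) (intro square_integrable_add lin sc Y L, assumption)
  have e': "square_integrable M (err (Suc t) i)" for i
  proof (rule square_integrableI_nn[OF err_past[THEN measurable_M]])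
    show "nsq M (\<lambda>\<omega>. err (Suc t) i \<omega>) < \<infinity>"
    proof (cases "Suc t mod q = 0")
      case True
      then show ?thesis using err_restart[of "Suc t" i] by (auto intro: le_less_trans)
    next
      case False
      have "square_integrable M (\<lambda>\<omega>. z (Suc t) i \<omega> - z t i \<omega>)"
        by (intro square_integrable_add square_integrable_z X Y X' Y')
      then have "(\<integral>\<^sup>+ \<omega>. ennreal (L\<^sup>2 * (norm (z (Suc t) i \<omega> - z t i \<omega>))\<^sup>2) \<partial>M) < \<infinity>"
        by (subst nn_integral_eq_integral) (auto simp: square_integrable_def)
      moreover have "nsq M (\<lambda>\<omega>. err t i \<omega>) < \<infinity>"
        using e[of i] by (subst nn_integral_eq_integral) (auto simp: square_integrable_def)
      ultimately show ?thesis using err_inner[OF False, of i]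
        by (auto intro!: le_less_trans[OF err_inner[OF False, of i]] simp: ennreal_mult_less_top)
    qed
  qed
  have d': "square_integrable M (\<lambda>\<omega>. d (Suc t) \<omega> i)" for i by (intro square_integrable_d square_integrable_z X' Y' e')
  have "square_integrable M (V (Suc t))"
    by (rule square_integrable_cong[OF _ run_eqs(4)])
      (intro square_integrable_add lin V square_integrable_rows square_integrable_linear[OF linear_fst d] square_integrable_linear[OF linear_fst d'], assumption)
  then show ?case using X' Y' L' d' e' by blast
qed

text \<open>Each agent is estimated separately and the results are added, so dependence between
  agents is harmless. The amortization is applied to the total over agents.\<close>

lemma spider_bound:
  "(\<Sum>t<T. \<integral>\<omega>. (norm (\<chi> i. d t \<omega> i - grad (f i) (X t \<omega> $ i, Y t \<omega> $ i)))\<^sup>2 \<partial>M)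
    \<le> real T * (m * \<Upsilon>) + L\<^sup>2 * ((\<Sum>t<T. \<integral>\<omega>. (norm (X (Suc t) \<omega> - X t \<omega>))\<^sup>2 \<partial>M) + (\<Sum>t<T. \<integral>\<omega>. (norm (Y (Suc t) \<omega> - Y t \<omega>))\<^sup>2 \<partial>M))"
proof -
  define R where "R t i = (\<integral>\<omega>. (norm (err t i \<omega>))\<^sup>2 \<partial>M)" for t i
  define \<Delta> where "\<Delta> t i = (\<integral>\<omega>. (norm (z (Suc t) i \<omega> - z t i \<omega>))\<^sup>2 \<partial>M)" for t i
  note sq = process_square_integrable
  have si_z: "square_integrable M (\<lambda>\<omega>. z (Suc t) i \<omega> - z t i \<omega>)" for t i
    using sq by (intro square_integrable_add square_integrable_z) auto
  have nnR: "nsq M (\<lambda>\<omega>. err t i \<omega>) = ennreal (R t i)" for t i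
    unfolding R_def using sq[of t] by (intro nn_integral_eq_integral) (auto simp: square_integrable_def)
  have nnD: "(\<integral>\<^sup>+ \<omega>. ennreal (L\<^sup>2 * (norm (z (Suc t) i \<omega> - z t i \<omega>))\<^sup>2) \<partial>M) = ennreal (L\<^sup>2 * \<Delta> t i)" for t i
    unfolding \<Delta>_def using si_z[of t i] by (subst nn_integral_eq_integral) (auto simp: square_integrable_def)
  have D0: "\<Delta> t i \<ge> 0" "R t i \<ge> 0" for t i by (simp_all add: \<Delta>_def R_def)
  have err_sum: "(\<integral>\<omega>. (norm (\<chi> i. d t \<omega> i - grad (f i) (X t \<omega> $ i, Y t \<omega> $ i)))\<^sup>2 \<partial>M) = (\<Sum>i\<in>UNIV. R t i)" for t
  proof -
    have "(norm (\<chi> i. d t \<omega> i - grad (f i) (X t \<omega> $ i, Y t \<omega> $ i)))\<^sup>2 = (\<Sum>i\<in>UNIV. (norm (err t i \<omega>))\<^sup>2)" for \<omega>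
      by (subst norm_sq_vec) (simp add: err_def z_def)
    then show ?thesis unfolding R_def using sq[of t] by (simp add: square_integrable_def)
  qed
  have \<Delta>_sum: "(\<Sum>i\<in>UNIV. \<Delta> t i) = (\<integral>\<omega>. (norm (X (Suc t) \<omega> - X t \<omega>))\<^sup>2 \<partial>M) + (\<integral>\<omega>. (norm (Y (Suc t) \<omega> - Y t \<omega>))\<^sup>2 \<partial>M)" for t
  proof -
    have si: "square_integrable M (\<lambda>\<omega>. X (Suc t) \<omega> - X t \<omega>)" "square_integrable M (\<lambda>\<omega>. Y (Suc t) \<omega> - Y t \<omega>)"
      using sq[of t] sq[of "Suc t"] by (auto intro: square_integrable_add)
    have "(\<Sum>i\<in>UNIV. (norm (z (Suc t) i \<omega> - z t i \<omega>))\<^sup>2) = (norm (X (Suc t) \<omega> - X t \<omega>))\<^sup>2 + (norm (Y (Suc t) \<omega> - Y t \<omega>))\<^sup>2" for \<omega>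
      by (simp add: z_def norm_Pair_sq norm_sq_rows sum.distrib)
    moreover have "(\<Sum>i\<in>UNIV. \<Delta> t i) = (\<integral>\<omega>. (\<Sum>i\<in>UNIV. (norm (z (Suc t) i \<omega> - z t i \<omega>))\<^sup>2) \<partial>M)"
      unfolding \<Delta>_def using si_z by (intro Bochner_Integration.integral_sum[symmetric]) (auto simp: square_integrable_def)
    ultimately show ?thesis using si by (simp add: square_integrable_def)
  qed
  have "(\<Sum>t<T. \<Sum>i\<in>UNIV. R t i) \<le> real T * (m * \<Upsilon>) + (\<Sum>t<T. L\<^sup>2 * (\<Sum>i\<in>UNIV. \<Delta> t i))"
  proof (rule spider_sum[OF q])
    show "0 \<le> L\<^sup>2 * (\<Sum>i\<in>UNIV. \<Delta> t i)" for t using D0 by (intro mult_nonneg_nonneg sum_nonneg) auto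
    show "(\<Sum>i\<in>UNIV. R t i) \<le> m * \<Upsilon>" if "t mod q = 0" for t
    proof -
      have "R t i \<le> \<Upsilon>" for i using err_restart[OF that, of i] Ups by (simp add: nnR)
      then have "(\<Sum>i\<in>UNIV. R t i) \<le> (\<Sum>i\<in>(UNIV::'m set). \<Upsilon>)" by (intro sum_mono)
      then show ?thesis by (simp add: m_card)
    qed
    show "(\<Sum>i\<in>UNIV. R (Suc t) i) \<le> (\<Sum>i\<in>UNIV. R t i) + L\<^sup>2 * (\<Sum>i\<in>UNIV. \<Delta> t i) / real q" if "Suc t mod q \<noteq> 0" for t
    proof -
      have "R (Suc t) i \<le> R t i + L\<^sup>2 * \<Delta> t i / real q" for i
        using err_inner[OF that, of i] D0 by (simp add: nnR nnD flip: ennreal_mult' ennreal_plus)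
      then have "(\<Sum>i\<in>UNIV. R (Suc t) i) \<le> (\<Sum>i\<in>UNIV. R t i + L\<^sup>2 * \<Delta> t i / real q)" by (intro sum_mono)
      then show ?thesis by (simp add: sum.distrib sum_distrib_left sum_divide_distrib)
    qed
  qed
  then show ?thesis by (simp add: err_sum \<Delta>_sum sum_distrib_left sum.distrib distrib_left)
qed

lemma step_square_integrable:
  "square_integrable M (\<lambda>\<omega>. X (Suc t) \<omega> - rep (row_avg (X t \<omega>)))"
  "square_integrable M (\<lambda>\<omega>. X (Suc t) \<omega> - W ** X t \<omega>)"
  "square_integrable M (\<lambda>\<omega>. perp (X t \<omega>))" "square_integrable M (\<lambda>\<omega>. perp (V t \<omega>))"
  "square_integrable M (\<lambda>\<omega>. \<Lambda> (Suc t) \<omega> - \<Lambda> t \<omega>)" "square_integrable M (\<lambda>\<omega>. X (Suc t) \<omega> - X t \<omega>)"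
  "square_integrable M (\<lambda>\<omega>. Y (Suc t) \<omega> - Y t \<omega>)"
proof -
  have lin_avg: "linear (\<lambda>Z :: real ^ 'a ^ 'm. rep (row_avg Z) :: real ^ 'a ^ 'm)"
    using linear_compose[OF linear_row_avg linear_rep] by (simp add: o_def)
  show "square_integrable M (\<lambda>\<omega>. X (Suc t) \<omega> - rep (row_avg (X t \<omega>)))"
    "square_integrable M (\<lambda>\<omega>. X (Suc t) \<omega> - W ** X t \<omega>)"
    "square_integrable M (\<lambda>\<omega>. perp (X t \<omega>))" "square_integrable M (\<lambda>\<omega>. perp (V t \<omega>))"
    "square_integrable M (\<lambda>\<omega>. \<Lambda> (Suc t) \<omega> - \<Lambda> t \<omega>)" "square_integrable M (\<lambda>\<omega>. X (Suc t) \<omega> - X t \<omega>)"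
    "square_integrable M (\<lambda>\<omega>. Y (Suc t) \<omega> - Y t \<omega>)"
    using process_square_integrable[of t] process_square_integrable[of "Suc t"]
    by (auto intro!: square_integrable_add square_integrable_linear[OF lin_avg] square_integrable_linear[OF linear_matrix_mult]
        square_integrable_linear[OF linear_perp])
qed

text \<open>Integrating the pathwise inequalities gives the hypotheses of
  \<open>combination\<close>; only the bound on the summed estimator error is genuinely
  probabilistic. Initial distance and gap are deterministic, since the starting points are
  fixed.\<close>

lemma expected_bound:
  fixes T :: nat
  assumes LP: "LP = L * sqrt (4 * \<kappa>\<^sup>2 + 1)"
    and \<eta>: "1 / \<eta> \<ge> 180 * LP / (1 - \<rho>)\<^sup>2" "1 / \<eta> \<ge> 20 * L * (12 * \<kappa>\<^sup>2 + 2 * \<kappa> + 5)"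
    and \<eta>': "1 / \<eta>' \<ge> 24 * L\<^sup>2 * (12 * \<kappa>\<^sup>2) / (5 * LP * (1 - \<rho>)\<^sup>2)" "1 / \<eta>' \<ge> 128 * L * \<kappa>\<^sup>2"
  defines "N1 \<equiv> \<Sum>t<T. \<integral>\<omega>. (norm (X (Suc t) \<omega> - rep (row_avg (X t \<omega>))))\<^sup>2 \<partial>M"
    and "N2 \<equiv> \<Sum>t<T. \<integral>\<omega>. (norm (X (Suc t) \<omega> - W ** X t \<omega>))\<^sup>2 \<partial>M"
    and "Sp \<equiv> \<Sum>t<T. \<integral>\<omega>. (norm (perp (X t \<omega>)))\<^sup>2 \<partial>M"
    and "Sv \<equiv> \<Sum>t<T. \<integral>\<omega>. (norm (perp (V t \<omega>)))\<^sup>2 \<partial>M"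
    and "Sl \<equiv> m * (\<Sum>t<T. \<integral>\<omega>. (norm (\<Lambda> (Suc t) \<omega> - \<Lambda> t \<omega>))\<^sup>2 \<partial>M)"
    and "v0 \<equiv> \<integral>\<omega>. (norm (perp (V 0 \<omega>)))\<^sup>2 \<partial>M"
    and "D0 \<equiv> (norm (Yo (rep x0) 0 - rep y0))\<^sup>2"
    and "\<delta>0 \<equiv> F (rep x0) 0 (Yo (rep x0) 0) - F (rep x0) 0 (rep y0)"
  shows "N1 / (4 * \<eta>) + Sl / (2 * \<eta>') + N2 / (4 * \<eta>) + 3 / (4 * \<eta>) * Sp + Sv / (60 * LP)
    \<le> potential x0 0 - m * \<phi>s + error_terms L LP \<kappa> \<rho> v0 D0 \<delta>0 (real T * (m * \<Upsilon>))"
proof -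
  define n1 where "n1 \<omega> = (\<Sum>t<T. (norm (X (Suc t) \<omega> - rep (row_avg (X t \<omega>))))\<^sup>2)" for \<omega>
  define n2 where "n2 \<omega> = (\<Sum>t<T. (norm (X (Suc t) \<omega> - W ** X t \<omega>))\<^sup>2)" for \<omega>
  define p where "p \<omega> = (\<Sum>t<T. (norm (perp (X t \<omega>)))\<^sup>2)" for \<omega>
  define v where "v \<omega> = (\<Sum>t<T. (norm (perp (V t \<omega>)))\<^sup>2)" for \<omega>
  define w where "w \<omega> = (norm (perp (V 0 \<omega>)))\<^sup>2" for \<omega>
  define l where "l \<omega> = (\<Sum>t<T. (sqrt m * norm (\<Lambda> (Suc t) \<omega> - \<Lambda> t \<omega>))\<^sup>2)" for \<omega>
  define e where "e \<omega> = (\<Sum>t<T. (norm (\<chi> i. d t \<omega> i - grad (f i) (X t \<omega> $ i, Y t \<omega> $ i)))\<^sup>2)" for \<omega>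
  define x where "x \<omega> = (\<Sum>t<T. (norm (X (Suc t) \<omega> - X t \<omega>))\<^sup>2)" for \<omega>
  define y where "y \<omega> = (\<Sum>t<T. (norm (Y (Suc t) \<omega> - Y t \<omega>))\<^sup>2)" for \<omega>
  define sd where "sd \<omega> = 4 * \<kappa> * D0 + 2 * \<kappa>\<^sup>2 / L\<^sup>2 * e \<omega> + 4 * \<kappa> * (1 + 8 * \<kappa>) * \<kappa>\<^sup>2 * (2 * x \<omega> + 2 * l \<omega>)" for \<omega>
  have pot: "(1 / (2 * \<eta>) - (L * (16 + 3 * \<kappa> + 26 * \<kappa>\<^sup>2) + 15 * LP)) * n1 \<omega> + n2 \<omega> / (2 * \<eta>)
        + (1 / \<eta>' - L * (26 * \<kappa>\<^sup>2 + 3 * \<kappa>)) * l \<omega>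
    \<le> (potential x0 0 - m * \<phi>s) + e \<omega> / (60 * L) + v \<omega> / (60 * LP)
      + L / (52 * \<kappa>\<^sup>2) * sd \<omega> + (1 / (2 * \<eta>) + L / 2 * (1 + \<kappa>)) * p \<omega>" (is "?A1 \<omega> \<le> ?B1 \<omega>")
    and gap: "3 * L * y \<omega> \<le> \<delta>0 + e \<omega> / (2 * L) + L / (8 * \<kappa>\<^sup>2) * sd \<omega> + 2 * L * \<kappa>\<^sup>2 * (2 * x \<omega> + 2 * l \<omega>)"
      (is "_ \<le> ?B2 \<omega>")
    and vb: "v \<omega> \<le> w \<omega> / (1 - \<rho>) + (6 * e \<omega> + 3 * L\<^sup>2 * (x \<omega> + y \<omega>)) / (1 - \<rho>)\<^sup>2" (is "_ \<le> ?B3 \<omega>")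
    and pv: "p \<omega> \<le> \<eta>\<^sup>2 * v \<omega> / (1 - \<rho>)\<^sup>2" and pn: "p \<omega> \<le> n1 \<omega>" and xb: "x \<omega> \<le> 2 * n1 \<omega> + 2 * p \<omega>"
    and d0: "0 \<le> \<delta>0"
    if \<omega>: "\<omega> \<in> space M" for \<omega>
  proof -
    interpret R: vrlm_run W \<rho> m L \<mu> \<kappa> f g h \<eta> \<eta>' LP \<phi>s
      "\<lambda>t. X t \<omega>" "\<lambda>t. V t \<omega>" "\<lambda>t. \<Lambda> t \<omega>" "\<lambda>t. Y t \<omega>" "\<lambda>t. d t \<omega>" x0 y0
      using run[OF \<omega>] .
    note defs = n1_def n2_def p_def v_def w_def l_def e_def x_def y_def R.seq_defs
    have D: "(R.D 0)\<^sup>2 = D0" by (simp add: R.D_def D0_def R.X_0 R.Y_0 Lam_0[OF \<omega>] norm_minus_commute)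
    have G: "R.gap 0 = \<delta>0" by (simp add: R.gap_def \<delta>0_def R.X_0 R.Y_0 Lam_0[OF \<omega>])
    have S: "R.SD T = sd \<omega>" unfolding R.SD_def D sd_def unfolding defs ..
    show "?A1 \<omega> \<le> ?B1 \<omega>" using R.run_potential[of T] unfolding S Lam_0[OF \<omega>] unfolding defs .
    show "3 * L * y \<omega> \<le> ?B2 \<omega>" using R.run_gap[of T] unfolding S G unfolding defs .
    show "v \<omega> \<le> ?B3 \<omega>" using R.run_v[of T] unfolding defs .
    show "p \<omega> \<le> \<eta>\<^sup>2 * v \<omega> / (1 - \<rho>)\<^sup>2" using R.run_p_v[of T] unfolding defs .
    show "p \<omega> \<le> n1 \<omega>" using R.run_p_n1[of T] unfolding defs .
    show "x \<omega> \<le> 2 * n1 \<omega> + 2 * p \<omega>" using R.run_x[of T] unfolding defs .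
    show "0 \<le> \<delta>0" using R.gap_nonneg[of 0] by (simp add: G)
  qed
  note sq = process_square_integrable
  note si = step_square_integrable
  have ie: "integrable M (\<lambda>\<omega>. (norm (\<chi> i. d t \<omega> i - grad (f i) (X t \<omega> $ i, Y t \<omega> $ i)))\<^sup>2)" for t
    using sq[of t] by (subst norm_sq_vec) (simp add: square_integrable_def err_def z_def)
  note si' = si[unfolded square_integrable_def, THEN conjunct2]
  have int: "integrable M n1" "integrable M n2" "integrable M p" "integrable M v" "integrable M w" "integrable M l"
    "integrable M e" "integrable M x" "integrable M y"
    unfolding n1_def n2_def p_def v_def w_def l_def e_def x_def y_def power_mult_distrib
    using si' ie by (auto intro!: Bochner_Integration.integrable_sum)
  have eqs: "integral\<^sup>L M n1 = N1" "integral\<^sup>L M n2 = N2" "integral\<^sup>L M p = Sp" "integral\<^sup>L M v = Sv" "integral\<^sup>L M w = v0"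
    "integral\<^sup>L M l = Sl"
    unfolding n1_def n2_def p_def v_def w_def l_def N1_def N2_def Sp_def Sv_def v0_def Sl_def power_mult_distrib
    using si' m_pos by (simp_all add: Bochner_Integration.integral_sum sum_distrib_left)
  define SE Sx Sb where "SE = integral\<^sup>L M e" and "Sx = integral\<^sup>L M x" and "Sb = integral\<^sup>L M y"
  have SE: "SE \<le> real T * (m * \<Upsilon>) + L\<^sup>2 * (Sx + Sb)"
    unfolding SE_def Sx_def Sb_def e_def x_def y_def
    using spider_bound[of T] si' ie by (simp add: Bochner_Integration.integral_sum)
  have nn: "0 \<le> N1" "0 \<le> N2" "0 \<le> Sp" "0 \<le> Sv" "0 \<le> Sl" "0 \<le> SE" "0 \<le> Sx" "0 \<le> Sb" "0 \<le> v0" "0 \<le> D0"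
    unfolding N1_def N2_def Sp_def Sv_def Sl_def v0_def D0_def SE_def Sx_def Sb_def e_def x_def y_def
    using m_pos by (auto intro!: sum_nonneg mult_nonneg_nonneg Bochner_Integration.integral_nonneg)
  define Sxl where "Sxl = 2 * Sx + 2 * Sl"
  define SD where "SD = 4 * \<kappa> * D0 + 2 * \<kappa>\<^sup>2 / L\<^sup>2 * SE + 4 * \<kappa> * (1 + 8 * \<kappa>) * \<kappa>\<^sup>2 * Sxl"
  note simps = eqs[symmetric] SE_def Sx_def Sb_def
  have sd: "integrable M sd" "integral\<^sup>L M sd = SD"
    unfolding sd_def[abs_def] SD_def Sxl_def simps using int by (simp_all add: prob_space)
  show ?thesis
  proof (rule combination[OF L_pos kappa_ge1 LP rho0 rho1 step_sizes(1) \<eta> step_sizes(2) \<eta>' nn(1-5) _ nn(6) nn(8) nn(7) nn(9) nn(10)])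
    show "0 \<le> SD" unfolding SD_def Sxl_def using nn kappa_ge1 by (intro add_nonneg_nonneg mult_nonneg_nonneg) auto
    show "0 \<le> \<delta>0" using d0 not_empty by blast
    show "0 \<le> real T * (m * \<Upsilon>)" using m_pos Ups by simp
    have "(\<integral>\<omega>. ?A1 \<omega> \<partial>M) \<le> (\<integral>\<omega>. ?B1 \<omega> \<partial>M)"
      using int sd by (intro integral_mono pot) auto
    then show "(1 / (2 * \<eta>) - (L * (16 + 3 * \<kappa> + 26 * \<kappa>\<^sup>2) + 15 * LP)) * N1 + N2 / (2 * \<eta>)
        + (1 / \<eta>' - L * (26 * \<kappa>\<^sup>2 + 3 * \<kappa>)) * Sl
        \<le> (potential x0 0 - m * \<phi>s) + SE / (60 * L) + Sv / (60 * LP) + L / (52 * \<kappa>\<^sup>2) * SD + (1 / (2 * \<eta>) + L / 2 * (1 + \<kappa>)) * Sp"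
      unfolding Sxl_def simps using int sd by (simp add: prob_space)
    show "SD \<le> 4 * \<kappa> * D0 + 2 * \<kappa>\<^sup>2 / L\<^sup>2 * SE + 4 * \<kappa> * (1 + 8 * \<kappa>) * \<kappa>\<^sup>2 * Sxl" by (simp add: SD_def)
    have "(\<integral>\<omega>. 3 * L * y \<omega> \<partial>M) \<le> (\<integral>\<omega>. ?B2 \<omega> \<partial>M)"
      using int sd by (intro integral_mono gap) auto
    then show "3 * L * Sb \<le> \<delta>0 + SE / (2 * L) + L / (8 * \<kappa>\<^sup>2) * SD + 2 * L * \<kappa>\<^sup>2 * Sxl"
      unfolding Sxl_def simps using int sd by (simp add: prob_space)
    have "(\<integral>\<omega>. v \<omega> \<partial>M) \<le> (\<integral>\<omega>. ?B3 \<omega> \<partial>M)"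
      using int by (intro integral_mono vb) auto
    then show "Sv \<le> v0 / (1 - \<rho>) + (6 * SE + 3 * L\<^sup>2 * (Sx + Sb)) / (1 - \<rho>)\<^sup>2"
      unfolding simps using int by simp
    have "(\<integral>\<omega>. p \<omega> \<partial>M) \<le> (\<integral>\<omega>. \<eta>\<^sup>2 * v \<omega> / (1 - \<rho>)\<^sup>2 \<partial>M)"
      using int by (intro integral_mono pv) auto
    then show "Sp \<le> \<eta>\<^sup>2 * Sv / (1 - \<rho>)\<^sup>2" unfolding simps using int by simp
    show "Sp \<le> N1" unfolding simps using int by (intro integral_mono pn) auto
    have "(\<integral>\<omega>. x \<omega> \<partial>M) \<le> (\<integral>\<omega>. 2 * n1 \<omega> + 2 * p \<omega> \<partial>M)" using int by (intro integral_mono xb) auto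
    then show "Sx \<le> 2 * N1 + 2 * Sp" unfolding simps using int by simp
    show "Sxl \<le> 2 * Sx + 2 * Sl" by (simp add: Sxl_def)
    show "SE \<le> real T * (m * \<Upsilon>) + L\<^sup>2 * (Sx + Sb)" by (rule SE)
  qed
qed

end

section \<open>The two sampling settings and the scaling back to the statement\<close>

lemma full_batch_grad:
  fixes G :: "'s \<Rightarrow> 'v::euclidean_space"
  assumes n: "n \<ge> 1" and D: "D = distr (uniform_count_measure {..<n}) (count_space (data ` {..<n})) data"
    and G: "has_bochner_integral D G c"
  shows "(1 / real n) *\<^sub>R (\<Sum>k<n. G (data k)) = (c :: 'v)"
proof -
  have d: "data \<in> measurable (uniform_count_measure {..<n}) (count_space (data ` {..<n}))"
    by (auto simp: measurable_def uniform_count_measure_def space_point_measure sets_point_measure)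
  have G': "G \<in> borel_measurable (count_space (data ` {..<n}))" by simp
  have "c = integral\<^sup>L D G" using G by (simp add: has_bochner_integral_iff)
  also have "\<dots> = (\<integral>k. G (data k) \<partial>uniform_count_measure {..<n})"
    unfolding D by (rule integral_distr[OF d G'])
  also have "\<dots> = (\<Sum>k<n. (1 / real n) *\<^sub>R G (data k))"
    unfolding uniform_count_measure_def by (subst lebesgue_integral_point_measure_finite) auto
  finally show ?thesis by (simp add: scaleR_sum_right)
qed

lemma le_recip:
  fixes c c' \<eta> :: real
  assumes "0 < \<eta>" "\<eta> \<le> 1 / c" "0 < c" "c' \<le> c"
  shows "c' \<le> 1 / \<eta>"
  using assms by (smt (verit) divide_le_eq_1_pos le_divide_eq mult.commute nonzero_eq_divide_eq)

theorem theorem3p1: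
  fixes M :: "'w measure"
    and D :: "'m::finite \<Rightarrow> 's measure"
    and ft :: "'m \<Rightarrow> (real ^ 'a) \<times> (real ^ 'b) \<Rightarrow> 's \<Rightarrow> real"
    and f :: "'m \<Rightarrow> (real ^ 'a) \<times> (real ^ 'b) \<Rightarrow> real"
    and sg :: "'m \<Rightarrow> (real ^ 'a) \<times> (real ^ 'b) \<Rightarrow> 's \<Rightarrow> (real ^ 'a) \<times> (real ^ 'b)"
    and g :: "real ^ 'a \<Rightarrow> ereal"
    and h :: "real ^ 'b \<Rightarrow> ereal"
    and W :: "real ^ 'm ^ 'm"
    and L \<mu> \<kappa> LP \<rho> \<sigma> \<phi>s \<eta>x \<eta>y \<eta>\<Lambda> \<Upsilon> :: real
    and \<xi> :: "'m \<Rightarrow> nat \<Rightarrow> nat \<Rightarrow> 'w \<Rightarrow> 's"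
    and B :: "'m \<Rightarrow> nat \<Rightarrow> 'w \<Rightarrow> 's list"
    and data :: "'m \<Rightarrow> nat \<Rightarrow> 's"
    and n S0 S1 S2 q T :: nat
    and x0 :: "real ^ 'a" and y0 :: "real ^ 'b"
    and X Xt Vx :: "nat \<Rightarrow> 'w \<Rightarrow> real ^ 'a ^ 'm"
    and \<Lambda> Y Vy :: "nat \<Rightarrow> 'w \<Rightarrow> real ^ 'b ^ 'm"
    and d :: "nat \<Rightarrow> 'w \<Rightarrow> 'm \<Rightarrow> (real ^ 'a) \<times> (real ^ 'b)"
  defines "m \<equiv> real CARD('m)"
  assumes prob_M: "prob_space M"
    and prob_D: "\<And>i. prob_space (D i)"
    and f_mean: "\<And>i z. has_bochner_integral (D i) (ft i z) (f i z)"
    and g_cc: "closed_convex_fun g" and h_cc: "closed_convex_fun h"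
    and A1_mu: "\<mu> > 0"
    and A1_concave: "\<And>i x. strongly_concave \<mu> (\<lambda>y. f i (x, y))"
    and A1_lower: "\<And>x \<Lambda>'. ereal \<phi>s \<le> phi L W f g h x \<Lambda>'"
    and A1_dom: "rel_interior (edom h) \<noteq> {}"
    and A2_null: "{v. (W - mat 1) *v v = 0} = span {vec 1}"
    and A2_stoch: "transpose W *v vec 1 = vec 1"
    and rho_def: "\<rho> = spectral_norm (W - (1 / m) *\<^sub>R (\<chi> i j. 1))"
    and A2_rho: "\<rho> < 1"
    and A2_norm: "spectral_norm (W - mat 1) \<le> 2"
    and A3_smooth: "\<And>i. smooth L (f i)"
    and A3_meas: "\<And>i. (\<lambda>(z, s). sg i z s) \<in> borel_measurable (borel \<Otimes>\<^sub>M D i)"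
    and A3_unbiased: "\<And>i z. has_bochner_integral (D i) (sg i z) (grad (f i) z)"
    and A3_var: "\<And>i z. (\<integral>\<^sup>+ s. ennreal ((norm (sg i z s - grad (f i) z))\<^sup>2) \<partial>D i)
                        \<le> ennreal (\<sigma>\<^sup>2)"
    and A3_mss: "\<And>i x y x' y'.
        (\<integral>\<^sup>+ s. ennreal ((norm (sg i (x, y) s - sg i (x', y') s))\<^sup>2) \<partial>D i)
          \<le> ennreal (L\<^sup>2 * ((norm (x - x'))\<^sup>2 + (norm (y - y'))\<^sup>2))"
    and kappa_def: "\<kappa> = L / \<mu>"
    and LP_def: "LP = L * sqrt (4 * \<kappa>\<^sup>2 + 1)"
    and S_pos: "S0 \<ge> 1" "S1 \<ge> 1" "S2 \<ge> 1"
    and q_def: "q = S2"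
    and eta_y: "\<eta>y = 1 / (4 * L)"
    and eta_x: "\<eta>x = min ((1 - \<rho>)\<^sup>2 / (180 * LP))
                         (1 / (20 * (L + 1) * (12 * \<kappa>\<^sup>2 + 2 * \<kappa> + 5)))"
    and eta_Lambda: "\<eta>\<Lambda> = min (5 * LP * (1 - \<rho>)\<^sup>2 / (24 * L\<^sup>2 * (12 * \<kappa>\<^sup>2 + \<kappa> + 1)))
                         (1 / (2 * LP + 128 * L * \<kappa>\<^sup>2
                               + (L + 1) * (20 * \<kappa>\<^sup>2 + \<kappa> + 1) / 2
                               + 4 * L\<^sup>2 * (12 * \<kappa>\<^sup>2 + \<kappa> + 1) / (30 * LP)))"
    and start: "x0 \<in> edom g" "y0 \<in> edom h"
    and setting:
      "(general_setting M D \<xi> q S0 S1 S2 B \<and> S1 \<le> S0 \<and> \<Upsilon> = \<sigma>\<^sup>2 / real S1) \<or>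
       (finite_sum_setting M D \<xi> q S0 S1 S2 n data B \<and> \<Upsilon> = 0)"
    and run: "\<And>\<omega>. \<omega> \<in> space M \<Longrightarrow>
        vrlm_spider L W g h sg q \<eta>x \<eta>y \<eta>\<Lambda> x0 y0 (\<lambda>i t. B i t \<omega>)
          (\<lambda>t. X t \<omega>) (\<lambda>t. Xt t \<omega>) (\<lambda>t. \<Lambda> t \<omega>) (\<lambda>t. Y t \<omega>) (\<lambda>t. d t \<omega>)
          (\<lambda>t. Vx t \<omega>) (\<lambda>t. Vy t \<omega>)"
    and T_pos: "T \<ge> 1"
  shows
    "ereal (1 / (4 * m * \<eta>x)) * (\<Sum>t<T. Esq M (\<lambda>\<omega>. X (t + 1) \<omega> - rep (row_avg (X t \<omega>))))
     + ereal (1 / (2 * \<eta>\<Lambda>)) * (\<Sum>t<T. Esq M (\<lambda>\<omega>. \<Lambda> (t + 1) \<omega> - \<Lambda> t \<omega>))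
     + ereal (1 / (4 * m * \<eta>x)) * (\<Sum>t<T. Esq M (\<lambda>\<omega>. X (t + 1) \<omega> - Xt t \<omega>))
     + ereal (3 / (4 * m * \<eta>x)) * (\<Sum>t<T. Esq M (\<lambda>\<omega>. perp (X t \<omega>)))
     + ereal (1 / (60 * m * LP)) * (\<Sum>t<T. Esq M (\<lambda>\<omega>. perp (Vx t \<omega>)))
     \<le> (phi L W f g h (row_avg (rep x0 :: real ^ 'a ^ 'm)) 0 - ereal \<phi>s
        + ereal (1 / (20 * m * LP) + \<rho> / (15 * m * LP * (1 - \<rho>))) * Esq M (\<lambda>\<omega>. perp (Vx 0 \<omega>))
        + ereal ((6 * (L + 1) / (64 * m * \<kappa>) + L\<^sup>2 / (120 * m * LP * \<kappa>)
                  + 3 * L\<^sup>2 / (10 * m * LP * \<kappa> * (1 - \<rho>)\<^sup>2))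
                 * (norm (Yopt L W f h (rep x0) 0 - rep y0))\<^sup>2)
        + ereal ((1 + 1 / L) / 8 + L / (30 * LP) + 6 * L / (5 * LP * (1 - \<rho>)\<^sup>2))
          * (Qmax L W f h (rep x0) 0 - Phi L W f h (rep x0) 0 (rep y0)))
       + ereal (real T * (1 / (30 * LP) + 1 / (LP * (1 - \<rho>)\<^sup>2) + (L + 1) / (8 * L\<^sup>2)) * \<Upsilon>)"
proof -
  interpret prob_space M by fact
  have h_dom: "edom h \<noteq> {}" using start by auto
  interpret minimax W \<rho> m L \<mu> \<kappa> f g h
    by unfold_locales
      (use A2_null A2_stoch rho_def A2_rho A2_norm A1_mu A3_smooth A1_concave g_cc h_cc h_dom kappa_def in \<open>auto simp: m_def\<close>)
  have LP0: "LP > 0" unfolding LP_def using L_pos by (auto intro!: mult_pos_pos add_nonneg_pos)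
  have s0: "(1 - \<rho>)\<^sup>2 > 0" using A2_rho by simp
  have \<kappa>0: "\<kappa> > 0" using kappa_ge1 by simp
  have c1: "20 * (L + 1) * (12 * \<kappa>\<^sup>2 + 2 * \<kappa> + 5) > 0" (is "?c1 > 0")
    using L_pos \<kappa>0 by (intro mult_pos_pos add_pos_pos) auto
  \<comment> \<open>All other summands of this denominator are nonnegative, so
    \<open>1 / \<eta>\<Lambda>\<close> inherits the summand as a lower bound.\<close>
  have c2: "2 * LP + 128 * L * \<kappa>\<^sup>2 + (L + 1) * (20 * \<kappa>\<^sup>2 + \<kappa> + 1) / 2 + 4 * L\<^sup>2 * (12 * \<kappa>\<^sup>2 + \<kappa> + 1) / (30 * LP) \<ge> 128 * L * \<kappa>\<^sup>2"
    (is "?c2 \<ge> _")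
    using L_pos \<kappa>0 LP0 by (auto intro!: add_nonneg_nonneg mult_nonneg_nonneg divide_nonneg_nonneg)
  have c2': "?c2 > 0" by (rule less_le_trans[OF _ c2]) (use L_pos \<kappa>0 in simp)
  have c3: "24 * L\<^sup>2 * (12 * \<kappa>\<^sup>2 + \<kappa> + 1) > 0" (is "?c3 > 0")
    using L_pos \<kappa>0 by (intro mult_pos_pos add_pos_pos) auto
  have e0: "\<eta>x > 0" unfolding eta_x using LP0 s0 c1 by simp
  have e0': "\<eta>\<Lambda> > 0" unfolding eta_Lambda using LP0 s0 c2' c3 by simp
  have ex1: "180 * LP / (1 - \<rho>)\<^sup>2 \<le> 1 / \<eta>x"
    by (rule le_recip[OF e0, where c = "180 * LP / (1 - \<rho>)\<^sup>2"]) (use LP0 s0 in \<open>simp_all add: eta_x\<close>)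
  have ex2: "20 * L * (12 * \<kappa>\<^sup>2 + 2 * \<kappa> + 5) \<le> 1 / \<eta>x"
  proof (rule le_recip[OF e0 _ c1])
    show "20 * L * (12 * \<kappa>\<^sup>2 + 2 * \<kappa> + 5) \<le> ?c1" using \<kappa>0 by (intro mult_right_mono) auto
  qed (simp add: eta_x)
  have el1: "24 * L\<^sup>2 * (12 * \<kappa>\<^sup>2) / (5 * LP * (1 - \<rho>)\<^sup>2) \<le> 1 / \<eta>\<Lambda>"
  proof (rule le_recip[OF e0'])
    show "\<eta>\<Lambda> \<le> 1 / (?c3 / (5 * LP * (1 - \<rho>)\<^sup>2))" by (simp add: eta_Lambda)
    show "0 < ?c3 / (5 * LP * (1 - \<rho>)\<^sup>2)" using c3 LP0 s0 by simp
    show "24 * L\<^sup>2 * (12 * \<kappa>\<^sup>2) / (5 * LP * (1 - \<rho>)\<^sup>2) \<le> ?c3 / (5 * LP * (1 - \<rho>)\<^sup>2)"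
      using LP0 \<kappa>0 by (intro divide_right_mono mult_left_mono) auto
  qed
  have el2: "128 * L * \<kappa>\<^sup>2 \<le> 1 / \<eta>\<Lambda>"
    by (rule le_recip[OF e0' _ c2' c2]) (simp add: eta_Lambda)
  have q1: "q \<ge> 1" using S_pos q_def by simp
  have mss: "(\<integral>\<^sup>+ s. ennreal ((norm (sg i z s - sg i z' s))\<^sup>2) \<partial>D i) \<le> ennreal (L\<^sup>2 * (norm (z - z'))\<^sup>2)" for i z z'
    using A3_mss[of i "fst z" "snd z" "fst z'" "snd z'"] by (simp add: norm_prod_def)
  \<comment> \<open>Both settings are cast into the form of \<open>vrlm_process\<close>. In the
    general one, \<open>S1 \<le> S0\<close> makes the initial batch at least as accurate as later
    restarts.\<close>
  obtain b where b: "fresh_iid M D \<xi> b"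
    "\<And>i t \<omega>. t mod q \<noteq> 0 \<Longrightarrow> B i t \<omega> = map (\<lambda>k. \<xi> i t k \<omega>) [0..<b t]" "\<And>t. t mod q \<noteq> 0 \<Longrightarrow> b t = q"
    "\<And>t. t mod q = 0 \<Longrightarrow> (\<forall>i \<omega> z. batch_grad (sg i) (B i t \<omega>) z = grad (f i) z)
        \<or> (\<forall>i \<omega>. B i t \<omega> = map (\<lambda>k. \<xi> i t k \<omega>) [0..<b t]) \<and> b t \<ge> 1 \<and> \<sigma>\<^sup>2 / real (b t) \<le> \<Upsilon>"
    and Ups: "\<Upsilon> \<ge> 0"
    using setting
  proof
    assume *: "general_setting M D \<xi> q S0 S1 S2 B \<and> S1 \<le> S0 \<and> \<Upsilon> = \<sigma>\<^sup>2 / real S1"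
    define b where "b t = (if t = 0 then S0 else if t mod q = 0 then S1 else S2)" for t :: nat
    have le: "\<sigma>\<^sup>2 / real S0 \<le> \<sigma>\<^sup>2 / real S1" using * S_pos by (intro divide_left_mono) auto
    have bB: "fresh_iid M D \<xi> b" "\<And>i t \<omega>. B i t \<omega> = map (\<lambda>k. \<xi> i t k \<omega>) [0..<b t]"
      using * by (auto simp: general_setting_def Let_def b_def[abs_def])
    show thesis
      by (rule that[of b]) (use bB * S_pos le q_def in \<open>auto simp: b_def\<close>)
  next
    assume *: "finite_sum_setting M D \<xi> q S0 S1 S2 n data B \<and> \<Upsilon> = 0"
    \<comment> \<open>A restart uses the stored data and draws nothing, hence the value 0
      there.\<close>
    define b where "b t = (if t mod q = 0 then 0 else S2)" for t :: nat
    have n: "n \<ge> 1" and Dd: "\<And>i. D i = distr (uniform_count_measure {..<n}) (count_space (data i ` {..<n})) (data i)"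
      and fr: "fresh_iid M D \<xi> b"
      and BB: "\<And>i t \<omega>. B i t \<omega> = (if t mod q = 0 then map (data i) [0..<n] else map (\<lambda>k. \<xi> i t k \<omega>) [0..<S2])"
      using * S_pos by (auto simp: finite_sum_setting_def b_def[abs_def])
    \<comment> \<open>Under the law of a uniformly chosen data index, expectation is the average
      over the data with multiplicity, so unbiasedness says that the full batch is exact.\<close>
    have full: "batch_grad (sg i) (map (data i) [0..<n]) z = grad (f i) z" for i z
      unfolding batch_grad_map using full_batch_grad[OF n Dd A3_unbiased] .
    show thesis
      by (rule that[of b]) (use BB full fr * q_def in \<open>auto simp: b_def\<close>)
  qed
  have spider: "vrlm_spider L W g h sg q \<eta>x \<eta>y \<eta>\<Lambda> x0 y0 (\<lambda>i t. B i t \<omega>)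
          (\<lambda>t. X t \<omega>) (\<lambda>t. Xt t \<omega>) (\<lambda>t. \<Lambda> t \<omega>) (\<lambda>t. Y t \<omega>) (\<lambda>t. d t \<omega>)
          (\<lambda>t. Vx t \<omega>) (\<lambda>t. Vy t \<omega>)" if "\<omega> \<in> space M" for \<omega>
    using run that .
  have d_eq: "d t \<omega> i = (if t mod q = 0 then batch_grad (sg i) (B i t \<omega>) (X t \<omega> $ i, Y t \<omega> $ i)
         else batch_grad (sg i) (B i t \<omega>) (X t \<omega> $ i, Y t \<omega> $ i)
              - batch_grad (sg i) (B i t \<omega>) (X (t - 1) \<omega> $ i, Y (t - 1) \<omega> $ i)
              + d (t - 1) \<omega> i)" if "\<omega> \<in> space M" for t \<omega> i
    using spider[OF that] unfolding vrlm_spider_def by blast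
  have run': "vrlm_run W \<rho> m L \<mu> \<kappa> f g h \<eta>x \<eta>\<Lambda> LP \<phi>s
        (\<lambda>t. X t \<omega>) (\<lambda>t. Vx t \<omega>) (\<lambda>t. \<Lambda> t \<omega>) (\<lambda>t. Y t \<omega>) (\<lambda>t. d t \<omega>) x0 y0" if "\<omega> \<in> space M" for \<omega>
  proof -
    note * = spider[OF that, unfolded vrlm_spider_def, folded m_def]
    have "Y (Suc t) \<omega> = dualstep (\<Lambda> t \<omega>) (Y t \<omega>) (\<chi> i. snd (d t \<omega> i))" for t
      using * by (simp add: dualstep_def eta_y)
    then show ?thesis
      by unfold_locales (use * e0 e0' LP0 start A1_lower in auto)
  qed
  have d_inner: "d (Suc t) \<omega> i = batch_grad (sg i) (B i (Suc t) \<omega>) (X (Suc t) \<omega> $ i, Y (Suc t) \<omega> $ i)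
        - batch_grad (sg i) (B i (Suc t) \<omega>) (X t \<omega> $ i, Y t \<omega> $ i) + d t \<omega> i"
    if "\<omega> \<in> space M" "Suc t mod q \<noteq> 0" for t \<omega> i
    using d_eq[OF that(1), of "Suc t" i] that(2) by simp
  have \<Lambda>0: "\<Lambda> 0 \<omega> = 0" if "\<omega> \<in> space M" for \<omega>
    using spider[OF that] by (simp add: vrlm_spider_def)
  interpret vrlm_process M W \<rho> m L \<mu> \<kappa> f g h \<eta>x \<eta>\<Lambda> LP \<phi>s \<sigma> \<Upsilon> q b D sg \<xi> B X Vx \<Lambda> Y d x0 y0
    by (intro vrlm_process.intro vrlm_process_axioms.intro)
      (fact prob_M minimax_axioms q1 Ups prob_D A3_meas A3_unbiased A3_var mss b run' \<Lambda>0 d_inner | simp add: d_eq)+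
  note bound = expected_bound[OF LP_def ex1 ex2 el1 el2, of T]
  define N1 N2 Sp Sv Sl v0 D0 FQ FP where
    "N1 = (\<Sum>t<T. \<integral>\<omega>. (norm (X (Suc t) \<omega> - rep (row_avg (X t \<omega>))))\<^sup>2 \<partial>M)"
    and "N2 = (\<Sum>t<T. \<integral>\<omega>. (norm (X (Suc t) \<omega> - W ** X t \<omega>))\<^sup>2 \<partial>M)"
    and "Sp = (\<Sum>t<T. \<integral>\<omega>. (norm (perp (X t \<omega>)))\<^sup>2 \<partial>M)"
    and "Sv = (\<Sum>t<T. \<integral>\<omega>. (norm (perp (Vx t \<omega>)))\<^sup>2 \<partial>M)"
    and "Sl = (\<Sum>t<T. \<integral>\<omega>. (norm (\<Lambda> (Suc t) \<omega> - \<Lambda> t \<omega>))\<^sup>2 \<partial>M)"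
    and "v0 = (\<integral>\<omega>. (norm (perp (Vx 0 \<omega>)))\<^sup>2 \<partial>M)"
    and "D0 = (norm (Yo (rep x0) 0 - rep y0))\<^sup>2"
    and "FQ = F (rep x0) 0 (Yo (rep x0) 0)" and "FP = F (rep x0) 0 (rep y0)"
  note bound = bound[folded N1_def N2_def Sp_def Sv_def Sl_def v0_def D0_def FQ_def FP_def]
  have E: "(\<Sum>t<T. Esq M (\<lambda>\<omega>. X (t + 1) \<omega> - rep (row_avg (X t \<omega>)))) = ereal N1"
    "(\<Sum>t<T. Esq M (\<lambda>\<omega>. \<Lambda> (t + 1) \<omega> - \<Lambda> t \<omega>)) = ereal Sl"
    "(\<Sum>t<T. Esq M (\<lambda>\<omega>. perp (X t \<omega>))) = ereal Sp" "(\<Sum>t<T. Esq M (\<lambda>\<omega>. perp (Vx t \<omega>))) = ereal Sv"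
    "Esq M (\<lambda>\<omega>. perp (Vx 0 \<omega>)) = ereal v0"
    by (simp_all add: Esq_eq_integral[OF step_square_integrable(1)] Esq_eq_integral[OF step_square_integrable(3)]
        Esq_eq_integral[OF step_square_integrable(4)] Esq_eq_integral[OF step_square_integrable(5)]
        N1_def Sp_def Sv_def Sl_def v0_def)
  have E2: "(\<Sum>t<T. Esq M (\<lambda>\<omega>. X (t + 1) \<omega> - Xt t \<omega>)) = ereal N2"
  proof -
    \<comment> \<open>The equation for \<open>Xt\<close> is known on \<open>space M\<close> only, so
      it is used under the integral.\<close>
    have "Esq M (\<lambda>\<omega>. X (t + 1) \<omega> - Xt t \<omega>) = Esq M (\<lambda>\<omega>. X (Suc t) \<omega> - W ** X t \<omega>)" for t
      unfolding Esq_def using spider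
      by (intro arg_cong[where f = enn2ereal] nn_integral_cong) (simp add: vrlm_spider_def)
    then show ?thesis by (simp add: Esq_eq_integral[OF step_square_integrable(2)] N2_def)
  qed
  have yd: "ydom (rep y0)" using start by (simp add: ydom_def)
  have P: "phi L W f g h (row_avg (rep x0 :: real ^ 'a ^ 'm)) 0 = ereal (potential x0 0 / m)"
    using phi_eq_F[OF start(1), of 0] by (simp add: potential_def)
  have Q: "Qmax L W f h (rep x0) 0 = ereal (FQ / m)" "Phi L W f h (rep x0) 0 (rep y0) = ereal (FP / m)"
    by (simp_all add: Qmax_eq_F Phi_eq_F[OF yd] FQ_def FP_def)
  let ?cv = "1 / (20 * LP) + \<rho> / (15 * LP * (1 - \<rho>))" and ?cd = "(1 + 1 / L) / 8 + L / (30 * LP) + 6 * L / (5 * LP * (1 - \<rho>)\<^sup>2)"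
    and ?cU = "1 / (30 * LP) + 1 / (LP * (1 - \<rho>)\<^sup>2) + (L + 1) / (8 * L\<^sup>2)"
    and ?cD = "6 * (L + 1) / (64 * \<kappa>) + L\<^sup>2 / (120 * LP * \<kappa>) + 3 * L\<^sup>2 / (10 * LP * \<kappa> * (1 - \<rho>)\<^sup>2)"
  \<comment> \<open>Back to the unscaled objective: the coefficients of the initial tracking error
    and distance acquire \<open>1 / m\<close>, whereas gap and noise already contain
    \<open>m\<close> and give it back.\<close>
  have distr: "(a + (c1 * u1 + c2 * u2 + c3 * u3 + c4 * u4)) / m = a / m + c1 / m * u1 + c2 / m * u2 + c3 * (u3 / m) + c4 * (u4 / m)"
    for a c1 c2 c3 c4 u1 u2 u3 u4 :: real by (simp add: add_divide_distrib)
  have "1 / (4 * m * \<eta>x) * N1 + 1 / (2 * \<eta>\<Lambda>) * Sl + 1 / (4 * m * \<eta>x) * N2 + 3 / (4 * m * \<eta>x) * Sp + 1 / (60 * m * LP) * Sv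
    = (N1 / (4 * \<eta>x) + m * Sl / (2 * \<eta>\<Lambda>) + N2 / (4 * \<eta>x) + 3 / (4 * \<eta>x) * Sp + Sv / (60 * LP)) / m"
    using m_pos by (simp add: add_divide_distrib mult_ac)
  also have "\<dots> \<le> (potential x0 0 - m * \<phi>s + error_terms L LP \<kappa> \<rho> v0 D0 (FQ - FP) (real T * (m * \<Upsilon>))) / m"
    using bound m_pos by (intro divide_right_mono) auto
  also have "\<dots> = (potential x0 0 - m * \<phi>s) / m + (?cv / m) * v0
      + (?cD / m) * D0
      + ?cd * ((FQ - FP) / m)
      + ?cU * (real T * (m * \<Upsilon>) / m)"
    unfolding error_terms_def by (rule distr)
  also have "(potential x0 0 - m * \<phi>s) / m = potential x0 0 / m - \<phi>s" using m_pos by (simp add: diff_divide_distrib)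
  also have "?cv / m = 1 / (20 * m * LP) + \<rho> / (15 * m * LP * (1 - \<rho>))"
    by (simp add: add_divide_distrib mult_ac)
  also have "?cD / m
    = 6 * (L + 1) / (64 * m * \<kappa>) + L\<^sup>2 / (120 * m * LP * \<kappa>) + 3 * L\<^sup>2 / (10 * m * LP * \<kappa> * (1 - \<rho>)\<^sup>2)"
    by (simp only: add_divide_distrib[of _ _ m] divide_divide_eq_left mult_ac)
  also have "(FQ - FP) / m = FQ / m - FP / m" by (rule diff_divide_distrib)
  also have "real T * (m * \<Upsilon>) / m = real T * \<Upsilon>" using m_pos by simp
  finally have final: "1 / (4 * m * \<eta>x) * N1 + 1 / (2 * \<eta>\<Lambda>) * Sl + 1 / (4 * m * \<eta>x) * N2 + 3 / (4 * m * \<eta>x) * Sp + 1 / (60 * m * LP) * Sv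
    \<le> (potential x0 0 / m - \<phi>s + (1 / (20 * m * LP) + \<rho> / (15 * m * LP * (1 - \<rho>))) * v0
      + (6 * (L + 1) / (64 * m * \<kappa>) + L\<^sup>2 / (120 * m * LP * \<kappa>) + 3 * L\<^sup>2 / (10 * m * LP * \<kappa> * (1 - \<rho>)\<^sup>2)) * D0
      + ?cd * (FQ / m - FP / m))
      + real T * ?cU * \<Upsilon>"
    by (simp only: mult_ac)
  show ?thesis
    unfolding E E2 P Q D0_def[symmetric] times_ereal.simps plus_ereal.simps ereal_minus(1) ereal_less_eq(3)
    by (rule final)
qed

end
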